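(* Let $T>0$, $\Omega=[0,1]\times[0,T]$, $M:\Omega\times\mathbb R\to\mathbb R$, and $Lv=\frac{\partial^2v}{\partial t^2}-\frac{\partial^2v}{\partial x^2}$. Suppose $\{(x_i,t_i)\}_{i=1}^\infty$ is dense in $\Omega$. If $u\in W(\Omega)$ is the solution of $$Lu(x,t)=M(x,t,u(x,t)),\quad (x,t)\in\Omega,\qquad u(x,0)=\frac{\partial u}{\partial t}(x,0)=u(0,t)=u(1,t)=0,$$ then $$u(x,t)=\sum_{i=1}^\infty\sum_{k=1}^i\beta_{ik}\,M\big(x_k,t_k,u(x_k,t_k)\big)\,\widehat\Psi_i(x,t),$$ the series in $i$ converging in $W(\Omega)$, where $\widehat\Psi_i=\sum_{k=1}^i\beta_{ik}\Psi_k$ is the orthonormal system obtained by Gram–Schmidt orthogonalization in $W(\Omega)$ of $\Psi_i=L^*G_{(x_i,t_i)}$, $G$ being the reproducing kernel of $\widehat W(\Omega)$ and $L^*$ the adjoint of $L:W(\Omega)\to\widehat W(\Omega)$.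
   Context: All functions are real-valued. A function $w$ on $\Omega$ is "completely continuous" if it is absolutely continuous in the two-variable sense, i.e. $w(x,t)=a+\int_0^xb(\xi)d\xi+\int_0^tc(\eta)d\eta+\int_0^x\int_0^td(\xi,\eta)\,d\eta\,d\xi$ for a constant $a$ and integrable functions $b,c,d$. $W_2^3[0,1]$: functions $u$ on $[0,1]$ with $u,u',u''$ absolutely continuous, $u^{(3)}\in L^2[0,1]$, $u(0)=u(1)=0$, with $\langle u,g\rangle_{W_2^3}=u(0)g(0)+u'(0)g'(0)+u'(1)g'(1)+\int_0^1u^{(3)}g^{(3)}dx$. $W_2^1[0,1]$: absolutely continuous $u$ on $[0,1]$ with $u'\in L^2[0,1]$, with $\langle u,g\rangle_{W_2^1}=u(0)g(0)+\int_0^1u'g'dx$. $W(\Omega)$: functions $u(x,t)$ on $\Omega$ such that $\frac{\partial^4u}{\partial x^2\partial t^2}$ is completely continuous on $\Omega$, $\frac{\partial^6u}{\partial x^3\partial t^3}\in L^2(\Omega)$, and $u(x,0)=0$, $\frac{\partial u}{\partial t}(x,0)=0$, $u(0,t)=0$, $u(1,t)=0$; it is equipped with $$\langle u,g\rangle_W=\sum_{i=0}^2\int_0^T\frac{\partial^3}{\partial t^3}\frac{\partial^i}{\partial x^i}u(0,t)\,\frac{\partial^3}{\partial t^3}\frac{\partial^i}{\partial x^i}g(0,t)\,dt+\sum_{j=0}^2\Big\langle\frac{\partial^j}{\partial t^j}u(\cdot,0),\frac{\partial^j}{\partial t^j}g(\cdot,0)\Big\rangle_{W_2^3}+\int_0^1\!\!\int_0^T\frac{\partial^6u}{\partial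 x^3\partial t^3}\,\frac{\partial^6g}{\partial x^3\partial t^3}\,dt\,dx.$$ $\widehat W(\Omega)$: completely continuous functions $u(x,t)$ on $\Omega$ with $\frac{\partial^2u}{\partial x\partial t}\in L^2(\Omega)$, equipped with $$\langle u,g\rangle_{\widehat W}=\int_0^T\frac{\partial}{\partial t}u(0,t)\frac{\partial}{\partial t}g(0,t)\,dt+\langle u(\cdot,0),g(\cdot,0)\rangle_{W_2^1}+\int_0^1\!\!\int_0^T\frac{\partial^2u}{\partial x\partial t}\frac{\partial^2g}{\partial x\partial t}\,dt\,dx.$$ It is understood that membership in $W(\Omega)$, $\widehat W(\Omega)$ includes that every term of the corresponding inner product is defined and finite. $W(\Omega)$ and $\widehat W(\Omega)$ are reproducing kernel Hilbert spaces, and $L:W(\Omega)\to\widehat W(\Omega)$ is a bounded linear operator. $G_{(y,s)}(x,t)=(1+\min(x,y))(1+\min(t,s))$ is the reproducing kernel of $\widehat W(\Omega)$: $u(y,s)=\langle u,G_{(y,s)}\rangle_{\widehat W}$ for all $u\in\widehat W(\Omega)$. Gram–Schmidt convention: $\widehat\Psi_i=\sum_{k=1}^i\beta_{ik}\Psi_k$ are the normalized Gram–Schmidt vectors of $(\Psi_i)$ with real coefficients $\beta_{ik}$; if $\Psi_i$ lies in the span of $\Psi_1,\dots,\Psi_{i-1}$ (or is $0$), the index $i$ contributes nothing, i.e. $\widehat\Psi_i=0$ and $\beta_{ik}=0$ for all $k\le i$. The nonzero $\widehat\Psi_i$ are orthonormal. The problem for $u$ arises from the one-dimensional sine-Gordon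 problem $u_{tt}=u_{xx}-\sin u$ after homogenizing its initial and boundary conditions; $M$ denotes the resulting right-hand side. *)

theory Defs
  imports "HOL-Analysis.Analysis"
begin

text \<open>
  Functions on \<open>\<Omega> = [0,1] \<times> [0,T]\<close> are curried, \<open>u x t\<close>; their values outside \<open>\<Omega>\<close> are
  irrelevant to every notion below. All derivatives are pointwise derivatives taken within the
  closed intervals (hence one-sided at endpoints). \<^const>\<open>vector_derivative\<close> is total, so
  existence is asserted separately wherever it is part of the mathematics. Derivatives of highest
  order exist only almost everywhere and are used only under integrals.
\<close>

definition Omega :: "real \<Rightarrow> (real \<times> real) set" where
  "Omega T = {0..1} \<times> {0..T}"

definition D01 :: "(real \<Rightarrow> real) \<Rightarrow> real \<Rightarrow> real" where
  "D01 f x = vector_derivative f (at x within {0..1})"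

definition dX :: "(real \<Rightarrow> real \<Rightarrow> real) \<Rightarrow> real \<Rightarrow> real \<Rightarrow> real" where
  "dX u x t = vector_derivative (\<lambda>\<xi>. u \<xi> t) (at x within {0..1})"

definition dT :: "real \<Rightarrow> (real \<Rightarrow> real \<Rightarrow> real) \<Rightarrow> real \<Rightarrow> real \<Rightarrow> real" where
  "dT T u x t = vector_derivative (\<lambda>\<tau>. u x \<tau>) (at t within {0..T})"

definition diffX :: "real \<Rightarrow> (real \<Rightarrow> real \<Rightarrow> real) \<Rightarrow> bool" where
  "diffX T u \<longleftrightarrow>
     (\<forall>x\<in>{0..1}. \<forall>t\<in>{0..T}. (\<lambda>\<xi>. u \<xi> t) differentiable (at x within {0..1}))"

definition diffT :: "real \<Rightarrow> (real \<Rightarrow> real \<Rightarrow> real) \<Rightarrow> bool" where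
  "diffT T u \<longleftrightarrow>
     (\<forall>x\<in>{0..1}. \<forall>t\<in>{0..T}. (\<lambda>\<tau>. u x \<tau>) differentiable (at t within {0..T}))"

definition L2_on :: "'a::euclidean_space set \<Rightarrow> ('a \<Rightarrow> real) \<Rightarrow> bool" where
  "L2_on S f \<longleftrightarrow> f \<in> borel_measurable (lebesgue_on S) \<and> integrable (lebesgue_on S) (\<lambda>x. (f x)\<^sup>2)"

text \<open>Absolute continuity on \<open>[0,1]\<close>: being an indefinite Lebesgue integral, in parallel to the
  two-variable notion that follows.\<close>

definition abs_cont01 :: "(real \<Rightarrow> real) \<Rightarrow> bool" where
  "abs_cont01 f \<longleftrightarrow> (\<exists>g. integrable (lebesgue_on {0..1}) g \<and>
     (\<forall>x\<in>{0..1}. f x = f 0 + (LINT \<xi>|lebesgue_on {0..x}. g \<xi>)))"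

definition completely_continuous :: "real \<Rightarrow> (real \<Rightarrow> real \<Rightarrow> real) \<Rightarrow> bool" where
  "completely_continuous T w \<longleftrightarrow>
     (\<exists>a b c d. integrable (lebesgue_on {0..1}) b \<and> integrable (lebesgue_on {0..T}) c \<and>
        integrable (lebesgue_on (Omega T)) d \<and>
        (\<forall>x\<in>{0..1}. \<forall>t\<in>{0..T}.
           w x t = a + (LINT \<xi>|lebesgue_on {0..x}. b \<xi>) + (LINT \<eta>|lebesgue_on {0..t}. c \<eta>)
                     + (LINT q|lebesgue_on ({0..x} \<times> {0..t}). d q)))"

definition W23 :: "(real \<Rightarrow> real) set" where
  "W23 = {f. (\<forall>x\<in>{0..1}. f differentiable (at x within {0..1})) \<and>
             (\<forall>x\<in>{0..1}. D01 f differentiable (at x within {0..1})) \<and>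
             abs_cont01 f \<and> abs_cont01 (D01 f) \<and> abs_cont01 ((D01 ^^ 2) f) \<and>
             L2_on {0..1} ((D01 ^^ 3) f) \<and> f 0 = 0 \<and> f 1 = 0}"

definition inner_W23 :: "(real \<Rightarrow> real) \<Rightarrow> (real \<Rightarrow> real) \<Rightarrow> real" where
  "inner_W23 f g = f 0 * g 0 + D01 f 0 * D01 g 0 + D01 f 1 * D01 g 1
     + (LINT x|lebesgue_on {0..1}. (D01 ^^ 3) f x * (D01 ^^ 3) g x)"

definition W21 :: "(real \<Rightarrow> real) set" where
  "W21 = {f. abs_cont01 f \<and> L2_on {0..1} (D01 f)}"

definition inner_W21 :: "(real \<Rightarrow> real) \<Rightarrow> (real \<Rightarrow> real) \<Rightarrow> real" where
  "inner_W21 f g = f 0 * g 0 + (LINT x|lebesgue_on {0..1}. D01 f x * D01 g x)"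

text \<open>\<open>\<partial>\<^sup>6u/\<partial>x\<^sup>3\<partial>t\<^sup>3\<close> is the almost everywhere existing mixed derivative \<open>\<partial>\<^sup>2/\<partial>x\<partial>t\<close> of the
  completely continuous function \<open>\<partial>\<^sup>4u/\<partial>x\<^sup>2\<partial>t\<^sup>2\<close>.\<close>

definition d4 :: "real \<Rightarrow> (real \<Rightarrow> real \<Rightarrow> real) \<Rightarrow> real \<Rightarrow> real \<Rightarrow> real" where
  "d4 T u = (dX ^^ 2) ((dT T ^^ 2) u)"

definition d6 :: "real \<Rightarrow> (real \<Rightarrow> real \<Rightarrow> real) \<Rightarrow> real \<Rightarrow> real \<Rightarrow> real" where
  "d6 T u = dX (dT T (d4 T u))"

text \<open>The clauses after the boundary conditions say that \<open>\<partial>\<^sup>2u/\<partial>x\<^sup>2\<close> and each term of the inner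
  product are defined and finite.\<close>

definition W :: "real \<Rightarrow> (real \<Rightarrow> real \<Rightarrow> real) set" where
  "W T = {u.
     diffT T u \<and> diffT T (dT T u) \<and>
     diffX T ((dT T ^^ 2) u) \<and> diffX T (dX ((dT T ^^ 2) u)) \<and>
     completely_continuous T (d4 T u) \<and>
     L2_on (Omega T) (\<lambda>(x, t). d6 T u x t) \<and>
     (\<forall>x\<in>{0..1}. u x 0 = 0 \<and> dT T u x 0 = 0) \<and>
     (\<forall>t\<in>{0..T}. u 0 t = 0 \<and> u 1 t = 0) \<and>
     diffX T u \<and> diffX T (dX u) \<and>
     (\<forall>i\<le>2. let g = (dX ^^ i) u in
        (\<forall>t\<in>{0..T}. g 0 differentiable (at t within {0..T}) \<and>
                    dT T g 0 differentiable (at t within {0..T})) \<and>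
        (AE t in lebesgue_on {0..T}. (dT T ^^ 2) g 0 differentiable (at t within {0..T})) \<and>
        L2_on {0..T} ((dT T ^^ 3) g 0)) \<and>
     (\<forall>j\<le>2. (\<lambda>x. (dT T ^^ j) u x 0) \<in> W23)}"

definition inner_W :: "real \<Rightarrow> (real \<Rightarrow> real \<Rightarrow> real) \<Rightarrow> (real \<Rightarrow> real \<Rightarrow> real) \<Rightarrow> real" where
  "inner_W T u g =
     (\<Sum>i\<le>2. LINT t|lebesgue_on {0..T}.
        (dT T ^^ 3) ((dX ^^ i) u) 0 t * (dT T ^^ 3) ((dX ^^ i) g) 0 t)
     + (\<Sum>j\<le>2. inner_W23 (\<lambda>x. (dT T ^^ j) u x 0) (\<lambda>x. (dT T ^^ j) g x 0))
     + (LINT (x, t)|lebesgue_on (Omega T). d6 T u x t * d6 T g x t)"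

definition norm_W :: "real \<Rightarrow> (real \<Rightarrow> real \<Rightarrow> real) \<Rightarrow> real" where
  "norm_W T u = sqrt (inner_W T u u)"

definition What :: "real \<Rightarrow> (real \<Rightarrow> real \<Rightarrow> real) set" where
  "What T = {u. completely_continuous T u \<and>
     L2_on (Omega T) (\<lambda>(x, t). dX (dT T u) x t) \<and>
     L2_on {0..T} (dT T u 0) \<and> (\<lambda>x. u x 0) \<in> W21}"

definition inner_What :: "real \<Rightarrow> (real \<Rightarrow> real \<Rightarrow> real) \<Rightarrow> (real \<Rightarrow> real \<Rightarrow> real) \<Rightarrow> real" where
  "inner_What T u g =
     (LINT t|lebesgue_on {0..T}. dT T u 0 t * dT T g 0 t)
     + inner_W21 (\<lambda>x. u x 0) (\<lambda>x. g x 0)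
     + (LINT (x, t)|lebesgue_on (Omega T). dX (dT T u) x t * dX (dT T g) x t)"

text \<open>The reproducing kernel of \<^const>\<open>What\<close>; \<open>G y s\<close> is the element representing evaluation at
  \<open>(y, s)\<close>.\<close>

definition G :: "real \<Rightarrow> real \<Rightarrow> real \<Rightarrow> real \<Rightarrow> real" where
  "G y s x t = (1 + min x y) * (1 + min t s)"

definition L :: "real \<Rightarrow> (real \<Rightarrow> real \<Rightarrow> real) \<Rightarrow> real \<Rightarrow> real \<Rightarrow> real" where
  "L T u x t = (dT T ^^ 2) u x t - (dX ^^ 2) u x t"

definition is_adjoint ::
  "'a set \<Rightarrow> ('a \<Rightarrow> 'a \<Rightarrow> real) \<Rightarrow> 'b set \<Rightarrow> ('b \<Rightarrow> 'b \<Rightarrow> real) \<Rightarrow> ('a \<Rightarrow> 'b) \<Rightarrow> ('b \<Rightarrow> 'a) \<Rightarrow> bool"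
  where
  "is_adjoint H ipH K ipK A B \<longleftrightarrow>
     (\<forall>g\<in>K. B g \<in> H \<and> (\<forall>v\<in>H. ipK (A v) g = ipH v (B g)))"

text \<open>On \<^const>\<open>What\<close> the adjoint of \<open>L : W \<rightarrow> What\<close> is determined up to the irrelevant values of its
  images outside \<open>\<Omega>\<close>; the choice operator only fixes these.\<close>

definition Lstar :: "real \<Rightarrow> (real \<Rightarrow> real \<Rightarrow> real) \<Rightarrow> real \<Rightarrow> real \<Rightarrow> real" where
  "Lstar T = (SOME B. is_adjoint (W T) (inner_W T) (What T) (inner_What T) (L T) B)"

definition in_previous_span :: "real \<Rightarrow> (nat \<Rightarrow> real \<Rightarrow> real \<Rightarrow> real) \<Rightarrow> nat \<Rightarrow> bool" where
  "in_previous_span T \<Psi> i \<longleftrightarrow>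
     (\<exists>c. \<forall>(x, t)\<in>Omega T. \<Psi> i x t = (\<Sum>k<i. c k * \<Psi> k x t))"

text \<open>Normalized Gram--Schmidt in \<^const>\<open>W\<close>, a dependent vector contributing \<open>0\<close>. Sequences are
  indexed from \<open>0\<close>.\<close>

fun gram_schmidt_W ::
  "real \<Rightarrow> (nat \<Rightarrow> real \<Rightarrow> real \<Rightarrow> real) \<Rightarrow> nat \<Rightarrow> real \<Rightarrow> real \<Rightarrow> real" where
  "gram_schmidt_W T \<Psi> i =
     (if in_previous_span T \<Psi> i then (\<lambda>x t. 0)
      else let r = (\<lambda>x t. \<Psi> i x t
                 - (\<Sum>j<i. inner_W T (\<Psi> i) (gram_schmidt_W T \<Psi> j) * gram_schmidt_W T \<Psi> j x t))
           in (\<lambda>x t. r x t / norm_W T r))"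

declare gram_schmidt_W.simps [simp del]

definition gram_schmidt_coeffs ::
  "real \<Rightarrow> (nat \<Rightarrow> real \<Rightarrow> real \<Rightarrow> real) \<Rightarrow> (nat \<Rightarrow> nat \<Rightarrow> real) \<Rightarrow> bool" where
  "gram_schmidt_coeffs T \<Psi> \<beta> \<longleftrightarrow>
     (\<forall>i. (\<forall>(x, t)\<in>Omega T. gram_schmidt_W T \<Psi> i x t = (\<Sum>k\<le>i. \<beta> i k * \<Psi> k x t)) \<and>
          (in_previous_span T \<Psi> i \<longrightarrow> (\<forall>k\<le>i. \<beta> i k = 0)))"

definition converges_in_W ::
  "real \<Rightarrow> (nat \<Rightarrow> real \<Rightarrow> real \<Rightarrow> real) \<Rightarrow> (real \<Rightarrow> real \<Rightarrow> real) \<Rightarrow> bool" where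
  "converges_in_W T S u \<longleftrightarrow> (\<forall>n. S n \<in> W T) \<and> u \<in> W T \<and>
     (\<lambda>n. norm_W T (\<lambda>x t. S n x t - u x t)) \<longlonglongrightarrow> 0"

end

theory Submission
  imports Defs
begin

text \<open>
  The expansion is the Fourier series of \<open>u\<close> along the Gram--Schmidt system. Two facts about the
  adjoint make it explicit. First, \<open>\<langle>v, \<Psi>\<^sub>k\<rangle> = \<langle>L v, G (x\<^sub>k) (t\<^sub>k)\<rangle> = L v (x\<^sub>k) (t\<^sub>k)\<close> for every \<open>v\<close> in
  \<^const>\<open>W\<close> (lemma \<open>adjoint_evaluation\<close>), so the Fourier coefficient
  \<open>\<langle>u, e\<^sub>i\<rangle> = \<Sum>\<^sub>k \<beta>\<^sub>i\<^sub>k \<langle>u, \<Psi>\<^sub>k\<rangle>\<close> of \<open>u\<close> is the coefficient with the values of \<open>M\<close>. Second, a vector orthogonal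
  to all \<open>\<Psi>\<^sub>k\<close> has \<open>L v = 0\<close> on a dense set, hence on \<open>\<Omega>\<close> by continuity, and then \<open>v = 0\<close> because the
  wave equation with zero data has only the zero solution (lemma \<open>wave_unique\<close>, by conservation of
  energy). So the system is complete, and the Fourier series converges to \<open>u\<close> in norm because
  \<^const>\<open>W\<close> is complete (lemmas \<open>orthonormal_expansion\<close>, \<open>W_complete\<close>). Point evaluations are bounded
  on \<^const>\<open>W\<close> (lemma \<open>W_point_bound\<close>), which gives pointwise convergence.

  The work lies in the facts about \<^const>\<open>W\<close> that this uses: that it is complete, and
  that \<open>L\<close> has an adjoint. Both come from one parametrization. The function
  \<open>w = \<partial>\<^sup>4u/\<partial>x\<^sup>2\<partial>t\<^sup>2\<close> determines \<open>u\<close>: for each \<open>t\<close> the function \<open>u\<^sub>t\<^sub>t\<close> solves \<open>f'' = w\<close>,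
  \<open>f 0 = f 1 = 0\<close>, and \<open>u\<close> follows by integrating twice in \<open>t\<close> from zero initial values (lemma
  \<open>W_eq_d4_inverse\<close>). In turn \<open>w x t = a + \<integral>b + \<integral>c + \<integral>\<integral>d\<close>, and the \<open>L\<^sup>2\<close> conditions in
  \<^const>\<open>W\<close> say exactly that \<open>b\<close>, \<open>c\<close>, \<open>d\<close> are square integrable (lemmas \<open>W_rep_exists\<close>, \<open>rep_in_W\<close>).
  Under this correspondence the norm of \<^const>\<open>W\<close> is equivalent to the norm of
  \<open>(a, b, c, d)\<close> in \<open>\<real> \<times> L\<^sup>2 \<times> L\<^sup>2 \<times> L\<^sup>2\<close> (lemmas \<open>sq_size_le_inner_W\<close>, \<open>inner_W_le_sq_size\<close>), so
  completeness is the Riesz--Fischer theorem. Likewise \<^const>\<open>What\<close> consists of the functions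
  \<open>a + \<integral>b + \<integral>c + \<integral>\<integral>d\<close> with square integrable data, \<open>L\<close> acts on data by bounded integral operators,
  and the Riesz representation theorem yields the adjoint.

  Derivatives of highest order are pointwise derivatives that exist almost everywhere, so the
  passage between a function and its data rests on Lebesgue's differentiation theorem and its
  version for \<open>\<partial>\<^sup>2/\<partial>x\<partial>t\<close> (lemmas \<open>lebesgue_differentiation\<close>, \<open>mixed_L1_AE_mixed\<close>).
\<close>

section \<open>The Lebesgue differentiation theorem on the line\<close>

text \<open>Outer regularity of the finite measure with density \<open>\<bar>g\<bar>\<close>.\<close>

lemma open_superset_small_integral:
  fixes g :: "real \<Rightarrow> real"
  assumes g: "integrable lborel g" and A: "A \<in> sets borel" and e: "0 < e"
  obtains U where "open U" "A \<subseteq> U" "(LINT x:U - A|lborel. \<bar>g x\<bar>) < e"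
proof -
  define N where "N = density lborel (\<lambda>x. ennreal \<bar>g x\<bar>)"
  have gm[measurable]: "g \<in> borel_measurable borel" using g by simp
  have em: "emeasure N B = ennreal (LINT x:B|lborel. \<bar>g x\<bar>)" if [measurable]: "B \<in> sets borel" for B
  proof -
    have "emeasure N B = (\<integral>\<^sup>+x. ennreal (indicator B x * \<bar>g x\<bar>) \<partial>lborel)"
      unfolding N_def by (subst emeasure_density) (auto intro!: nn_integral_cong simp: indicator_def)
    also have "\<dots> = ennreal (LINT x|lborel. indicator B x * \<bar>g x\<bar>)"
      by (rule nn_integral_eq_integral) (auto intro!: integrable_real_mult_indicator g[THEN integrable_abs] simp: mult.commute)
    finally show ?thesis by (simp add: set_lebesgue_integral_def)
  qed
  have sN: "sets N = sets borel" by (simp add: N_def)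
  have fin: "emeasure N B \<noteq> \<infinity>" if "B \<in> sets borel" for B using em[OF that] by simp
  have "emeasure N (space N) \<noteq> \<infinity>" using fin[of UNIV] by (simp add: N_def)
  from outer_regular[OF sN this A]
  have "(INF U \<in> {U. A \<subseteq> U \<and> open U}. emeasure N U) < emeasure N A + ennreal e"
    using fin[OF A] e by (metis ennreal_add_left_cancel_less add.right_neutral ennreal_0 ennreal_less_zero_iff infinity_ennreal_def)
  then obtain U where U: "A \<subseteq> U" "open U" "emeasure N U < emeasure N A + ennreal e"
    by (auto simp: INF_less_iff)
  have [measurable]: "U \<in> sets borel" "A \<in> sets borel" using U A by auto
  have "emeasure N U = emeasure N A + emeasure N (U - A)"
    using U by (subst plus_emeasure) (auto simp: sN Un_absorb1)
  then have "emeasure N (U - A) < ennreal e"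
    using U(3) fin[OF A] by (simp add: ennreal_add_left_cancel_less)
  then have "(LINT x:U - A|lborel. \<bar>g x\<bar>) < e"
    by (subst (asm) em) (auto simp: ennreal_less_iff set_lebesgue_integral_def)
  then show thesis using U that by blast
qed

text \<open>The intervals with nonnegative integral form a Vitali cover, so disjoint ones among them exhaust
  \<open>A\<close> up to a null set, and they may be chosen inside an open set that exceeds \<open>A\<close> by little.\<close>

lemma integral_nonneg_on_vitali_set:
  fixes g :: "real \<Rightarrow> real"
  assumes g: "integrable lborel g" and A: "A \<in> sets borel"
    and cover: "\<And>x \<delta>. x \<in> A \<Longrightarrow> \<delta> > 0 \<Longrightarrow>
      \<exists>a b. a < b \<and> x \<in> {a..b} \<and> b - a < \<delta> \<and> 0 \<le> (LINT y:{a..b}|lborel. g y)"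
  shows "0 \<le> (LINT x:A|lborel. g x)"
proof (rule field_le_epsilon)
  fix e :: real assume e: "0 < e"
  obtain U where U: "open U" "A \<subseteq> U" "(LINT x:U - A|lborel. \<bar>g x\<bar>) < e"
    using open_superset_small_integral[OF g A e] .
  have gm[measurable]: "g \<in> borel_measurable borel" "A \<in> sets borel" "U \<in> sets borel"
    using g A U by auto
  \<comment> \<open>A pair \<open>p\<close> stands for the interval with center \<open>fst p\<close> and radius \<open>snd p\<close>.\<close>
  define K where "K = {p::real \<times> real. 0 < snd p \<and> cball (fst p) (snd p) \<subseteq> U \<and> 0 \<le> (LINT y:cball (fst p) (snd p)|lborel. g y)}"
  have cov: "\<exists>p. p \<in> K \<and> x \<in> cball (fst p) (snd p) \<and> snd p < d" if xA: "x \<in> A" and d0: "0 < d" for x d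
  proof -
    from xA U obtain r where r: "r > 0" "ball x r \<subseteq> U" by (meson open_contains_ball subsetD)
    obtain a b where ab: "a < b" "x \<in> {a..b}" "b - a < min d r" "0 \<le> (LINT y:{a..b}|lborel. g y)"
      using cover[OF xA, of "min d r"] d0 r by fastforce
    have eq: "cball ((a+b)/2) ((b-a)/2) = {a..b}"
      by (auto simp: cball_def dist_real_def abs_le_iff field_simps)
    have "{a..b} \<subseteq> ball x r" using ab by (auto simp: dist_real_def)
    then show ?thesis using ab r eq
      by (intro exI[of _ "((a+b)/2, (b-a)/2)"]) (auto simp: K_def eq)
  qed
  obtain C where C: "countable C" "C \<subseteq> K"
     "pairwise (\<lambda>i j. disjnt (cball (fst i) (snd i)) (cball (fst j) (snd j))) C"
     "negligible (A - (\<Union>i \<in> C. cball (fst i) (snd i)))"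
    by (rule Vitali_covering_theorem_cballs[of K snd A fst]) (use cov in \<open>auto simp: K_def\<close>)
  define V where "V = (\<Union>i \<in> C. cball (fst i) (snd i))"
  have [measurable]: "V \<in> sets borel" unfolding V_def using C(1) by (intro sets.countable_UN'') auto
  have VU: "V \<subseteq> U" using C(2) by (auto simp: V_def K_def)
  have sg: "set_integrable lborel B g" if "B \<in> sets borel" for B
    using that g unfolding set_integrable_def by (intro integrable_mult_indicator) auto
  have nn: "0 \<le> (LINT x:V|lborel. g x)"
  proof (cases "C = {}")
    case True then show ?thesis by (simp add: V_def set_lebesgue_integral_def)
  next
    case False
    show ?thesis
    proof (cases "finite C")
      case True
      have "(LINT x:V|lborel. g x) = (\<Sum>i\<in>C. LINT x:cball (fst i) (snd i)|lborel. g x)"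
        unfolding V_def using C(3) True
        by (intro set_integral_finite_Union sg) (auto simp: disjoint_family_on_def pairwise_def disjnt_def)
      also have "\<dots> \<ge> 0" using C(2) by (intro sum_nonneg) (auto simp: K_def)
      finally show ?thesis .
    next
      case inf: False
      define f where "f = from_nat_into C"
      have bf: "bij_betw f UNIV C" unfolding f_def using C(1) inf by (rule bij_betw_from_nat_into)
      have V2: "V = (\<Union>n. cball (fst (f n)) (snd (f n)))"
        unfolding V_def using bf by (auto simp: bij_betw_def)
      have fK: "f n \<in> K" for n using bf C(2) by (auto simp: bij_betw_def)
      have dj: "disjoint_family (\<lambda>n. cball (fst (f n)) (snd (f n)))"
        using bf C(3) unfolding disjoint_family_on_def pairwise_def disjnt_def bij_betw_def inj_on_def
        by (metis UNIV_I rangeI)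
      have part: "0 \<le> (LINT x:(\<Union>i<n. cball (fst (f i)) (snd (f i)))|lborel. g x)" for n
      proof -
        have "(LINT x:(\<Union>i<n. cball (fst (f i)) (snd (f i)))|lborel. g x)
            = (\<Sum>i<n. LINT x:cball (fst (f i)) (snd (f i))|lborel. g x)"
          using dj by (intro set_integral_finite_Union sg) (auto simp: disjoint_family_on_def)
        also have "\<dots> \<ge> 0" using fK by (intro sum_nonneg) (auto simp: K_def)
        finally show ?thesis .
      qed
      have eqV: "(\<Union>n. \<Union>i<n. cball (fst (f i)) (snd (f i))) = V"
        unfolding V2 by blast
      have "(\<lambda>n. LINT x:(\<Union>i<n. cball (fst (f i)) (snd (f i)))|lborel. g x)
          \<longlonglongrightarrow> (LINT x:(\<Union>n. \<Union>i<n. cball (fst (f i)) (snd (f i)))|lborel. g x)"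
      proof (rule set_integral_cont_up)
        show "incseq (\<lambda>n. \<Union>i<n. cball (fst (f i)) (snd (f i)))"
          unfolding incseq_def by (intro allI impI UN_mono) auto
        show "set_integrable lborel (\<Union>n. \<Union>i<n. cball (fst (f i)) (snd (f i))) g"
          unfolding eqV by (intro sg) measurable
      qed auto
      then show ?thesis unfolding eqV by (rule LIMSEQ_le_const) (use part in blast)
    qed
  qed
  have ae: "AE x in lborel. x \<notin> A - V"
  proof -
    have "A - V \<in> null_sets lebesgue" using C(4) by (simp add: V_def negligible_iff_null_sets)
    then have "A - V \<in> null_sets lborel" by (simp add: null_sets_completion_iff)
    then show ?thesis by (rule AE_not_in)
  qed
  \<comment> \<open>The two integrals differ only on \<open>U - A\<close>, up to a null set.\<close>
  have "(LINT x:V|lborel. g x) - (LINT x:A|lborel. g x) = (LINT x|lborel. (indicator V x - indicator A x) * g x)"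
    unfolding set_lebesgue_integral_def
    by (subst Bochner_Integration.integral_diff[symmetric])
       (use sg[of V] sg[of A] in \<open>auto simp: set_integrable_def algebra_simps\<close>)
  also have "\<dots> \<le> (LINT x|lborel. indicator (U - A) x * \<bar>g x\<bar>)"
  proof (rule integral_mono_AE)
    show "integrable lborel (\<lambda>x. (indicator V x - indicator A x) * g x)"
      using sg[of V] sg[of A] by (auto simp: set_integrable_def algebra_simps)
    show "integrable lborel (\<lambda>x. indicator (U - A) x * \<bar>g x\<bar>)"
      using integrable_mult_indicator[OF _ integrable_abs[OF g], of "U-A"] by auto
    show "AE x in lborel. (indicator V x - indicator A x) * g x \<le> indicator (U - A) x * \<bar>g x\<bar>"
      using ae by eventually_elim (use VU in \<open>auto simp: indicator_def\<close>)
  qed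
  also have "\<dots> < e" using U(3) by (simp add: set_lebesgue_integral_def)
  finally show "0 \<le> (LINT x:A|lborel. g x) + e" using nn by simp
qed

lemma null_sets_vitali:
  fixes g :: "real \<Rightarrow> real"
  assumes g: "integrable lborel g" and A: "A \<in> sets borel"
    and cover: "\<And>x \<delta>. x \<in> A \<Longrightarrow> \<delta> > 0 \<Longrightarrow>
      \<exists>a b. a < b \<and> x \<in> {a..b} \<and> b - a < \<delta> \<and> 0 \<le> (LINT y:{a..b}|lborel. g y)"
    and neg: "\<And>x. x \<in> A \<Longrightarrow> g x < 0"
  shows "AE x in lborel. x \<notin> A"
proof -
  have [measurable]: "A \<in> sets borel" by fact
  have i: "integrable lborel (\<lambda>x. indicator A x * g x)"
    using integrable_mult_indicator[OF _ g, of A] by simp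
  have "0 \<le> (LINT x|lborel. indicator A x * g x)"
    using integral_nonneg_on_vitali_set[OF g A cover] by (simp add: set_lebesgue_integral_def)
  moreover have "0 \<le> (LINT x|lborel. - (indicator A x * g x))"
    using neg by (intro integral_nonneg_AE AE_I2) (auto simp: indicator_def less_imp_le)
  ultimately have "(LINT x|lborel. - (indicator A x * g x)) = 0" by simp
  then have "AE x in lborel. - (indicator A x * g x) = 0"
    using i neg by (subst (asm) integral_nonneg_eq_0_iff_AE) (auto simp: indicator_def less_imp_le)
  then show ?thesis by eventually_elim (use neg in \<open>force simp: indicator_def split: if_splits\<close>)
qed

text \<open>Integration starts at \<open>-\<infinity>\<close>; for functions that vanish left of \<open>0\<close>, as all data below do, this is the
  primitive that starts at \<open>0\<close>, and no case distinction on the sign of the argument is needed.\<close>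

definition primitive :: "(real \<Rightarrow> real) \<Rightarrow> real \<Rightarrow> real" where
  "primitive f x = (LINT y:{..x}|lborel. f y)"

lemma set_integrable_borel:
  fixes f :: "'a::euclidean_space \<Rightarrow> real"
  shows "integrable lborel f \<Longrightarrow> B \<in> sets borel \<Longrightarrow> set_integrable lborel B f"
  unfolding set_integrable_def by (intro integrable_mult_indicator) auto

lemma primitive_diff:
  assumes f: "integrable lborel f" and "a \<le> b"
  shows "primitive f b - primitive f a = (LINT y:{a..b}|lborel. f y)"
proof -
  have fm[measurable]: "f \<in> borel_measurable borel" using f by simp
  have i: "integrable lborel (\<lambda>x. indicator B x * f x)" if "B \<in> sets borel" for B
    using set_integrable_borel[OF f that] by (simp add: set_integrable_def)
  have "primitive f b - primitive f a = (LINT y|lborel. indicator {..b} y * f y - indicator {..a} y * f y)"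
    unfolding primitive_def set_lebesgue_integral_def by (simp add: i)
  also have "\<dots> = (LINT y|lborel. indicator {a..b} y * f y)"
    using AE_lborel_singleton[of a]
    by (intro integral_cong_AE) (auto simp: indicator_def \<open>a \<le> b\<close> elim!: eventually_mono intro: order_trans[OF _ \<open>a \<le> b\<close>])
  finally show ?thesis by (simp add: set_lebesgue_integral_def)
qed

lemma continuous_primitive:
  assumes f: "integrable lborel f"
  shows "continuous_on UNIV (primitive f)"
proof -
  have fm[measurable]: "f \<in> borel_measurable borel" using f by simp
  have "isCont (primitive f) x" for x
  proof (rule continuous_at_sequentiallyI)
    fix X assume X: "X \<longlonglongrightarrow> x"
    show "(\<lambda>n. primitive f (X n)) \<longlonglongrightarrow> primitive f x"
      unfolding primitive_def set_lebesgue_integral_def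
    proof (rule integral_dominated_convergence[where w="\<lambda>y. \<bar>f y\<bar>"])
      show "AE y in lborel. (\<lambda>n. indicator {..X n} y *\<^sub>R f y) \<longlonglongrightarrow> indicator {..x} y *\<^sub>R f y"
        using AE_lborel_singleton[of x]
      proof eventually_elim
        case (elim y)
        have "eventually (\<lambda>n. indicator {..X n} y = (indicator {..x} y :: real)) sequentially"
        proof (cases "y < x")
          case True
          show ?thesis using order_tendstoD(1)[OF X True] by eventually_elim (use True in auto)
        next
          case False
          then have xy: "x < y" using elim by auto
          show ?thesis using order_tendstoD(2)[OF X xy] by eventually_elim (use xy in auto)
        qed
        then have "eventually (\<lambda>n. indicator {..X n} y *\<^sub>R f y = indicator {..x} y *\<^sub>R f y) sequentially"
          by eventually_elim simp
        then show ?case by (rule tendsto_eventually)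
      qed
    qed (use f in \<open>auto simp: indicator_def\<close>)
  qed
  then show ?thesis by (simp add: continuous_on_eq_continuous_at)
qed

text \<open>Continuity reduces bounds on difference quotients to countably many increments, which keeps the
  exceptional sets measurable.\<close>

lemma le_from_rationals:
  fixes Q :: "real \<Rightarrow> real"
  assumes Q: "continuous_on {h. h \<noteq> 0 \<and> \<bar>h\<bar> < \<delta>} Q"
    and le: "\<And>r::rat. of_rat r \<noteq> (0::real) \<Longrightarrow> \<bar>of_rat r\<bar> < \<delta> \<Longrightarrow> Q (of_rat r) \<le> c"
    and h: "h \<noteq> 0" "\<bar>h\<bar> < \<delta>"
  shows "Q h \<le> c"
proof (rule ccontr)
  assume neg: "\<not> Q h \<le> c"
  let ?S = "{h. h \<noteq> 0 \<and> \<bar>h\<bar> < \<delta>}"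
  have op: "open ?S" by (intro open_Collect_conj open_Collect_neq open_Collect_less continuous_intros)
  have "open (Q -` {c<..} \<inter> ?S)"
    by (rule continuous_on_open_vimage[OF op, THEN iffD1, rule_format, OF Q open_greaterThan])
  moreover have "h \<in> Q -` {c<..} \<inter> ?S" using h neg by auto
  ultimately obtain \<epsilon> where \<epsilon>: "\<epsilon> > 0" "ball h \<epsilon> \<subseteq> Q -` {c<..} \<inter> ?S" by (meson open_contains_ball)
  obtain r where "h < of_rat r" "of_rat r < h + \<epsilon>" using of_rat_dense[of h "h + \<epsilon>"] \<epsilon>(1) by auto
  then have "of_rat r \<in> ball h \<epsilon>" by (simp add: dist_real_def)
  with \<epsilon>(2) have "of_rat r \<in> Q -` {c<..} \<inter> ?S" by blast
  then have "of_rat r \<noteq> (0::real)" "\<bar>of_rat r\<bar> < \<delta>" "c < Q (of_rat r)"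
    unfolding Int_iff vimage_eq mem_Collect_eq greaterThan_iff by blast+
  then show False using le[of r] by linarith
qed

text \<open>Where \<open>f < r < s\<close> but arbitrarily small difference quotients exceed \<open>s\<close>, the function \<open>f - s\<close> is
  negative and yet has nonnegative integrals over a Vitali cover. Such a set is null, and countably
  many of them, with rational \<open>r\<close> and \<open>s\<close>, cover all bad points.\<close>

lemma AE_upper_derivative_primitive:
  assumes f: "integrable lborel f"
  shows "AE x in lborel. \<forall>e>0. \<exists>d>0. \<forall>h. h \<noteq> 0 \<and> \<bar>h\<bar> < d \<longrightarrow>
    (primitive f (x + h) - primitive f x) / h \<le> f x + e"
proof -
  let ?F = "primitive f"
  have fm[measurable]: "f \<in> borel_measurable borel" using f by simp
  have cF: "continuous_on UNIV ?F" using continuous_primitive[OF f] .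
  have [measurable]: "?F \<in> borel_measurable borel" by (rule borel_measurable_continuous_onI[OF cF])
  define A where "A N r s = {x. \<bar>x\<bar> < real N \<and> f x < r \<and>
      (\<forall>n. \<exists>q::rat. of_rat q \<noteq> (0::real) \<and> \<bar>of_rat q\<bar> < 1 / real (Suc n) \<and>
         s < (?F (x + of_rat q) - ?F x) / of_rat q)}" for N :: nat and r s :: real
  have [measurable]: "A N r s \<in> sets borel" for N r s unfolding A_def by measurable
  \<comment> \<open>Cutting off at \<open>N\<close> makes the constant \<open>s\<close> integrable.\<close>
  have null: "AE x in lborel. x \<notin> A N r s" if "r < s" for N r s
  proof (rule null_sets_vitali[where g="\<lambda>x. f x - s * indicator {- real N..real N} x"])
    show "integrable lborel (\<lambda>x. f x - s * indicator {- real N..real N} x)"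
      using f by (intro Bochner_Integration.integrable_diff integrable_mult_right) auto
    show "A N r s \<in> sets borel" by measurable
    show "f x - s * indicator {- real N..real N} x < 0" if "x \<in> A N r s" for x
      using that \<open>r < s\<close> by (auto simp: A_def indicator_def abs_less_iff)
    fix x \<delta> :: real assume x: "x \<in> A N r s" and "0 < \<delta>"
    then have xN: "\<bar>x\<bar> < real N" by (simp add: A_def)
    then obtain n where n: "1 / real (Suc n) < min \<delta> (real N - \<bar>x\<bar>)"
      using \<open>0 < \<delta>\<close> reals_Archimedean[of "min \<delta> (real N - \<bar>x\<bar>)"] by (auto simp: inverse_eq_divide)
    from x obtain q :: rat where "of_rat q \<noteq> (0::real)" "\<bar>of_rat q\<bar> < 1 / real (Suc n)"
      "s < (?F (x + of_rat q) - ?F x) / of_rat q"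
      unfolding A_def by blast
    then obtain h :: real where h: "h \<noteq> 0" "\<bar>h\<bar> < 1 / real (Suc n)" "s < (?F (x + h) - ?F x) / h"
      by blast
    define a b where "a = min x (x + h)" and "b = max x (x + h)"
    have ab: "a < b" "x \<in> {a..b}" "b - a = \<bar>h\<bar>" using h(1) by (auto simp: a_def b_def)
    have sub: "{a..b} \<subseteq> {- real N..real N}" using h(2) n xN by (auto simp: a_def b_def min_def max_def split: if_splits)
    have "(LINT y:{a..b}|lborel. f y - s * indicator {- real N..real N} y) = (LINT y:{a..b}|lborel. f y - s)"
      by (rule set_lebesgue_integral_cong) (use sub in \<open>auto simp: indicator_def\<close>)
    also have "\<dots> = (LINT y:{a..b}|lborel. f y) - (LINT y:{a..b}|lborel. s)"
      by (rule set_integral_diff) (rule set_integrable_borel[OF f], simp,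
          rule borel_integrable_atLeastAtMost', rule continuous_on_const)
    also have "\<dots> = ?F b - ?F a - s * (b - a)"
      using ab by (simp add: primitive_diff[OF f] set_lebesgue_integral_def)
    also have "?F b - ?F a = (?F (x + h) - ?F x) / h * \<bar>h\<bar>"
      using h(1) by (auto simp: a_def b_def min_def max_def abs_if)
    also have "\<dots> - s * (b - a) = ((?F (x + h) - ?F x) / h - s) * \<bar>h\<bar>"
      by (simp add: ab algebra_simps)
    also have "\<dots> \<ge> 0" using h by (intro mult_nonneg_nonneg) auto
    finally show "\<exists>a b. a < b \<and> x \<in> {a..b} \<and> b - a < \<delta> \<and>
        0 \<le> (LINT y:{a..b}|lborel. f y - s * indicator {- real N..real N} y)"
      using ab h(2) n by (intro exI[of _ a] exI[of _ b]) auto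
  qed
  have "AE x in lborel. \<forall>N. \<forall>p q::rat. p < q \<longrightarrow> x \<notin> A N (of_rat p) (of_rat q)"
    unfolding AE_all_countable using null by (auto simp: of_rat_less)
  then show ?thesis
  proof eventually_elim
    case (elim x)
    show ?case
    proof (intro allI impI)
      fix e :: real assume "0 < e"
      obtain p where p: "f x < of_rat p" "of_rat p < f x + e" using of_rat_dense[of "f x" "f x + e"] \<open>0 < e\<close> by auto
      obtain q where q: "of_rat p < (of_rat q::real)" "of_rat q < f x + e" using of_rat_dense[OF p(2)] by auto
      obtain N where N: "\<bar>x\<bar> < real N" using reals_Archimedean2 by blast
      have "x \<notin> A N (of_rat p) (of_rat q)" using elim q(1) by (auto simp: of_rat_less)
      then have "\<not> (\<forall>n. \<exists>r::rat. of_rat r \<noteq> (0::real) \<and> \<bar>of_rat r\<bar> < 1 / real (Suc n) \<and>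
         of_rat q < (?F (x + of_rat r) - ?F x) / of_rat r)"
        using N p(1) unfolding A_def mem_Collect_eq by blast
      then obtain n where n: "\<And>r::rat. of_rat r \<noteq> (0::real) \<Longrightarrow> \<bar>of_rat r\<bar> < 1 / real (Suc n) \<Longrightarrow>
         (?F (x + of_rat r) - ?F x) / of_rat r \<le> of_rat q"
        unfolding not_less[symmetric] by blast
      show "\<exists>d>0. \<forall>h. h \<noteq> 0 \<and> \<bar>h\<bar> < d \<longrightarrow> (?F (x + h) - ?F x) / h \<le> f x + e"
      proof (intro exI[of _ "1 / real (Suc n)"] conjI allI impI)
        fix h :: real assume h: "h \<noteq> 0 \<and> \<bar>h\<bar> < 1 / real (Suc n)"
        have "(?F (x + h) - ?F x) / h \<le> of_rat q"
        proof (rule le_from_rationals[of "1 / real (Suc n)" "\<lambda>h. (?F (x + h) - ?F x) / h"])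
          show "continuous_on {k. k \<noteq> 0 \<and> \<bar>k\<bar> < 1 / real (Suc n)} (\<lambda>h. (?F (x + h) - ?F x) / h)"
            by (intro continuous_intros continuous_on_compose2[OF cF]) auto
        qed (use n h in blast)+
        then show "(?F (x + h) - ?F x) / h \<le> f x + e" using q(2) by simp
      qed simp
    qed
  qed
qed

text \<open>The upper bound on difference quotients, for \<open>f\<close> and for \<open>- f\<close>.\<close>

theorem lebesgue_differentiation:
  assumes f: "integrable lborel f"
  shows "AE x in lborel. (primitive f has_real_derivative f x) (at x)"
proof -
  have neg: "primitive (\<lambda>x. - f x) x = - primitive f x" for x
    by (simp add: primitive_def set_lebesgue_integral_def)
  have f': "integrable lborel (\<lambda>x. - f x)" using f by simp
  show ?thesis
    using AE_upper_derivative_primitive[OF f] AE_upper_derivative_primitive[OF f']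
  proof eventually_elim
    case (elim x)
    show ?case unfolding DERIV_def LIM_eq
    proof (intro allI impI)
      fix e :: real assume "0 < e"
      then have e2: "0 < e / 2" by simp
      obtain d1 where d1: "d1 > 0" "\<And>h. h \<noteq> 0 \<and> \<bar>h\<bar> < d1 \<Longrightarrow> (primitive f (x + h) - primitive f x) / h \<le> f x + e / 2"
        using elim(1) e2 by blast
      obtain d2 where d2: "d2 > 0" "\<And>h. h \<noteq> 0 \<and> \<bar>h\<bar> < d2 \<Longrightarrow> (- primitive f (x + h) - - primitive f x) / h \<le> - f x + e / 2"
        using elim(2) e2 unfolding neg by blast
      show "\<exists>s>0. \<forall>h. h \<noteq> 0 \<and> norm (h - 0) < s \<longrightarrow> norm ((primitive f (x + h) - primitive f x) / h - f x) < e"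
      proof (intro exI[of _ "min d1 d2"] conjI allI impI)
        fix h :: real assume h: "h \<noteq> 0 \<and> norm (h - 0) < min d1 d2"
        have "(- primitive f (x + h) - - primitive f x) / h = - ((primitive f (x + h) - primitive f x) / h)"
          by (simp add: minus_divide_left)
        then show "norm ((primitive f (x + h) - primitive f x) / h - f x) < e"
          using d1(2)[of h] d2(2)[of h] h \<open>0 < e\<close> by (simp add: abs_less_iff)
      qed (use d1 d2 in auto)
    qed
  qed
qed

section \<open>Almost everywhere mixed derivatives of double primitives\<close>

definition primitive2 :: "(real \<times> real \<Rightarrow> real) \<Rightarrow> real \<Rightarrow> real \<Rightarrow> real" where
  "primitive2 d x t = (LINT q:{..x} \<times> {..t}|lborel. d q)"

text \<open>The inner integral \<open>\<integral>\<^bsub>\<xi> \<le> x\<^esub> d (\<xi>, t) d\<xi>\<close>, which is the \<open>t\<close>-derivative of \<^const>\<open>primitive2\<close>.\<close>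

abbreviation strip :: "(real \<times> real \<Rightarrow> real) \<Rightarrow> real \<Rightarrow> real \<Rightarrow> real" where
  "strip d x t \<equiv> primitive (\<lambda>\<xi>. d (\<xi>, t)) x"

lemma integrable_swap:
  fixes d :: "real \<times> real \<Rightarrow> real"
  assumes "integrable lborel d" shows "integrable lborel (d \<circ> prod.swap)"
  using lborel_pair.integrable_product_swap[of d] assms
  by (simp add: lborel_prod comp_def case_prod_unfold prod.swap_def)

lemma integral_swap:
  fixes d :: "real \<times> real \<Rightarrow> real"
  assumes "integrable lborel d" shows "(LINT q|lborel. (d \<circ> prod.swap) q) = (LINT q|lborel. d q)"
  using lborel_pair.integral_product_swap[of d] assms
  by (simp add: lborel_prod comp_def case_prod_unfold prod.swap_def)

lemma strip_integrable_AE: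
  fixes d :: "real \<times> real \<Rightarrow> real"
  assumes d: "integrable lborel d"
  shows "AE t in lborel. integrable lborel (\<lambda>\<xi>. d (\<xi>, t))"
  using lborel_pair.AE_integrable_snd[of "curry d"] d by (simp add: lborel_prod)

lemma
  fixes d :: "real \<times> real \<Rightarrow> real"
  assumes d: "integrable lborel d"
  shows integrable_strip: "integrable lborel (strip d x)"
    and primitive2_eq: "primitive2 d x t = primitive (strip d x) t"
proof -
  have dm[measurable]: "d \<in> borel_measurable borel" using d by simp
  have i1: "integrable (lborel \<Otimes>\<^sub>M lborel) (case_prod (\<lambda>\<xi> \<eta>. indicator {..x} \<xi> * d (\<xi>, \<eta>)))"
    using set_integrable_borel[OF d, of "{..x} \<times> UNIV"]
    by (auto simp: set_integrable_def lborel_prod indicator_times case_prod_unfold borel_Times)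
  show "integrable lborel (strip d x)"
    using lborel_pair.integrable_snd[OF i1] by (simp add: primitive_def set_lebesgue_integral_def)
  have i2: "integrable (lborel \<Otimes>\<^sub>M lborel) (case_prod (\<lambda>\<xi> \<eta>. indicator {..t} \<eta> * (indicator {..x} \<xi> * d (\<xi>, \<eta>))))"
    using set_integrable_borel[OF d, of "{..x} \<times> {..t}"]
    by (auto simp: set_integrable_def lborel_prod indicator_times case_prod_unfold borel_Times mult.assoc mult.left_commute)
  show "primitive2 d x t = primitive (strip d x) t"
    using lborel_pair.integral_snd[OF i2]
    by (simp add: primitive2_def primitive_def set_lebesgue_integral_def lborel_prod indicator_times
          case_prod_unfold mult.assoc mult.left_commute)
qed

lemma primitive2_diff_mono:
  fixes d :: "real \<times> real \<Rightarrow> real"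
  assumes d: "integrable lborel d" and nn: "\<And>q. 0 \<le> d q" and xy: "x \<le> y"
  shows "mono (\<lambda>t. primitive2 d y t - primitive2 d x t)"
proof (rule monoI)
  fix s t :: real assume st: "s \<le> t"
  have i: "integrable lborel (\<lambda>q. indicator ({..x} \<times> {..t}) q * d q)" for x t
    using set_integrable_borel[OF d, of "{..x} \<times> {..t}"] by (simp add: set_integrable_def borel_Times)
  have eq: "primitive2 d y t - primitive2 d x t
      = (LINT q|lborel. indicator ({..y} \<times> {..t}) q * d q - indicator ({..x} \<times> {..t}) q * d q)" for t
    by (simp add: primitive2_def set_lebesgue_integral_def i)
  show "primitive2 d y s - primitive2 d x s \<le> primitive2 d y t - primitive2 d x t"
    unfolding eq
  proof (rule integral_mono)
    show "indicator ({..y} \<times> {..s}) q * d q - indicator ({..x} \<times> {..s}) q * d q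
        \<le> indicator ({..y} \<times> {..t}) q * d q - indicator ({..x} \<times> {..t}) q * d q" for q
      using st xy nn[of q] by (cases q) (auto simp: indicator_def)
  qed (intro Bochner_Integration.integrable_diff i)+
qed

text \<open>One exceptional null set of times serves all \<open>x\<close>: for rational \<open>x\<close> there are only countably many
  null sets, and for the others the difference quotients are squeezed between those at nearby rational
  points, since they increase with \<open>x\<close> when \<open>d \<ge> 0\<close> and the expected limit is continuous in \<open>x\<close>.\<close>

lemma AE_primitive2_partial_nonneg:
  fixes d :: "real \<times> real \<Rightarrow> real"
  assumes d: "integrable lborel d" and nn: "\<And>q. 0 \<le> d q"
  shows "AE t in lborel. \<forall>x. ((\<lambda>t. primitive2 d x t) has_real_derivative strip d x t) (at t)"
proof -
  have "AE t in lborel. \<forall>q::rat. (primitive (strip d (of_rat q)) has_real_derivative strip d (of_rat q) t) (at t)"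
    unfolding AE_all_countable using lebesgue_differentiation[OF integrable_strip[OF d]] by blast
  then show ?thesis using strip_integrable_AE[OF d]
  proof eventually_elim
    case (elim t)
    note cont = continuous_primitive[OF elim(2)]
    have quot: "((\<lambda>h. (primitive2 d (of_rat q) (t + h) - primitive2 d (of_rat q) t) / h) \<longlongrightarrow> strip d (of_rat q) t) (at 0)"
      for q :: rat
      using elim(1)[rule_format, of q] by (simp add: DERIV_def primitive2_eq[OF d])
    have mono: "(primitive2 d x (t + h) - primitive2 d x t) / h \<le> (primitive2 d y (t + h) - primitive2 d y t) / h"
      if "x \<le> y" "h \<noteq> 0" for x y h
    proof (cases "0 < h")
      case True
      then show ?thesis using monoD[OF primitive2_diff_mono[OF d nn \<open>x \<le> y\<close>], of t "t + h"]
        by (intro divide_right_mono) auto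
    next
      case False
      then show ?thesis using monoD[OF primitive2_diff_mono[OF d nn \<open>x \<le> y\<close>], of "t + h" t] that(2)
        by (intro divide_right_mono_neg) auto
    qed
    show ?case unfolding DERIV_def
    proof (intro allI order_tendstoI)
      fix x a assume a: "a < strip d x t"
      have "open {y. a < strip d y t}" by (intro open_Collect_less continuous_intros cont)
      then obtain r where r: "r > 0" "ball x r \<subseteq> {y. a < strip d y t}"
        using a by (metis mem_Collect_eq open_contains_ball)
      obtain q where q: "x - r < of_rat q" "of_rat q < x" using of_rat_dense[of "x - r" x] r(1) by auto
      then have "a < strip d (of_rat q) t" using r by (auto simp: dist_real_def subset_iff)
      from order_tendstoD(1)[OF quot this]
      show "\<forall>\<^sub>F h in at 0. a < (primitive2 d x (t + h) - primitive2 d x t) / h"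
        using eventually_neq_at_within[of 0 0 UNIV]
        by eventually_elim (use mono[of "of_rat q" x] q in \<open>force intro: less_le_trans\<close>)
    next
      fix x a assume a: "strip d x t < a"
      have "open {y. strip d y t < a}" by (intro open_Collect_less continuous_intros cont)
      then obtain r where r: "r > 0" "ball x r \<subseteq> {y. strip d y t < a}"
        using a by (metis mem_Collect_eq open_contains_ball)
      obtain q where q: "x < of_rat q" "of_rat q < x + r" using of_rat_dense[of x "x + r"] r(1) by auto
      then have "strip d (of_rat q) t < a" using r by (auto simp: dist_real_def subset_iff)
      from order_tendstoD(2)[OF quot this]
      show "\<forall>\<^sub>F h in at 0. (primitive2 d x (t + h) - primitive2 d x t) / h < a"
        using eventually_neq_at_within[of 0 0 UNIV]
        by eventually_elim (use mono[of x "of_rat q"] q in \<open>force intro: le_less_trans\<close>)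
    qed
  qed
qed

lemma primitive_minus:
  assumes "integrable lborel f" "integrable lborel g"
  shows "primitive (\<lambda>x. f x - g x) x = primitive f x - primitive g x"
  unfolding primitive_def by (rule set_integral_diff) (auto intro: set_integrable_borel assms)

lemma primitive2_minus:
  assumes "integrable lborel f" "integrable lborel g"
  shows "primitive2 (\<lambda>x. f x - g x) x t = primitive2 f x t - primitive2 g x t"
  unfolding primitive2_def by (rule set_integral_diff) (auto intro: set_integrable_borel assms simp: borel_Times)

text \<open>A general \<open>d\<close> is the difference of its positive and negative parts.\<close>

lemma AE_primitive2_partial:
  fixes d :: "real \<times> real \<Rightarrow> real"
  assumes d: "integrable lborel d"
  shows "AE t in lborel. \<forall>x. ((\<lambda>t. primitive2 d x t) has_real_derivative strip d x t) (at t)"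
proof -
  define p n where "p q = max 0 (d q)" and "n q = max 0 (- d q)" for q
  have pn: "d = (\<lambda>q. p q - n q)" by (auto simp: p_def n_def fun_eq_iff max_def)
  have i: "integrable lborel p" "integrable lborel n" using d unfolding p_def n_def by auto
  have nn: "0 \<le> p q" "0 \<le> n q" for q by (auto simp: p_def n_def)
  show ?thesis
    using AE_primitive2_partial_nonneg[OF i(1) nn(1)] AE_primitive2_partial_nonneg[OF i(2) nn(2)]
      strip_integrable_AE[OF i(1)] strip_integrable_AE[OF i(2)]
    by eventually_elim
       (auto simp: pn primitive2_minus[OF i] primitive_minus intro!: DERIV_diff)
qed

lemma measurable_strip:
  fixes d :: "real \<times> real \<Rightarrow> real"
  assumes [measurable]: "d \<in> borel_measurable borel"
  shows "(\<lambda>q. strip d (fst q) (snd q)) \<in> borel_measurable borel"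
proof -
  have [measurable]: "d \<in> borel_measurable (borel \<Otimes>\<^sub>M borel)" using assms by (simp add: borel_prod)
  have "(\<lambda>q. LINT \<xi>|lborel. indicator {\<xi>. \<xi> \<le> fst q} \<xi> * d (\<xi>, snd q)) \<in> borel_measurable (borel \<Otimes>\<^sub>M borel)"
    by measurable
  then show ?thesis by (simp add: primitive_def set_lebesgue_integral_def borel_prod atMost_def)
qed

text \<open>Fubini for null sets, with the second coordinate fixed first.\<close>

lemma AE_lborel_pairI:
  fixes P :: "real \<times> real \<Rightarrow> bool"
  assumes P: "Measurable.pred borel P" and ae: "AE t in lborel. AE x in lborel. P (x, t)"
  shows "AE q in lborel. P q"
proof -
  have m: "{q \<in> space (lborel \<Otimes>\<^sub>M lborel). P q} \<in> sets (lborel \<Otimes>\<^sub>M (lborel :: real measure))"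
    using P unfolding lborel_prod by (simp add: pred_def)
  have "AE x in lborel. AE t in lborel. P (x, t)"
    using lborel_pair.AE_commute[of "\<lambda>x t. P (x, t)"] m ae by simp
  from lborel_pair.AE_pair_measure[OF m this] show ?thesis unfolding lborel_prod .
qed

lemma AE_lborel_snd:
  assumes "AE t::real in lborel. Q t"
  shows "AE q::real \<times> real in lborel. Q (snd q)"
proof -
  from assms obtain N where N: "{t. \<not> Q t} \<subseteq> N" "N \<in> null_sets lborel"
    by (auto simp: eventually_ae_filter)
  have [measurable]: "N \<in> sets borel" using N(2) by auto
  have "AE q::real \<times> real in lborel. snd q \<notin> N"
  proof (rule AE_lborel_pairI)
    show "AE t in lborel. AE x::real in lborel. snd (x, t) \<notin> N"
      using AE_not_in[OF N(2)] by eventually_elim simp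
    have "Measurable.pred (borel \<Otimes>\<^sub>M borel) (\<lambda>q::real \<times> real. snd q \<notin> N)" by measurable
    then show "Measurable.pred borel (\<lambda>q::real \<times> real. snd q \<notin> N)" by (simp add: borel_prod)
  qed
  then show ?thesis by eventually_elim (use N(1) in auto)
qed

text \<open>On each horizontal line this is the one-dimensional theorem. Restricting to rational increments
  makes the set of good points Borel, so that Fubini applies to it.\<close>

lemma AE_strip_derivative:
  fixes d :: "real \<times> real \<Rightarrow> real"
  assumes d: "integrable lborel d"
  shows "AE q in lborel. ((\<lambda>x. strip d x (snd q)) has_real_derivative d q) (at (fst q))"
proof -
  have [measurable]: "d \<in> borel_measurable borel" using d by simp
  have [measurable]: "(\<lambda>q. strip d (fst q) (snd q)) \<in> borel_measurable borel" by (rule measurable_strip) measurable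
  have strip_shift[measurable]: "(\<lambda>q. strip d (fst q + r) (snd q)) \<in> borel_measurable borel" for r
  proof -
    have "(\<lambda>q::real \<times> real. (fst q + r, snd q)) \<in> borel_measurable borel"
      by (intro borel_measurable_continuous_onI continuous_intros)
    from measurable_compose[OF this measurable_strip[of d]] show ?thesis by simp
  qed
  define good where "good q \<longleftrightarrow> (\<forall>k. \<exists>n. \<forall>r::rat. of_rat r \<noteq> (0::real) \<and> \<bar>of_rat r\<bar> < 1 / real (Suc n) \<longrightarrow>
      \<bar>(strip d (fst q + of_rat r) (snd q) - strip d (fst q) (snd q)) / of_rat r - d q\<bar> \<le> 1 / real (Suc k))" for q
  have [measurable]: "Measurable.pred borel good" unfolding good_def by measurable
  have "AE t in lborel. AE x in lborel. good (x, t)"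
    using strip_integrable_AE[OF d]
  proof eventually_elim
    case (elim t)
    show ?case using lebesgue_differentiation[OF elim]
    proof eventually_elim
      case (elim x)
      then have L: "(\<lambda>h. (strip d (x + h) t - strip d x t) / h) \<midarrow>0\<rightarrow> d (x, t)" by (simp add: DERIV_def)
      show ?case unfolding good_def
      proof
        fix k
        obtain s where s: "s > 0" "\<And>h. h \<noteq> 0 \<Longrightarrow> \<bar>h\<bar> < s \<Longrightarrow> \<bar>(strip d (x + h) t - strip d x t) / h - d (x, t)\<bar> < 1 / real (Suc k)"
          using LIM_D[OF L, of "1 / real (Suc k)"] by auto
        obtain n where "1 / real (Suc n) < s" using reals_Archimedean[OF s(1)] by (auto simp: inverse_eq_divide)
        then show "\<exists>n. \<forall>r::rat. of_rat r \<noteq> (0::real) \<and> \<bar>of_rat r\<bar> < 1 / real (Suc n) \<longrightarrow>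
          \<bar>(strip d (fst (x,t) + of_rat r) (snd (x,t)) - strip d (fst (x,t)) (snd (x,t))) / of_rat r - d (x,t)\<bar> \<le> 1 / real (Suc k)"
          unfolding fst_conv snd_conv
          by (intro exI[of _ n] allI impI less_imp_le s(2)) (auto elim: less_trans)
      qed
    qed
  qed
  then have good: "AE q in lborel. good q" by (intro AE_lborel_pairI) measurable
  have "AE q::real \<times> real in lborel. integrable lborel (\<lambda>\<xi>. d (\<xi>, snd q))"
    using AE_lborel_snd[OF strip_integrable_AE[OF d]] .
  with good show ?thesis
  proof eventually_elim
    case (elim q)
    obtain x t where q: "q = (x, t)" by fastforce
    have cont: "continuous_on UNIV (\<lambda>x. strip d x t)" using continuous_primitive[OF elim(2)] by (simp add: q)
    show ?case unfolding DERIV_def LIM_eq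
    proof (intro allI impI)
      fix e :: real assume "0 < e"
      then obtain k where k: "1 / real (Suc k) < e" using reals_Archimedean by (auto simp: inverse_eq_divide)
      have "\<exists>n. \<forall>r::rat. of_rat r \<noteq> (0::real) \<and> \<bar>of_rat r\<bar> < 1 / real (Suc n) \<longrightarrow>
          \<bar>(strip d (x + of_rat r) t - strip d x t) / of_rat r - d q\<bar> \<le> 1 / real (Suc k)"
        using elim(1)[unfolded good_def, rule_format, of k] by (simp only: q fst_conv snd_conv)
      then obtain n where n: "\<And>r::rat. of_rat r \<noteq> (0::real) \<Longrightarrow> \<bar>of_rat r\<bar> < 1 / real (Suc n) \<Longrightarrow>
          \<bar>(strip d (x + of_rat r) t - strip d x t) / of_rat r - d q\<bar> \<le> 1 / real (Suc k)"
        by blast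
      have "\<bar>(strip d (x + h) t - strip d x t) / h - d q\<bar> < e" if h: "h \<noteq> 0" "\<bar>h\<bar> < 1 / real (Suc n)" for h
      proof -
        have cq: "continuous_on {h. h \<noteq> 0 \<and> \<bar>h\<bar> < 1 / real (Suc n)} (\<lambda>h. \<bar>(strip d (x + h) t - strip d x t) / h - d q\<bar>)"
          by (intro continuous_intros continuous_on_compose2[OF cont]) auto
        show ?thesis using le_from_rationals[OF cq n h] k by linarith
      qed
      then show "\<exists>s>0. \<forall>h. h \<noteq> 0 \<and> norm (h - 0) < s \<longrightarrow>
          norm ((strip d (fst q + h) (snd q) - strip d (fst q) (snd q)) / h - d q) < e"
        unfolding q by (intro exI[of _ "1 / real (Suc n)"]) auto
    qed
  qed
qed

section \<open>Representation and expansion in a complete semi-inner-product space\<close>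

text \<open>All that enters is how \<open>ip\<close> behaves on \<open>lc f c g\<close>, to be thought of as \<open>f + c g\<close>. Function spaces
  whose elements matter only up to null sets, or only on \<open>\<Omega>\<close>, are instances as they stand, without
  passing to quotients.\<close>

locale semi_inner_space =
  fixes H :: "'v set" and ip :: "'v \<Rightarrow> 'v \<Rightarrow> real"
    and lc :: "'v \<Rightarrow> real \<Rightarrow> 'v \<Rightarrow> 'v" and z :: 'v
  assumes lc_in: "\<lbrakk>f \<in> H; g \<in> H\<rbrakk> \<Longrightarrow> lc f c g \<in> H"
    and ip_lc: "\<lbrakk>f \<in> H; g \<in> H; k \<in> H\<rbrakk> \<Longrightarrow> ip (lc f c g) k = ip f k + c * ip g k"
    and ip_sym: "\<lbrakk>f \<in> H; g \<in> H\<rbrakk> \<Longrightarrow> ip f g = ip g f"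
    and ip_nonneg: "f \<in> H \<Longrightarrow> 0 \<le> ip f f"
    and zero_in: "z \<in> H"
    and ip_zero: "f \<in> H \<Longrightarrow> ip z f = 0"
begin

lemma ip_lc_right: "\<lbrakk>f \<in> H; g \<in> H; k \<in> H\<rbrakk> \<Longrightarrow> ip k (lc f c g) = ip k f + c * ip k g"
  by (metis ip_lc ip_sym lc_in)

lemma ip_zero_right: "f \<in> H \<Longrightarrow> ip f z = 0"
  using ip_zero ip_sym zero_in by metis

lemma ip_lc_lc: "\<lbrakk>f \<in> H; g \<in> H\<rbrakk> \<Longrightarrow> ip (lc f c g) (lc f c g) = ip f f + 2 * c * ip f g + c\<^sup>2 * ip g g"
  by (simp add: ip_lc ip_lc_right lc_in ip_sym[of g f] power2_eq_square algebra_simps)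

lemma Cauchy_Schwarz:
  assumes "f \<in> H" "g \<in> H" shows "(ip f g)\<^sup>2 \<le> ip f f * ip g g"
proof -
  have q: "0 \<le> ip f f + 2 * c * ip f g + c\<^sup>2 * ip g g" for c
    using ip_nonneg[OF lc_in[OF assms]] ip_lc_lc[OF assms] by metis
  show ?thesis
  proof (cases "ip g g = 0")
    case True
    have "ip f g = 0"
    proof (rule ccontr)
      assume "ip f g \<noteq> 0"
      then show False using q[of "- (ip f f + 1) / (2 * ip f g)"] True by (simp add: field_simps)
    qed
    then show ?thesis using ip_nonneg assms by simp
  next
    case False
    then have pos: "0 < ip g g" using ip_nonneg[OF assms(2)] by simp
    have "0 \<le> ip f f - (ip f g)\<^sup>2 / ip g g"
      using q[of "- ip f g / ip g g"] pos by (simp add: power2_eq_square field_simps)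
    then show ?thesis using pos by (simp add: field_simps)
  qed
qed

definition sqdist :: "'v \<Rightarrow> 'v \<Rightarrow> real" where
  "sqdist f g = ip (lc f (-1) g) (lc f (-1) g)"

lemma sqdist_eq: "\<lbrakk>f \<in> H; g \<in> H\<rbrakk> \<Longrightarrow> sqdist f g = ip f f - 2 * ip f g + ip g g"
  unfolding sqdist_def by (simp add: ip_lc_lc)

lemma sqdist_nonneg: "\<lbrakk>f \<in> H; g \<in> H\<rbrakk> \<Longrightarrow> 0 \<le> sqdist f g"
  unfolding sqdist_def by (intro ip_nonneg lc_in)

lemma tendsto_ip:
  assumes "\<And>n. F n \<in> H" "f \<in> H" "k \<in> H" "(\<lambda>n. sqdist (F n) f) \<longlonglongrightarrow> 0"
  shows "(\<lambda>n. ip (F n) k) \<longlonglongrightarrow> ip f k"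
proof -
  have lim: "(\<lambda>n. sqdist (F n) f * ip k k) \<longlonglongrightarrow> 0" using tendsto_mult_left_zero[OF assms(4)] .
  have le: "(ip (F n) k - ip f k)\<^sup>2 \<le> sqdist (F n) f * ip k k" for n
    using Cauchy_Schwarz[of "lc (F n) (-1) f" k] assms lc_in
    by (simp add: ip_lc sqdist_def)
  have "(\<lambda>n. (ip (F n) k - ip f k)\<^sup>2) \<longlonglongrightarrow> 0"
    by (rule tendsto_sandwich[OF _ _ tendsto_const lim]) (simp_all add: le)
  then have "(\<lambda>n. ip (F n) k - ip f k) \<longlonglongrightarrow> 0"
    by (simp only: power_tendsto_0_iff pos2)
  then show ?thesis by (simp add: LIM_zero_iff)
qed

end

locale complete_semi_inner_space = semi_inner_space +
  assumes complete: "\<lbrakk>\<And>n. F n \<in> H; \<And>e. e > 0 \<Longrightarrow> \<exists>N. \<forall>m\<ge>N. \<forall>n\<ge>N. sqdist (F m) (F n) < e\<rbrakk>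
      \<Longrightarrow> \<exists>f\<in>H. (\<lambda>n. sqdist (F n) f) \<longlonglongrightarrow> 0"
begin

text \<open>If \<open>\<beta> \<noteq> 0\<close>, the linear term dominates the quadratic one near \<open>c = 0\<close> and changes sign there.\<close>

lemma linear_part_zero:
  fixes \<beta> \<gamma> :: real
  assumes "0 \<le> \<gamma>" "\<And>c. 0 \<le> 2 * c * \<beta> + c\<^sup>2 * \<gamma>" shows "\<beta> = 0"
proof (rule ccontr)
  assume "\<beta> \<noteq> 0"
  define c where "c = - \<beta> / (\<gamma> + 1)"
  have cb: "c * (\<gamma> + 1) = - \<beta>" using assms(1) by (simp add: c_def)
  have "2 * c * \<beta> + c\<^sup>2 * \<gamma> = - (c\<^sup>2 * (\<gamma> + 2))"
  proof -
    have b: "\<beta> = - (c * (\<gamma> + 1))" using cb by simp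
    show ?thesis unfolding b by (simp add: power2_eq_square algebra_simps)
  qed
  moreover have "0 < c\<^sup>2 * (\<gamma> + 2)"
    using assms(1) \<open>\<beta> \<noteq> 0\<close> by (intro mult_pos_pos) (auto simp: c_def)
  ultimately show False using assms(2)[of c] by linarith
qed

text \<open>The representing vector minimizes \<open>J f = \<langle>f, f\<rangle> - 2 \<phi> f\<close>. Minimizing sequences are Cauchy by the
  parallelogram law, and the first variation of \<open>J\<close> vanishes at their limit.\<close>

theorem riesz_representation:
  assumes lin: "\<And>f g c. \<lbrakk>f \<in> H; g \<in> H\<rbrakk> \<Longrightarrow> \<phi> (lc f c g) = \<phi> f + c * \<phi> g"
    and bound: "\<And>f. f \<in> H \<Longrightarrow> (\<phi> f)\<^sup>2 \<le> C * ip f f"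
  shows "\<exists>r\<in>H. \<forall>f\<in>H. \<phi> f = ip f r"
proof -
  define B where "B = max C 0"
  have bB: "(\<phi> f)\<^sup>2 \<le> B * ip f f" if "f \<in> H" for f
    using bound[OF that] ip_nonneg[OF that] mult_right_mono[of C B "ip f f"] by (auto simp: B_def)
  have B0: "0 \<le> B" by (simp add: B_def)
  define J where "J f = ip f f - 2 * \<phi> f" for f
  have Jlow: "- B \<le> J f" if "f \<in> H" for f
  proof -
    have "(B + ip f f)\<^sup>2 - (2 * \<phi> f)\<^sup>2 = (B - ip f f)\<^sup>2 + 4 * (B * ip f f - (\<phi> f)\<^sup>2)"
      by (simp add: power2_eq_square algebra_simps)
    moreover have "0 \<le> (B - ip f f)\<^sup>2 + 4 * (B * ip f f - (\<phi> f)\<^sup>2)"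
      using bB[OF that] by (intro add_nonneg_nonneg mult_nonneg_nonneg) simp_all
    ultimately have "0 \<le> (B + ip f f)\<^sup>2 - (2 * \<phi> f)\<^sup>2" by (simp only:)
    then have "(2 * \<phi> f)\<^sup>2 \<le> (B + ip f f)\<^sup>2" by (simp only: diff_ge_0_iff_ge)
    moreover have "0 \<le> B + ip f f" using ip_nonneg[OF that] B0 by simp
    ultimately have "2 * \<phi> f \<le> B + ip f f" by (rule power2_le_imp_le)
    then show ?thesis by (simp add: J_def)
  qed
  define m where "m = Inf (J ` H)"
  have bdd: "bdd_below (J ` H)" using Jlow by (intro bdd_belowI[of _ "-B"]) auto
  have mJ: "m \<le> J f" if "f \<in> H" for f unfolding m_def by (rule cInf_lower[OF _ bdd]) (use that in auto)
  have "\<exists>f\<in>H. J f < m + 1 / real (Suc n)" for n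
    using cInf_lessD[of "J ` H" "m + 1 / real (Suc n)"] zero_in by (auto simp: m_def)
  then obtain F where F: "\<And>n. F n \<in> H" "\<And>n. J (F n) < m + 1 / real (Suc n)" by metis
  have phiz: "\<phi> z = 0" using bB[OF zero_in] ip_zero[OF zero_in] by simp
  \<comment> \<open>The parallelogram law; \<open>lc (lc z (1/2) f) (1/2) g\<close> is the midpoint of \<open>f\<close> and \<open>g\<close>.\<close>
  have para: "sqdist f g = 2 * J f + 2 * J g - 4 * J (lc (lc z (1/2) f) (1/2) g)" if "f \<in> H" "g \<in> H" for f g
    using that by (simp add: sqdist_eq J_def ip_lc ip_lc_right lc_in zero_in ip_zero ip_zero_right lin phiz
        ip_sym[OF that(2,1)] field_simps)
  have dFF: "sqdist (F n) (F k) < 2 / real (Suc n) + 2 / real (Suc k)" for n k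
    using F(2)[of n] F(2)[of k] mJ[of "lc (lc z (1/2) (F n)) (1/2) (F k)"]
    by (simp add: para F(1) lc_in zero_in)
  have "\<exists>r\<in>H. (\<lambda>n. sqdist (F n) r) \<longlonglongrightarrow> 0"
  proof (rule complete[OF F(1)])
    fix e :: real assume "e > 0"
    then obtain N where N: "1 / real (Suc N) < e / 4"
      using reals_Archimedean[of "e/4"] by (auto simp: inverse_eq_divide)
    have b: "2 / real (Suc n) < e / 2" if "n \<ge> N" for n
    proof -
      have "1 / real (Suc n) \<le> 1 / real (Suc N)" using that by (intro divide_left_mono) auto
      then show ?thesis using N by linarith
    qed
    show "\<exists>N. \<forall>m\<ge>N. \<forall>n\<ge>N. sqdist (F m) (F n) < e"
    proof (intro exI[of _ N] allI impI)
      fix i j assume "N \<le> i" "N \<le> j"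
      then show "sqdist (F i) (F j) < e" using dFF[of i j] b[of i] b[of j] by linarith
    qed
  qed
  then obtain r where r: "r \<in> H" "(\<lambda>n. sqdist (F n) r) \<longlonglongrightarrow> 0" by blast
  have "\<phi> f = ip f r" if f: "f \<in> H" for f
  proof -
    \<comment> \<open>The first variation of \<open>J\<close> at \<open>r\<close> in direction \<open>f\<close>, as a limit along the minimizing sequence.\<close>
    have "0 \<le> 2 * c * (ip r f - \<phi> f) + c\<^sup>2 * ip f f" for c
    proof -
      have le: "- (1 / real (Suc n)) \<le> 2 * c * (ip (F n) f - \<phi> f) + c\<^sup>2 * ip f f" for n
        using mJ[OF lc_in[OF F(1) f], of n c] F(2)[of n]
        by (simp add: J_def ip_lc_lc[OF F(1) f] lin[OF F(1) f] algebra_simps)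
      have "(\<lambda>n. 2 * c * (ip (F n) f - \<phi> f) + c\<^sup>2 * ip f f) \<longlonglongrightarrow> 2 * c * (ip r f - \<phi> f) + c\<^sup>2 * ip f f"
        by (intro tendsto_add tendsto_mult tendsto_diff tendsto_const tendsto_ip[OF F(1) r(1) f r(2)])
      moreover have "(\<lambda>n. - (1 / real (Suc n))) \<longlonglongrightarrow> - 0"
        by (rule tendsto_minus[OF LIMSEQ_Suc[OF lim_1_over_n]])
      ultimately show ?thesis using le by (intro LIMSEQ_le[where X="\<lambda>n. - (1 / real (Suc n))" and x=0]) auto
    qed
    from linear_part_zero[OF ip_nonneg[OF f] this] show ?thesis using ip_sym[OF f r(1)] by simp
  qed
  then show ?thesis using r(1) by blast
qed

text \<open>By Bessel's inequality the partial sums \<open>P n\<close> are Cauchy. The difference of \<open>u\<close> and their limit is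
  orthogonal to the whole system, hence has norm \<open>0\<close>. Zero vectors are admitted in the system because a
  Gram--Schmidt process produces them at dependent indices.\<close>

theorem orthonormal_expansion:
  assumes u: "u \<in> H" and e: "\<And>i. e i \<in> H"
    and orth: "\<And>i j. i \<noteq> j \<Longrightarrow> ip (e i) (e j) = 0"
    and unit: "\<And>i. ip (e i) (e i) = 0 \<or> ip (e i) (e i) = 1"
    and total: "\<And>v. \<lbrakk>v \<in> H; \<And>i. ip v (e i) = 0\<rbrakk> \<Longrightarrow> ip v v = 0"
    and P0: "P 0 = z" and PS: "\<And>n. P (Suc n) = lc (P n) (ip u (e n)) (e n)"
  shows "(\<lambda>n. sqdist (P n) u) \<longlonglongrightarrow> 0"
proof -
  define c where "c i = ip u (e i)" for i
  have PH: "P n \<in> H" for n by (induction n) (simp_all add: P0 PS zero_in lc_in e)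
  have Pk: "ip (P n) k = (\<Sum>i<n. c i * ip (e i) k)" if "k \<in> H" for n k
    using that by (induction n) (simp_all add: P0 PS ip_zero ip_lc PH e c_def)
  \<comment> \<open>Both sides vanish if \<open>e i\<close> has norm \<open>0\<close>.\<close>
  have ce: "c i * ip (e i) (e i) = c i" for i
    using unit[of i] Cauchy_Schwarz[OF u e[of i]] by (auto simp: c_def)
  have Pe: "ip (P n) (e j) = (if j < n then c j else 0)" for n j
  proof -
    have "ip (P n) (e j) = (\<Sum>i<n. if i = j then c j else 0)"
      unfolding Pk[OF e] by (rule sum.cong) (use orth ce in auto)
    then show ?thesis by simp
  qed
  have PP: "ip (P m) (P n) = (\<Sum>i<m. (c i)\<^sup>2)" if "m \<le> n" for m n
  proof -
    have "ip (P m) (P n) = (\<Sum>i<m. c i * ip (P n) (e i))"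
      unfolding Pk[OF PH] by (simp add: ip_sym[OF e PH])
    also have "\<dots> = (\<Sum>i<m. (c i)\<^sup>2)"
      by (rule sum.cong) (use that in \<open>auto simp: Pe power2_eq_square\<close>)
    finally show ?thesis .
  qed
  have uP: "ip u (P n) = (\<Sum>i<n. (c i)\<^sup>2)" for n
    unfolding ip_sym[OF u PH] Pk[OF u] by (simp add: ip_sym[OF e u] c_def power2_eq_square)
  have bessel: "(\<Sum>i<n. (c i)\<^sup>2) \<le> ip u u" for n
    using sqdist_nonneg[OF u PH[of n]] by (simp add: sqdist_eq[OF u PH] uP PP)
  have "summable (\<lambda>i. (c i)\<^sup>2)" by (rule summableI_nonneg_bounded[OF _ bessel]) simp
  then have Cau: "Cauchy (\<lambda>n. \<Sum>i<n. (c i)\<^sup>2)" by (simp add: summable_iff_convergent convergent_Cauchy)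
  have sd: "sqdist (P m) (P n) = \<bar>(\<Sum>i<m. (c i)\<^sup>2) - (\<Sum>i<n. (c i)\<^sup>2)\<bar>" for m n
  proof (cases "m \<le> n")
    case True
    then have "(\<Sum>i<m. (c i)\<^sup>2) \<le> (\<Sum>i<n. (c i)\<^sup>2)" by (intro sum_mono2) auto
    then show ?thesis using True by (simp add: sqdist_eq PH PP)
  next
    case False
    then have "(\<Sum>i<n. (c i)\<^sup>2) \<le> (\<Sum>i<m. (c i)\<^sup>2)" by (intro sum_mono2) auto
    then show ?thesis using False by (simp add: sqdist_eq PH PP ip_sym[OF PH[of m] PH[of n]])
  qed
  have "\<exists>p\<in>H. (\<lambda>n. sqdist (P n) p) \<longlonglongrightarrow> 0"
  proof (rule complete[OF PH])
    fix \<epsilon> :: real assume "\<epsilon> > 0"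
    from CauchyD[OF Cau this] show "\<exists>N. \<forall>m\<ge>N. \<forall>n\<ge>N. sqdist (P m) (P n) < \<epsilon>"
      by (simp add: sd)
  qed
  then obtain p where p: "p \<in> H" "(\<lambda>n. sqdist (P n) p) \<longlonglongrightarrow> 0" by blast
  define v where "v = lc u (-1) p"
  have v: "v \<in> H" unfolding v_def by (intro lc_in u p)
  have "ip v (e j) = 0" for j
  proof -
    have "(\<lambda>n. ip (P n) (e j)) \<longlonglongrightarrow> ip p (e j)" by (rule tendsto_ip[OF PH p(1) e p(2)])
    moreover have "(\<lambda>n. ip (P n) (e j)) \<longlonglongrightarrow> c j"
      by (rule tendsto_eventually, rule eventually_sequentiallyI[of "Suc j"]) (simp add: Pe)
    ultimately have "ip p (e j) = c j" by (rule LIMSEQ_unique)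
    then show ?thesis by (simp add: v_def ip_lc u p e c_def)
  qed
  then have "ip v v = 0" using total v by blast
  then have "ip v k = 0" if "k \<in> H" for k using Cauchy_Schwarz[OF v that] by simp
  then have same: "ip u k = ip p k" if "k \<in> H" for k
    using that by (simp add: v_def ip_lc u p)
  have "ip (P n) u = ip (P n) p" for n using same[OF PH] by (simp add: ip_sym[OF PH] u p)
  moreover have "ip u u = ip p p" using same[OF u] same[OF p(1)] ip_sym[OF u p(1)] by simp
  ultimately have "sqdist (P n) u = sqdist (P n) p" for n
    by (simp add: sqdist_eq PH u p)
  with p(2) show ?thesis by simp
qed

end

section \<open>Completeness of the space of square integrable functions\<close>

definition sqint :: "'a measure \<Rightarrow> ('a \<Rightarrow> real) \<Rightarrow> bool" where
  "sqint M f \<longleftrightarrow> f \<in> borel_measurable M \<and> integrable M (\<lambda>x. (f x)\<^sup>2)"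

lemma sqint_mult:
  assumes "sqint M f" "sqint M g" shows "integrable M (\<lambda>x. f x * g x)"
proof (rule Bochner_Integration.integrable_bound)
  show "integrable M (\<lambda>x. (f x)\<^sup>2 + (g x)\<^sup>2)" using assms by (simp add: sqint_def)
  show "AE x in M. norm (f x * g x) \<le> norm ((f x)\<^sup>2 + (g x)\<^sup>2)"
  proof (intro AE_I2)
    fix x
    have "2 * \<bar>f x * g x\<bar> \<le> (f x)\<^sup>2 + (g x)\<^sup>2"
      using sum_squares_bound[of "\<bar>f x\<bar>" "\<bar>g x\<bar>"] by (simp add: abs_mult mult.assoc)
    then show "norm (f x * g x) \<le> norm ((f x)\<^sup>2 + (g x)\<^sup>2)" by simp
  qed
qed (use assms in \<open>auto simp: sqint_def intro!: borel_measurable_times\<close>)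

lemma sqint_lin:
  assumes "sqint M f" "sqint M g" shows "sqint M (\<lambda>x. f x + c * g x)"
proof -
  have "integrable M (\<lambda>x. (f x)\<^sup>2 + 2 * c * (f x * g x) + c\<^sup>2 * (g x)\<^sup>2)"
    using assms sqint_mult[OF assms] by (simp add: sqint_def)
  moreover have "(f x)\<^sup>2 + 2 * c * (f x * g x) + c\<^sup>2 * (g x)\<^sup>2 = (f x + c * g x)\<^sup>2" for x
    by (simp add: power2_eq_square algebra_simps)
  ultimately show ?thesis using assms by (auto simp: sqint_def)
qed

interpretation L2: semi_inner_space "Collect (sqint M)" "\<lambda>f g. LINT x|M. f x * g x"
  "\<lambda>f c g x. f x + c * g x" "\<lambda>x. 0" for M
proof (unfold_locales, goal_cases)
  case (1 f g c)
  then show ?case using sqint_lin[of M] by simp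
next
  case (2 f g k c)
  then show ?case using sqint_mult[of M] by (simp add: algebra_simps)
qed (auto simp: mult.commute sqint_def intro!: integral_nonneg_AE)

text \<open>Along a rapidly Cauchy subsequence \<open>\<Sum>\<^sub>k 2^k \<bar>F\<^bsub>r (k+1)\<^esub> - F\<^bsub>r k\<^esub>\<bar>\<^sup>2\<close> has a finite integral, so it is finite almost
  everywhere, and there the subsequence converges. Fatou's lemma turns pointwise into \<open>L\<^sup>2\<close>
  convergence. That the limit vanishes where all members do preserves supports.\<close>

theorem riesz_fischer:
  fixes F :: "nat \<Rightarrow> 'a \<Rightarrow> real"
  assumes F: "\<And>n. sqint M (F n)"
    and Cau: "\<And>e. e > 0 \<Longrightarrow> \<exists>N. \<forall>m\<ge>N. \<forall>n\<ge>N. (LINT x|M. (F m x - F n x)\<^sup>2) < e"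
  obtains f where "sqint M f" "(\<lambda>n. LINT x|M. (F n x - f x)\<^sup>2) \<longlonglongrightarrow> 0"
    "\<And>x. (\<And>n. F n x = 0) \<Longrightarrow> f x = 0"
proof -
  have [measurable]: "F n \<in> borel_measurable M" for n using F by (simp add: sqint_def)
  have di: "integrable M (\<lambda>x. (F m x - F n x)\<^sup>2)" for m n
    using sqint_lin[OF F[of m] F[of n], of "-1"] by (simp add: sqint_def)
  have "\<exists>N. \<forall>m\<ge>N. \<forall>n\<ge>N. (LINT x|M. (F m x - F n x)\<^sup>2) < (1/4)^k" for k :: nat
    by (rule Cau) simp
  then obtain N where N: "\<And>k m n. m \<ge> N k \<Longrightarrow> n \<ge> N k \<Longrightarrow> (LINT x|M. (F m x - F n x)\<^sup>2) < (1/4)^k" by metis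
  \<comment> \<open>Monotone, at least \<open>N k\<close> and unbounded.\<close>
  define r where "r k = (\<Sum>j\<le>k. N j) + k" for k
  have rN: "N k \<le> r k" for k unfolding r_def using member_le_sum[of k "{..k}" N] by simp
  have rS: "N k \<le> r (Suc k)" for k unfolding r_def using member_le_sum[of k "{..Suc k}" N] by simp
  have rk: "k \<le> r k" for k by (simp add: r_def)
  define h where "h k x = 2^k * (F (r (Suc k)) x - F (r k) x)\<^sup>2" for k x
  have [measurable]: "h k \<in> borel_measurable M" for k unfolding h_def by measurable
  have nnh: "(\<integral>\<^sup>+x. ennreal (h k x) \<partial>M) \<le> ennreal ((1/2)^k)" for k
  proof -
    have "(\<integral>\<^sup>+x. ennreal (h k x) \<partial>M) = ennreal (LINT x|M. h k x)"
      by (rule nn_integral_eq_integral) (auto simp: h_def intro!: integrable_mult_right di)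
    also have "(LINT x|M. h k x) = 2^k * (LINT x|M. (F (r (Suc k)) x - F (r k) x)\<^sup>2)"
      by (simp add: h_def)
    also have "\<dots> \<le> 2^k * (1/4)^k"
      by (intro mult_left_mono less_imp_le[OF N[OF rS rN]]) simp
    also have "\<dots> = (1/2::real)^k" by (simp add: power_mult_distrib[symmetric])
    finally show ?thesis by (simp add: ennreal_leI)
  qed
  have "(\<integral>\<^sup>+x. (\<Sum>k. ennreal (h k x)) \<partial>M) = (\<Sum>k. \<integral>\<^sup>+x. ennreal (h k x) \<partial>M)"
    by (rule nn_integral_suminf) measurable
  also have "\<dots> \<le> (\<Sum>k. ennreal ((1/2)^k))" by (intro suminf_le nnh) auto
  also have "\<dots> = ennreal (\<Sum>k. (1/2)^k)" by (rule suminf_ennreal2) (auto intro: summable_geometric)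
  also have "\<dots> < \<infinity>" by simp
  finally have "AE x in M. (\<Sum>k. ennreal (h k x)) \<noteq> \<infinity>"
    by (intro nn_integral_PInf_AE) auto
  then have conv: "AE x in M. convergent (\<lambda>k. F (r k) x)"
  proof eventually_elim
    case (elim x)
    have h0: "0 \<le> h k x" for k by (simp add: h_def)
    have sm: "summable (\<lambda>k. h k x)"
      using elim by (intro summable_suminf_not_top h0) auto
    define S where "S = (\<Sum>k. h k x)"
    have hS: "h k x \<le> S" for k
      unfolding S_def using sum_le_suminf[OF sm, of "{k}"] h0 by auto
    have "\<bar>F (r (Suc k)) x - F (r k) x\<bar> \<le> sqrt S * (1 / sqrt 2)^k" for k
    proof -
      have "(F (r (Suc k)) x - F (r k) x)\<^sup>2 \<le> S * (1/2)^k"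
        using hS[of k] by (simp add: h_def field_simps)
      then have "sqrt ((F (r (Suc k)) x - F (r k) x)\<^sup>2) \<le> sqrt (S * (1/2)^k)" by (rule real_sqrt_le_mono)
      then have "\<bar>F (r (Suc k)) x - F (r k) x\<bar> \<le> sqrt (S * (1/2)^k)" by (simp only: real_sqrt_abs)
      then show ?thesis by (simp add: real_sqrt_mult real_sqrt_power real_sqrt_divide)
    qed
    then have "summable (\<lambda>k. F (r (Suc k)) x - F (r k) x)"
      by (intro summable_comparison_test[OF _ summable_mult[OF summable_geometric]]) auto
    then have "convergent (\<lambda>n. \<Sum>k<n. F (r (Suc k)) x - F (r k) x)" by (simp add: summable_iff_convergent)
    then have "convergent (\<lambda>n. F (r n) x - F (r 0) x)" using sum_lessThan_telescope[of "\<lambda>k. F (r k) x"] by simp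
    then show ?case using convergent_add[OF _ convergent_const[of "F (r 0) x"]] by fastforce
  qed
  define f where "f x = lim (\<lambda>k. F (r k) x)" for x
  have [measurable]: "f \<in> borel_measurable M" unfolding f_def by measurable
  have lim: "AE x in M. (\<lambda>k. F (r k) x) \<longlonglongrightarrow> f x"
    using conv by eventually_elim (simp add: f_def convergent_LIMSEQ_iff)
  have key: "(\<integral>\<^sup>+x. ennreal ((F n x - f x)\<^sup>2) \<partial>M) \<le> ennreal e"
    if e: "\<And>k. k \<ge> K \<Longrightarrow> (LINT x|M. (F n x - F (r k) x)\<^sup>2) \<le> e" for n K e
  proof -
    have "(\<integral>\<^sup>+x. ennreal ((F n x - f x)\<^sup>2) \<partial>M) = (\<integral>\<^sup>+x. liminf (\<lambda>k. ennreal ((F n x - F (r k) x)\<^sup>2)) \<partial>M)"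
    proof (rule nn_integral_cong_AE)
      show "AE x in M. ennreal ((F n x - f x)\<^sup>2) = liminf (\<lambda>k. ennreal ((F n x - F (r k) x)\<^sup>2))"
        using lim
      proof eventually_elim
        case (elim x)
        have "(\<lambda>k. ennreal ((F n x - F (r k) x)\<^sup>2)) \<longlonglongrightarrow> ennreal ((F n x - f x)\<^sup>2)"
          by (intro tendsto_ennrealI tendsto_intros elim)
        then show ?case by (metis lim_imp_Liminf trivial_limit_sequentially)
      qed
    qed
    also have "\<dots> \<le> liminf (\<lambda>k. \<integral>\<^sup>+x. ennreal ((F n x - F (r k) x)\<^sup>2) \<partial>M)"
      by (rule nn_integral_liminf) measurable
    also have "\<dots> \<le> ennreal e"
    proof (rule Liminf_le)
      show "\<forall>\<^sub>F k in sequentially. (\<integral>\<^sup>+x. ennreal ((F n x - F (r k) x)\<^sup>2) \<partial>M) \<le> ennreal e"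
      proof (rule eventually_sequentiallyI[of K])
        fix k assume "K \<le> k"
        have "(\<integral>\<^sup>+x. ennreal ((F n x - F (r k) x)\<^sup>2) \<partial>M) = ennreal (LINT x|M. (F n x - F (r k) x)\<^sup>2)"
          by (rule nn_integral_eq_integral[OF di]) simp
        then show "(\<integral>\<^sup>+x. ennreal ((F n x - F (r k) x)\<^sup>2) \<partial>M) \<le> ennreal e"
          using e[OF \<open>K \<le> k\<close>] by (simp add: ennreal_leI)
      qed
    qed simp
    finally show ?thesis .
  qed
  have fin: "integrable M (\<lambda>x. (F (N 0) x - f x)\<^sup>2)"
  proof -
    have "(\<integral>\<^sup>+x. ennreal ((F (N 0) x - f x)\<^sup>2) \<partial>M) \<le> ennreal 1"
    proof (rule key[of "0"])
      fix k show "(LINT x|M. (F (N 0) x - F (r k) x)\<^sup>2) \<le> 1"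
        using N[of 0 "N 0" "r k"] member_le_sum[of 0 "{..k}" N] by (simp add: r_def less_imp_le)
    qed
    also have "\<dots> < \<infinity>" by simp
    finally show ?thesis by (intro integrableI_bounded) (auto simp: )
  qed
  then have "sqint M (\<lambda>x. F (N 0) x - f x)" by (simp add: sqint_def)
  from sqint_lin[OF F[of "N 0"] this, of "-1"] have sf: "sqint M f" by simp
  have "(\<lambda>n. LINT x|M. (F n x - f x)\<^sup>2) \<longlonglongrightarrow> 0"
  proof (rule LIMSEQ_I)
    fix e :: real assume "0 < e"
    obtain K where K: "\<And>m n. m \<ge> K \<Longrightarrow> n \<ge> K \<Longrightarrow> (LINT x|M. (F m x - F n x)\<^sup>2) < e / 2"
      using Cau[of "e/2"] \<open>0 < e\<close> by auto
    show "\<exists>n0. \<forall>n\<ge>n0. norm ((LINT x|M. (F n x - f x)\<^sup>2) - 0) < e"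
    proof (intro exI[of _ K] allI impI)
      fix n assume n: "K \<le> n"
      have i: "integrable M (\<lambda>x. (F n x - f x)\<^sup>2)"
        using sqint_lin[OF F[of n] sf, of "-1"] by (simp add: sqint_def)
      have "ennreal (LINT x|M. (F n x - f x)\<^sup>2) = (\<integral>\<^sup>+x. ennreal ((F n x - f x)\<^sup>2) \<partial>M)"
        by (rule nn_integral_eq_integral[symmetric, OF i]) simp
      also have "\<dots> \<le> ennreal (e / 2)"
      proof (rule key)
        fix k assume "K \<le> k"
        then have "K \<le> r k" using rk[of k] by simp
        then show "(LINT x|M. (F n x - F (r k) x)\<^sup>2) \<le> e / 2" using K[OF n] by (simp add: less_imp_le)
      qed
      finally have "(LINT x|M. (F n x - f x)\<^sup>2) \<le> e / 2"
        using \<open>0 < e\<close> by (subst (asm) ennreal_le_iff) auto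
      moreover have "0 \<le> (LINT x|M. (F n x - f x)\<^sup>2)" by (intro integral_nonneg_AE) simp
      ultimately show "norm ((LINT x|M. (F n x - f x)\<^sup>2) - 0) < e" using \<open>0 < e\<close> by simp
    qed
  qed
  moreover have "f x = 0" if "\<And>n. F n x = 0" for x
    using that by (simp add: f_def)
  ultimately show thesis using that sf by blast
qed

section \<open>Functions with an integrable mixed derivative\<close>

text \<open>Data are Borel functions on the whole space, extended by zero. Fubini's theorem for products of \<^const>\<open>lborel\<close>
  then applies directly, and \<^const>\<open>primitive\<close> effectively starts at the left end of the support.\<close>

definition L1_in :: "'a::euclidean_space set \<Rightarrow> ('a \<Rightarrow> real) \<Rightarrow> bool" where
  "L1_in S f \<longleftrightarrow> integrable lborel f \<and> (\<forall>x. x \<notin> S \<longrightarrow> f x = 0)"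

definition L2_in :: "'a::euclidean_space set \<Rightarrow> ('a \<Rightarrow> real) \<Rightarrow> bool" where
  "L2_in S f \<longleftrightarrow> sqint lborel f \<and> (\<forall>x. x \<notin> S \<longrightarrow> f x = 0)"

lemma L2_in_L1_in:
  assumes "S \<in> sets borel" "emeasure lborel S < \<infinity>" "L2_in S f"
  shows "L1_in S f"
proof -
  have "integrable lborel f"
  proof (rule Bochner_Integration.integrable_bound)
    show "integrable lborel (\<lambda>x. indicator S x + (f x)\<^sup>2)"
      using assms by (auto simp: L2_in_def sqint_def)
    show "AE x in lborel. norm (f x) \<le> norm (indicator S x + (f x)\<^sup>2)"
    proof (intro AE_I2)
      fix x
      have "\<bar>f x\<bar> \<le> 1 + (f x)\<^sup>2"
        using sum_squares_bound[of "\<bar>f x\<bar>" 1] by simp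
      then show "norm (f x) \<le> norm (indicator S x + (f x)\<^sup>2)"
        using assms(3) by (cases "x \<in> S") (auto simp: L2_in_def)
    qed
  qed (use assms in \<open>auto simp: L2_in_def sqint_def\<close>)
  then show ?thesis using assms by (simp add: L1_in_def L2_in_def)
qed

lemma Omega_borel[simp, measurable]: "Omega T \<in> sets borel"
  unfolding Omega_def by (simp add: borel_Times)

lemma Omega_cbox: "Omega T = cbox (0,0) (1,T)"
  by (auto simp: Omega_def cbox_Pair_eq)

lemma emeasure_Omega: "emeasure lborel (Omega T) < \<infinity>"
  unfolding Omega_cbox by (rule emeasure_lborel_cbox_finite)

lemma L2_in_Icc_L1_in: "L2_in {0..A::real} f \<Longrightarrow> L1_in {0..A} f"
  by (rule L2_in_L1_in) (auto simp: emeasure_lborel_Icc_eq)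

lemma L2_in_Omega_L1_in: "L2_in (Omega T) f \<Longrightarrow> L1_in (Omega T) f"
  by (rule L2_in_L1_in[OF Omega_borel emeasure_Omega])

lemma L2_in_lin: "L2_in S f \<Longrightarrow> L2_in S g \<Longrightarrow> L2_in S (\<lambda>x. f x + c * g x)"
  by (simp add: L2_in_def sqint_lin)

text \<open>The derivatives under the integrals of the inner products are known only up to null sets;
  completeness of Lebesgue measure makes them measurable nevertheless.\<close>

lemma measurable_lebesgue_on_AE:
  fixes f g :: "'a::euclidean_space \<Rightarrow> real"
  assumes R: "R \<in> sets borel" and g: "g \<in> borel_measurable borel"
    and ae: "AE x in lborel. x \<in> R \<longrightarrow> f x = g x"
  shows "f \<in> borel_measurable (lebesgue_on R)"
proof -
  have [measurable]: "R \<in> sets borel" "g \<in> borel_measurable borel" by fact+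
  have "(\<lambda>x. indicator R x *\<^sub>R g x) \<in> borel_measurable borel" by measurable
  then have "(\<lambda>x. indicator R x *\<^sub>R g x) \<in> borel_measurable lebesgue"
    by (intro measurable_completion) simp
  moreover have "AE x in lebesgue. indicator R x *\<^sub>R g x = indicator R x *\<^sub>R f x"
    using AE_completion[OF ae] by eventually_elim (auto simp: indicator_def)
  ultimately have "(\<lambda>x. indicator R x *\<^sub>R f x) \<in> borel_measurable lebesgue"
    by (rule borel_measurable_AE)
  then show ?thesis using R by (subst borel_measurable_restrict_space_iff) (auto simp: sets_completionI_sets)
qed

lemma
  fixes f g :: "'a::euclidean_space \<Rightarrow> real"
  assumes R: "R \<in> sets borel" and g: "g \<in> borel_measurable borel"
    and ae: "AE x in lborel. x \<in> R \<longrightarrow> f x = g x"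
  shows LINT_lebesgue_on_AE: "(LINT x|lebesgue_on R. f x) = (LINT x:R|lborel. g x)"
    and integrable_lebesgue_on_AE: "integrable (lebesgue_on R) f \<longleftrightarrow> set_integrable lborel R g"
proof -
  have [measurable]: "R \<in> sets borel" "g \<in> borel_measurable borel" by fact+
  have RL: "R \<inter> space lebesgue \<in> sets lebesgue" using R by (simp add: sets_completionI_sets)
  have fm: "(\<lambda>x. indicator R x *\<^sub>R f x) \<in> borel_measurable lebesgue"
    using measurable_lebesgue_on_AE[OF assms] RL by (simp add: borel_measurable_restrict_space_iff)
  have gb: "(\<lambda>x. indicator R x *\<^sub>R g x) \<in> borel_measurable lborel" by measurable
  have gm: "(\<lambda>x. indicator R x *\<^sub>R g x) \<in> borel_measurable lebesgue"
    by (rule measurable_completion[OF gb])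
  have ae': "AE x in lebesgue. indicator R x *\<^sub>R f x = indicator R x *\<^sub>R g x"
    using AE_completion[OF ae] by eventually_elim (auto simp: indicator_def)
  have "(LINT x|lebesgue_on R. f x) = (LINT x|lebesgue. indicator R x *\<^sub>R f x)"
    by (rule integral_restrict_space[OF RL])
  also have "\<dots> = (LINT x|lebesgue. indicator R x *\<^sub>R g x)"
    by (rule integral_cong_AE[OF fm gm ae'])
  also have "\<dots> = (LINT x:R|lborel. g x)"
    unfolding set_lebesgue_integral_def by (rule integral_completion[OF gb])
  finally show "(LINT x|lebesgue_on R. f x) = (LINT x:R|lborel. g x)" .
  have "integrable (lebesgue_on R) f \<longleftrightarrow> integrable lebesgue (\<lambda>x. indicator R x *\<^sub>R f x)"
    by (rule integrable_restrict_space[OF RL])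
  also have "\<dots> \<longleftrightarrow> integrable lebesgue (\<lambda>x. indicator R x *\<^sub>R g x)"
    by (rule integrable_cong_AE[OF fm gm ae'])
  also have "\<dots> \<longleftrightarrow> set_integrable lborel R g"
    unfolding set_integrable_def by (rule integrable_completion[OF gb])
  finally show "integrable (lebesgue_on R) f \<longleftrightarrow> set_integrable lborel R g" .
qed

lemma lebesgue_on_borel_rep:
  fixes f :: "'a::euclidean_space \<Rightarrow> real"
  assumes S: "S \<in> sets borel" and f: "integrable (lebesgue_on S) f"
  obtains f' where "L1_in S f'" "AE x in lborel. x \<in> S \<longrightarrow> f x = f' x"
proof -
  have SL: "S \<inter> space lebesgue \<in> sets lebesgue" using S by (simp add: sets_completionI_sets)
  have "integrable lebesgue (\<lambda>x. indicator S x *\<^sub>R f x)" using f by (simp add: integrable_restrict_space[OF SL])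
  then have "(\<lambda>x. indicator S x *\<^sub>R f x) \<in> borel_measurable lebesgue" by simp
  from completion_ex_borel_measurable_real[OF this]
  obtain g where g: "g \<in> borel_measurable lborel" "AE x in lborel. indicator S x *\<^sub>R f x = g x" by blast
  have [measurable]: "S \<in> sets borel" "g \<in> borel_measurable borel" using S g by auto
  define f' where "f' x = indicator S x * g x" for x
  have f'm: "f' \<in> borel_measurable borel" unfolding f'_def by measurable
  have ae: "AE x in lborel. x \<in> S \<longrightarrow> f x = f' x"
    using g(2) by eventually_elim (auto simp: f'_def indicator_def)
  have "set_integrable lborel S f'"
    using integrable_lebesgue_on_AE[OF S f'm ae] f by simp
  moreover have "(\<lambda>x. indicator S x *\<^sub>R f' x) = f'" by (auto simp: f'_def indicator_def fun_eq_iff)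
  ultimately have "L1_in S f'" by (simp add: L1_in_def set_integrable_def) (simp add: f'_def)
  then show thesis using ae that by blast
qed

lemma L1_in_measurable: "L1_in S f \<Longrightarrow> f \<in> borel_measurable borel"
  by (auto simp: L1_in_def)

lemma L2_on_AE_iff:
  assumes S: "S \<in> sets borel" and f': "f' \<in> borel_measurable borel" "\<forall>x. x \<notin> S \<longrightarrow> f' x = 0"
    and ae: "AE x in lborel. x \<in> S \<longrightarrow> f x = f' x"
  shows "L2_on S f \<longleftrightarrow> L2_in S f'"
proof -
  have m: "(\<lambda>x. (f' x)\<^sup>2) \<in> borel_measurable borel" using f' by measurable
  have ae2: "AE x in lborel. x \<in> S \<longrightarrow> (f x)\<^sup>2 = (f' x)\<^sup>2" using ae by eventually_elim auto
  have eq: "(\<lambda>x. indicator S x *\<^sub>R (f' x)\<^sup>2) = (\<lambda>x. (f' x)\<^sup>2)" using f'(2) by (auto simp: indicator_def fun_eq_iff)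
  show ?thesis
    unfolding L2_on_def L2_in_def sqint_def
    using measurable_lebesgue_on_AE[OF S f'(1) ae] integrable_lebesgue_on_AE[OF S m ae2] f' eq
    by (simp add: set_integrable_def)
qed

lemma LINT_mult_lebesgue_on:
  fixes f f' g g' :: "'a::euclidean_space \<Rightarrow> real"
  assumes S: "S \<in> sets borel" and m: "f' \<in> borel_measurable borel" "g' \<in> borel_measurable borel"
    and z: "\<forall>x. x \<notin> S \<longrightarrow> f' x = 0"
    and ae: "AE x in lborel. x \<in> S \<longrightarrow> f x = f' x" "AE x in lborel. x \<in> S \<longrightarrow> g x = g' x"
  shows "(LINT x|lebesgue_on S. f x * g x) = (LINT x|lborel. f' x * g' x)"
proof -
  have mm: "(\<lambda>x. f' x * g' x) \<in> borel_measurable borel" by (rule borel_measurable_times[OF m])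
  have aa: "AE x in lborel. x \<in> S \<longrightarrow> f x * g x = f' x * g' x" using ae by eventually_elim auto
  have eq: "(\<lambda>x. indicator S x *\<^sub>R (f' x * g' x)) = (\<lambda>x. f' x * g' x)" using z by (auto simp: indicator_def fun_eq_iff)
  show ?thesis using LINT_lebesgue_on_AE[OF S mm aa] eq by (simp add: set_lebesgue_integral_def)
qed

definition mixed_integral :: "real \<Rightarrow> (real \<Rightarrow> real) \<Rightarrow> (real \<Rightarrow> real) \<Rightarrow> (real \<times> real \<Rightarrow> real) \<Rightarrow> real \<Rightarrow> real \<Rightarrow> real" where
  "mixed_integral a b c d x t = a + primitive b x + primitive c t + primitive2 d x t"

lemma primitive_Icc: "L1_in {0..A} f \<Longrightarrow> (LINT \<xi>:{0..x}|lborel. f \<xi>) = primitive f x"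
  unfolding primitive_def set_lebesgue_integral_def
  by (rule Bochner_Integration.integral_cong) (auto simp: L1_in_def indicator_def)

lemma primitive2_Icc: "L1_in (Omega T) f \<Longrightarrow> (LINT q:{0..x} \<times> {0..t}|lborel. f q) = primitive2 f x t"
  unfolding primitive2_def set_lebesgue_integral_def
proof (rule Bochner_Integration.integral_cong)
  fix q assume "L1_in (Omega T) f"
  then show "indicator ({0..x} \<times> {0..t}) q *\<^sub>R f q = indicator ({..x} \<times> {..t}) q *\<^sub>R f q"
    by (cases "q \<in> Omega T") (auto simp: L1_in_def indicator_def Omega_def)
qed simp

lemma LINT_primitive:
  assumes "L1_in {0..A} f'" "AE x in lborel. x \<in> {0..A} \<longrightarrow> f x = f' x" "x \<in> {0..A}"
  shows "(LINT \<xi>|lebesgue_on {0..x}. f \<xi>) = primitive f' x"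
proof -
  have "AE y in lborel. y \<in> {0..x} \<longrightarrow> f y = f' y"
    using assms(2) by eventually_elim (use assms(3) in auto)
  from LINT_lebesgue_on_AE[OF _ L1_in_measurable[OF assms(1)] this] show ?thesis
    using primitive_Icc[OF assms(1)] by simp
qed

lemma LINT_primitive2:
  assumes "L1_in (Omega T) f'" "AE x in lborel. x \<in> Omega T \<longrightarrow> f x = f' x" "x \<in> {0..1}" "t \<in> {0..T}"
  shows "(LINT q|lebesgue_on ({0..x} \<times> {0..t}). f q) = primitive2 f' x t"
proof -
  have "AE y in lborel. y \<in> {0..x} \<times> {0..t} \<longrightarrow> f y = f' y"
    using assms(2) by eventually_elim (use assms(3,4) in \<open>auto simp: Omega_def\<close>)
  from LINT_lebesgue_on_AE[OF _ L1_in_measurable[OF assms(1)] this] show ?thesis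
    using primitive2_Icc[OF assms(1)] by (simp add: borel_Times)
qed

text \<open>\<^const>\<open>completely_continuous\<close> with a named choice of the constant and of Borel versions of the three
  densities.\<close>

definition mixed_L1 :: "real \<Rightarrow> (real \<Rightarrow> real \<Rightarrow> real) \<Rightarrow> real \<Rightarrow> (real \<Rightarrow> real) \<Rightarrow> (real \<Rightarrow> real) \<Rightarrow> (real \<times> real \<Rightarrow> real) \<Rightarrow> bool" where
  "mixed_L1 T w a b c d \<longleftrightarrow> L1_in {0..1} b \<and> L1_in {0..T} c \<and> L1_in (Omega T) d \<and>
     (\<forall>x\<in>{0..1}. \<forall>t\<in>{0..T}. w x t = mixed_integral a b c d x t)"

lemma L1_in_integrable_lebesgue_on:
  assumes "S \<in> sets borel" "L1_in S f" shows "integrable (lebesgue_on S) f"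
  using integrable_lebesgue_on_AE[OF assms(1) L1_in_measurable[OF assms(2)], of f] assms
    set_integrable_borel[of f S] by (simp add: L1_in_def)

lemma completely_continuous_iff: "completely_continuous T w \<longleftrightarrow> (\<exists>a b c d. mixed_L1 T w a b c d)"
proof
  assume "completely_continuous T w"
  then obtain a b c d where 1: "integrable (lebesgue_on {0..1}) b" "integrable (lebesgue_on {0..T}) c"
      "integrable (lebesgue_on (Omega T)) d"
    and w: "\<And>x t. x\<in>{0..1} \<Longrightarrow> t\<in>{0..T} \<Longrightarrow>
           w x t = a + (LINT \<xi>|lebesgue_on {0..x}. b \<xi>) + (LINT \<eta>|lebesgue_on {0..t}. c \<eta>)
                     + (LINT q|lebesgue_on ({0..x} \<times> {0..t}). d q)"
    unfolding completely_continuous_def by blast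
  obtain b' where b: "L1_in {0..1} b'" "AE x in lborel. x \<in> {0..1} \<longrightarrow> b x = b' x"
    using lebesgue_on_borel_rep[OF _ 1(1)] by auto
  obtain c' where c: "L1_in {0..T} c'" "AE x in lborel. x \<in> {0..T} \<longrightarrow> c x = c' x"
    using lebesgue_on_borel_rep[OF _ 1(2)] by auto
  obtain d' where d: "L1_in (Omega T) d'" "AE x in lborel. x \<in> Omega T \<longrightarrow> d x = d' x"
    using lebesgue_on_borel_rep[OF _ 1(3)] by auto
  have "mixed_L1 T w a b' c' d'"
    unfolding mixed_L1_def mixed_integral_def
    using b(1) c(1) d(1) w LINT_primitive[OF b] LINT_primitive[OF c] LINT_primitive2[OF d] by simp
  then show "\<exists>a b c d. mixed_L1 T w a b c d" by blast
next
  assume "\<exists>a b c d. mixed_L1 T w a b c d"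
  then obtain a b c d where r: "mixed_L1 T w a b c d" by blast
  then have l: "L1_in {0..1} b" "L1_in {0..T} c" "L1_in (Omega T) d" by (auto simp: mixed_L1_def)
  show "completely_continuous T w"
    unfolding completely_continuous_def
  proof (intro exI conjI ballI)
    show "integrable (lebesgue_on {0..1}) b" "integrable (lebesgue_on {0..T}) c" "integrable (lebesgue_on (Omega T)) d"
      using l by (auto intro: L1_in_integrable_lebesgue_on)
    fix x t assume xt: "x \<in> {0..1::real}" "t \<in> {0..T}"
    show "w x t = a + (LINT \<xi>|lebesgue_on {0..x}. b \<xi>) + (LINT \<eta>|lebesgue_on {0..t}. c \<eta>)
                     + (LINT q|lebesgue_on ({0..x} \<times> {0..t}). d q)"
      using r xt LINT_primitive[OF l(1)] LINT_primitive[OF l(2)] LINT_primitive2[OF l(3)]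
      by (simp add: mixed_L1_def mixed_integral_def)
  qed
qed

lemma vector_derivative_Icc:
  fixes f :: "real \<Rightarrow> real"
  assumes "0 < A" "x \<in> {0..A}" "(f has_vector_derivative D) (at x within {0..A})"
  shows "vector_derivative f (at x within {0..A::real}) = D"
  using vector_derivative_within_closed_interval[of 0 A x f D] assms by simp

lemma has_vector_derivative_cong_Icc:
  fixes f g :: "real \<Rightarrow> real"
  assumes "x \<in> {0..A::real}" "\<And>y. y \<in> {0..A} \<Longrightarrow> f y = g y"
  shows "(f has_vector_derivative D) (at x within {0..A}) \<longleftrightarrow> (g has_vector_derivative D) (at x within {0..A})"
  using has_vector_derivative_transform[OF assms(1), of f g D] has_vector_derivative_transform[OF assms(1), of g f D] assms(2)
  by metis

lemma AE_derivative_primitive_Icc: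
  assumes "0 < A" "integrable lborel b" "\<And>x. x \<in> {0..A} \<Longrightarrow> f x = a + primitive b x"
  shows "AE x in lborel. x \<in> {0..A} \<longrightarrow> (f has_vector_derivative b x) (at x within {0..A})"
  using lebesgue_differentiation[OF assms(2)]
proof eventually_elim
  case (elim x)
  show ?case
  proof
    assume x: "x \<in> {0..A}"
    have "((\<lambda>x. a + primitive b x) has_real_derivative 0 + b x) (at x)" by (intro DERIV_add DERIV_const elim)
    then have "((\<lambda>x. a + primitive b x) has_vector_derivative b x) (at x within {0..A})"
      by (simp add: has_real_derivative_iff_has_vector_derivative has_vector_derivative_at_within)
    then show "(f has_vector_derivative b x) (at x within {0..A})"
      using has_vector_derivative_cong_Icc[OF x, of f "\<lambda>x. a + primitive b x"] assms(3) by simp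
  qed
qed

lemma primitive_0: "L1_in {0..A} f \<Longrightarrow> primitive f 0 = 0"
proof -
  assume f: "L1_in {0..A} f"
  have "primitive f 0 = (LINT y:{0..0}|lborel. f y)" using primitive_Icc[OF f, of 0] by simp
  then show ?thesis using primitive_diff[of f 0 0] f by (simp add: L1_in_def)
qed

lemma L1_in_strip_integrable:
  assumes "L1_in (Omega T) d" shows "L1_in {0..T} (strip d x)"
  using integrable_strip[of d x] assms by (auto simp: L1_in_def Omega_def primitive_def set_lebesgue_integral_def)

lemma primitive_AE_zero:
  assumes "integrable lborel g" "AE x in lborel. g x = 0"
  shows "primitive g t = 0"
proof -
  have [measurable]: "g \<in> borel_measurable borel" using assms(1) by auto
  have "(LINT y|lborel. indicator {..t} y *\<^sub>R g y) = (LINT y::real|lborel. (0::real))"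
    by (rule integral_cong_AE) (use assms(2) in \<open>auto elim: eventually_mono\<close>)
  then show ?thesis by (simp add: primitive_def set_lebesgue_integral_def)
qed

text \<open>Both vanish because \<open>d\<close> is carried by the closed first quadrant and coordinate axes are null.\<close>

lemma primitive2_0:
  assumes d: "L1_in (Omega T) d" shows "primitive2 d x 0 = 0" "primitive2 d 0 t = 0"
proof -
  show "primitive2 d x 0 = 0"
    using primitive2_eq[of d x 0] primitive_0[OF L1_in_strip_integrable[OF d]] d by (simp add: L1_in_def)
  have "strip d 0 \<eta> = 0" if "integrable lborel (\<lambda>\<xi>. d (\<xi>, \<eta>))" for \<eta>
    by (rule primitive_0[of 1]) (use d that in \<open>auto simp: L1_in_def Omega_def\<close>)
  then have ae: "AE \<eta> in lborel. strip d 0 \<eta> = 0"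
    using strip_integrable_AE[of d] d by (auto simp: L1_in_def elim: eventually_mono)
  have "primitive (strip d 0) t = 0"
    by (rule primitive_AE_zero) (use ae integrable_strip[of d 0] d in \<open>auto simp: L1_in_def\<close>)
  then show "primitive2 d 0 t = 0" using primitive2_eq[of d 0 t] d by (simp add: L1_in_def)
qed

lemma mixed_L1_AE_dT:
  assumes T: "0 < T" and r: "mixed_L1 T w a b c d"
  shows "AE t in lborel. t \<in> {0..T} \<longrightarrow> (\<forall>x\<in>{0..1}.
     ((\<lambda>t. w x t) has_vector_derivative c t + strip d x t) (at t within {0..T}))"
proof -
  have i: "integrable lborel c" "integrable lborel d" using r by (auto simp: mixed_L1_def L1_in_def)
  show ?thesis
    using lebesgue_differentiation[OF i(1)] AE_primitive2_partial[OF i(2)]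
  proof eventually_elim
    case (elim t)
    show ?case
    proof (intro impI ballI)
      fix x :: real assume t: "t \<in> {0..T}" and x: "x \<in> {0..1}"
      have "((\<lambda>t. a + primitive b x + primitive c t + primitive2 d x t) has_real_derivative 0 + 0 + c t + strip d x t) (at t)"
        by (intro DERIV_add DERIV_const elim(1) elim(2)[rule_format])
      then have "((\<lambda>t. mixed_integral a b c d x t) has_vector_derivative c t + strip d x t) (at t within {0..T})"
        by (simp add: mixed_integral_def has_real_derivative_iff_has_vector_derivative has_vector_derivative_at_within)
      then show "((\<lambda>t. w x t) has_vector_derivative c t + strip d x t) (at t within {0..T})"
        using has_vector_derivative_cong_Icc[OF t, of "w x" "mixed_integral a b c d x"] r x by (simp add: mixed_L1_def)
    qed
  qed
qed

lemma mixed_L1_AE_dT_0: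
  assumes T: "0 < T" and r: "mixed_L1 T w a b c d"
  shows "AE t in lborel. t \<in> {0..T} \<longrightarrow> ((\<lambda>t. w 0 t) has_vector_derivative c t) (at t within {0..T})"
proof (rule AE_derivative_primitive_Icc[OF T])
  show "integrable lborel c" using r by (auto simp: mixed_L1_def L1_in_def)
  have l: "L1_in {0..1} b" "L1_in {0..T} c" "L1_in (Omega T) d" using r by (auto simp: mixed_L1_def)
  show "w 0 t = a + primitive c t" if "t \<in> {0..T}" for t
    using r that primitive_0[OF l(1)] primitive2_0[OF l(3)] by (simp add: mixed_L1_def mixed_integral_def)
qed

lemma mixed_L1_at_0: "mixed_L1 T w a b c d \<Longrightarrow> 0 \<le> T \<Longrightarrow> x \<in> {0..1} \<Longrightarrow> w x 0 = a + primitive b x"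
  using primitive_0[of T c] primitive2_0[of T d] by (simp add: mixed_L1_def mixed_integral_def)

lemma mixed_L1_AE_dX_0:
  assumes T: "0 < T" and r: "mixed_L1 T w a b c d"
  shows "AE x in lborel. x \<in> {0..1} \<longrightarrow> ((\<lambda>x. w x 0) has_vector_derivative b x) (at x within {0..1})"
proof (rule AE_derivative_primitive_Icc)
  show "integrable lborel b" using r by (auto simp: mixed_L1_def L1_in_def)
  show "w x 0 = a + primitive b x" if "x \<in> {0..1}" for x
    using mixed_L1_at_0[OF r _ that] T by simp
qed simp

text \<open>For almost every \<open>t\<close> the \<open>t\<close>-derivative of \<open>w\<close> is known simultaneously at all \<open>x\<close>; only
  therefore can it be differentiated in \<open>x\<close>.\<close>

theorem mixed_L1_AE_mixed:
  assumes T: "0 < T" and r: "mixed_L1 T w a b c d"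
  shows "AE q in lborel. q \<in> Omega T \<longrightarrow> (case q of (x, t) \<Rightarrow> dX (dT T w) x t) = d q"
proof -
  have i: "integrable lborel c" "integrable lborel d" using r by (auto simp: mixed_L1_def L1_in_def)
  show ?thesis
    using AE_lborel_snd[OF mixed_L1_AE_dT[OF T r]] AE_strip_derivative[OF i(2)]
  proof eventually_elim
    case (elim q)
    obtain x t where q: "q = (x, t)" by fastforce
    show ?case
    proof
      assume "q \<in> Omega T"
      then have x: "x \<in> {0..1}" and t: "t \<in> {0..T}" by (auto simp: q Omega_def)
      have 1: "dT T w y t = c t + strip d y t" if "y \<in> {0..1}" for y
        unfolding dT_def using elim(1) t that T by (intro vector_derivative_Icc) (auto simp: q)
      have "((\<lambda>y. c t + strip d y t) has_real_derivative 0 + d q) (at x)"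
        by (intro DERIV_add DERIV_const) (use elim(2) in \<open>simp add: q\<close>)
      then have "((\<lambda>y. c t + strip d y t) has_vector_derivative d q) (at x within {0..1})"
        by (simp add: has_real_derivative_iff_has_vector_derivative has_vector_derivative_at_within)
      then have "((\<lambda>y. dT T w y t) has_vector_derivative d q) (at x within {0..1})"
        using has_vector_derivative_cong_Icc[OF x, of "\<lambda>y. dT T w y t" "\<lambda>y. c t + strip d y t"] 1 by simp
      then show "(case q of (x, t) \<Rightarrow> dX (dT T w) x t) = d q"
        unfolding q prod.case dX_def using x by (intro vector_derivative_Icc) auto
    qed
  qed
qed

section \<open>Square integrable data and their primitives\<close>

lemma integrable_indicator_Icc [simp]: "integrable lborel (indicator {0..A::real} :: real \<Rightarrow> real)"
  by (rule integrable_real_indicator) (auto simp: emeasure_lborel_Icc_eq)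

lemma indicator_sq: "(indicator S x :: real)\<^sup>2 = indicator S x"
  by (simp add: indicator_def)

lemma integrable_tensor:
  fixes f g :: "real \<Rightarrow> real"
  assumes f: "integrable lborel f" and g: "integrable lborel g"
  shows "integrable lborel (\<lambda>q. f (fst q) * g (snd q))"
    and "(LINT q|lborel. f (fst q) * g (snd q)) = (LINT x|lborel. f x) * (LINT y|lborel. g y)"
proof -
  have [measurable]: "f \<in> borel_measurable borel" "g \<in> borel_measurable borel" using f g by auto
  have i: "integrable (lborel \<Otimes>\<^sub>M lborel) (\<lambda>q. f (fst q) * g (snd q))"
  proof (rule lborel_pair.Fubini_integrable)
    show "integrable lborel (\<lambda>x. LINT y|lborel. norm (f (fst (x, y)) * g (snd (x, y))))"
      using f by (simp add: abs_mult)
    show "AE x in lborel. integrable lborel (\<lambda>y. f (fst (x, y)) * g (snd (x, y)))"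
      using g by simp
  qed measurable
  then show "integrable lborel (\<lambda>q. f (fst q) * g (snd q))" by (simp add: lborel_prod)
  show "(LINT q|lborel. f (fst q) * g (snd q)) = (LINT x|lborel. f x) * (LINT y|lborel. g y)"
    using lborel_pair.integral_fst'[OF i] by (simp add: lborel_prod)
qed

lemma primitive2_tensor:
  fixes f g :: "real \<Rightarrow> real"
  assumes f: "integrable lborel f" and g: "integrable lborel g"
  shows "primitive2 (\<lambda>q. f (fst q) * g (snd q)) x t = primitive f x * primitive g t"
proof -
  have i: "integrable lborel (\<lambda>y. indicator {..x} y * f y)" if "integrable lborel f" for x and f :: "real \<Rightarrow> real"
    using set_integrable_borel[OF that, of "{..x}"] by (simp add: set_integrable_def)
  show ?thesis
    using integrable_tensor(2)[OF i[OF f, of x] i[OF g, of t]]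
    by (simp add: primitive2_def primitive_def set_lebesgue_integral_def indicator_times mult_ac)
qed

lemma primitive2_eq_fst:
  assumes d: "integrable lborel d"
  shows "primitive2 d x t = primitive (\<lambda>\<xi>. primitive (\<lambda>\<eta>. d (\<xi>, \<eta>)) t) x"
proof -
  have i2: "integrable (lborel \<Otimes>\<^sub>M lborel) (case_prod (\<lambda>\<xi> \<eta>. indicator {..x} \<xi> * (indicator {..t} \<eta> * d (\<xi>, \<eta>))))"
    using set_integrable_borel[OF d, of "{..x} \<times> {..t}"]
    by (auto simp: set_integrable_def lborel_prod indicator_times case_prod_unfold borel_Times mult.assoc)
  show ?thesis
    using lborel_pair.integral_fst[OF i2]
    by (simp add: primitive2_def primitive_def set_lebesgue_integral_def lborel_prod indicator_times
          case_prod_unfold mult.assoc)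
qed

text \<open>Dominated convergence: the indicators of the quadrants converge off two coordinate lines.\<close>

lemma continuous_primitive2:
  assumes d: "integrable lborel d"
  shows "continuous_on UNIV (\<lambda>q. primitive2 d (fst q) (snd q))"
proof -
  have dm[measurable]: "d \<in> borel_measurable borel" using d by simp
  have "isCont (\<lambda>q. primitive2 d (fst q) (snd q)) q" for q
  proof (rule continuous_at_sequentiallyI)
    fix X assume X: "X \<longlonglongrightarrow> q"
    have X1: "(\<lambda>n. fst (X n)) \<longlonglongrightarrow> fst q" and X2: "(\<lambda>n. snd (X n)) \<longlonglongrightarrow> snd q"
      using X by (auto intro: tendsto_fst tendsto_snd)
    have ev: "eventually (\<lambda>n. indicator {..Y n} y = (indicator {..l} y :: real)) sequentially"
      if "y \<noteq> l" "Y \<longlonglongrightarrow> l" for Y and y l :: real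
    proof (cases "y < l")
      case True
      show ?thesis using order_tendstoD(1)[OF that(2) True] by eventually_elim (use True in auto)
    next
      case False
      then have xy: "l < y" using that(1) by auto
      show ?thesis using order_tendstoD(2)[OF that(2) xy] by eventually_elim (use xy in auto)
    qed
    have ae2: "AE y::real\<times>real in lborel. snd y \<noteq> snd q"
      by (rule AE_lborel_snd[OF AE_lborel_singleton])
    have "AE y::real\<times>real in lborel. y \<in> prod.swap -` {y. snd y \<noteq> fst q}"
    proof (rule AE_lborel_pairI)
      have "Measurable.pred (borel \<Otimes>\<^sub>M borel) (\<lambda>y. y \<in> prod.swap -` {y::real\<times>real. snd y \<noteq> fst q})"
        unfolding vimage_eq mem_Collect_eq snd_swap by measurable
      then show "Measurable.pred borel (\<lambda>y. y \<in> prod.swap -` {y::real\<times>real. snd y \<noteq> fst q})" by (simp add: borel_prod)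
      show "AE t in lborel. AE x in lborel. (x, t::real) \<in> prod.swap -` {y. snd y \<noteq> fst q}"
        using AE_lborel_singleton[of "fst q"] by simp
    qed
    then have ae1: "AE y::real\<times>real in lborel. fst y \<noteq> fst q" by simp
    show "(\<lambda>n. primitive2 d (fst (X n)) (snd (X n))) \<longlonglongrightarrow> primitive2 d (fst q) (snd q)"
      unfolding primitive2_def set_lebesgue_integral_def
    proof (rule integral_dominated_convergence[where w="\<lambda>y. \<bar>d y\<bar>"])
      show "AE y in lborel. (\<lambda>n. indicator ({..fst (X n)} \<times> {..snd (X n)}) y *\<^sub>R d y)
          \<longlonglongrightarrow> indicator ({..fst q} \<times> {..snd q}) y *\<^sub>R d y"
        using ae1 ae2
      proof eventually_elim
        case (elim y)
        have "eventually (\<lambda>n. indicator ({..fst (X n)} \<times> {..snd (X n)}) y *\<^sub>R d y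
            = indicator ({..fst q} \<times> {..snd q}) y *\<^sub>R d y) sequentially"
          using ev[OF elim(1) X1] ev[OF elim(2) X2]
          by eventually_elim (simp add: indicator_times)
        then show ?case by (rule tendsto_eventually)
      qed
      show "(\<lambda>y. indicator ({..fst q} \<times> {..snd q}) y *\<^sub>R d y) \<in> borel_measurable lborel"
        using set_integrable_borel[OF d, of "{..fst q} \<times> {..snd q}"] by (auto simp: set_integrable_def borel_Times)
      show "(\<lambda>y. indicator ({..fst (X n)} \<times> {..snd (X n)}) y *\<^sub>R d y) \<in> borel_measurable lborel" for n
        using set_integrable_borel[OF d, of "{..fst (X n)} \<times> {..snd (X n)}"] by (auto simp: set_integrable_def borel_Times)
    qed (use d in \<open>auto simp: indicator_def\<close>)
  qed
  then show ?thesis by (simp add: continuous_on_eq_continuous_at)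
qed

abbreviation rect :: "real \<Rightarrow> real \<Rightarrow> (real \<times> real) set" where
  "rect A B \<equiv> {0..A} \<times> {0..B}"

abbreviation sq :: "('a::euclidean_space \<Rightarrow> real) \<Rightarrow> real" where
  "sq f \<equiv> LINT x|lborel. (f x)\<^sup>2"

lemma sq_nonneg: "0 \<le> sq f" by (intro integral_nonneg_AE) simp

lemma L2_in_rect_L1_in: "L2_in (rect A B) d \<Longrightarrow> L1_in (rect A B) d"
proof (rule L2_in_L1_in)
  have "rect A B = cbox (0,0) (A,B)" by (auto simp: cbox_Pair_eq)
  then show "emeasure lborel (rect A B) < \<infinity>" by (simp only: emeasure_lborel_cbox_finite)
qed (auto simp: borel_Times)

lemma L2_in_integrable: "L2_in {0..A::real} f \<Longrightarrow> integrable lborel f" "L2_in (rect A B) d \<Longrightarrow> integrable lborel d"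
  using L2_in_Icc_L1_in L2_in_rect_L1_in by (auto simp: L1_in_def)

lemma sq_add: "L2_in S f \<Longrightarrow> L2_in S g \<Longrightarrow> sq (\<lambda>x. f x + c * g x) \<le> 2 * sq f + 2 * c\<^sup>2 * sq g"
proof -
  assume fg: "L2_in S f" "L2_in S g"
  have "sq (\<lambda>x. f x + c * g x) \<le> (LINT x|lborel. 2 * (f x)\<^sup>2 + 2 * c\<^sup>2 * (g x)\<^sup>2)"
  proof (rule integral_mono)
    show "integrable lborel (\<lambda>x. (f x + c * g x)\<^sup>2)" using L2_in_lin[OF fg, of c] by (simp add: L2_in_def sqint_def)
    show "integrable lborel (\<lambda>x. 2 * (f x)\<^sup>2 + 2 * c\<^sup>2 * (g x)\<^sup>2)" using fg by (simp add: L2_in_def sqint_def)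
    show "(f x + c * g x)\<^sup>2 \<le> 2 * (f x)\<^sup>2 + 2 * c\<^sup>2 * (g x)\<^sup>2" for x
      using sum_squares_bound[of "f x" "c * g x"] by (simp add: power2_sum power_mult_distrib)
  qed
  also have "\<dots> = 2 * sq f + 2 * c\<^sup>2 * sq g" using fg by (simp add: L2_in_def sqint_def)
  finally show ?thesis .
qed

lemma sq_indicator: "0 \<le> A \<Longrightarrow> sq (indicator {0..A::real}) = A"
  by (simp add: indicator_sq)

text \<open>Cauchy--Schwarz against the indicator of \<open>{0..A}\<close>.\<close>

lemma primitive_sq_bound:
  assumes f: "sqint lborel f" "\<And>x. x \<notin> {0..A} \<Longrightarrow> f x = 0" and A: "0 \<le> A"
  shows "(primitive f x)\<^sup>2 \<le> A * sq f"
proof -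
  have s: "sqint lborel (indicator {0..A} :: real \<Rightarrow> real)"
    by (simp add: sqint_def indicator_sq)
  have m[measurable]: "f \<in> borel_measurable borel" using f by (simp add: sqint_def)
  define g where "g y = indicator {..x} y * f y" for y
  have gi: "integrable lborel (\<lambda>y. (g y)\<^sup>2)"
    using integrable_mult_indicator[of "{..x}" lborel "\<lambda>y. (f y)\<^sup>2"] f
    by (auto simp: g_def power_mult_distrib indicator_sq sqint_def)
  have "g \<in> borel_measurable lborel" unfolding g_def[abs_def] by measurable
  with gi have gs: "sqint lborel g" by (simp add: sqint_def)
  have "primitive f x = (LINT y|lborel. indicator {0..A} y * g y)"
    unfolding primitive_def set_lebesgue_integral_def g_def
    by (rule Bochner_Integration.integral_cong) (use f(2) in \<open>auto simp: indicator_def\<close>)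
  then have "(primitive f x)\<^sup>2 \<le> (LINT y|lborel. indicator {0..A} y * indicator {0..A} y) * (LINT y|lborel. g y * g y)"
    using L2.Cauchy_Schwarz[of "indicator {0..A}" lborel g] s gs by simp
  also have "(LINT y|lborel. indicator {0..A} y * indicator {0..A} y) = A"
    using sq_indicator[OF A] by (simp add: power2_eq_square)
  also have "A * (LINT y|lborel. g y * g y) \<le> A * sq f"
  proof (intro mult_left_mono A integral_mono)
    show "integrable lborel (\<lambda>y. g y * g y)" using gi by (simp add: power2_eq_square)
    show "integrable lborel (\<lambda>y. (f y)\<^sup>2)" using f by (simp add: sqint_def)
    show "g y * g y \<le> (f y)\<^sup>2" for y by (auto simp: g_def indicator_def power2_eq_square)
  qed
  finally show ?thesis .
qed

lemma L2_in_primitive_bound: "L2_in {0..A} f \<Longrightarrow> 0 \<le> A \<Longrightarrow> (primitive f x)\<^sup>2 \<le> A * sq f"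
  by (rule primitive_sq_bound) (auto simp: L2_in_def)

lemma L2_in_indicator: "L2_in {0..A::real} (indicator {0..A})"
  by (auto simp: L2_in_def sqint_def indicator_sq)

lemma L2_in_cut_primitive:
  assumes f: "L2_in {0..A} f" and A: "0 \<le> A"
  shows "L2_in {0..A} (\<lambda>x. indicator {0..A} x * primitive f x)"
    and "sq (\<lambda>x. indicator {0..A} x * primitive f x) \<le> A\<^sup>2 * sq f"
proof -
  have [measurable]: "primitive f \<in> borel_measurable borel"
    by (intro borel_measurable_continuous_onI continuous_primitive L2_in_integrable(1)[OF f])
  have b: "(indicator {0..A} x * primitive f x)\<^sup>2 \<le> indicator {0..A} x * (A * sq f)" for x
    using L2_in_primitive_bound[OF f A, of x] by (auto simp: indicator_def)
  have i1: "integrable lborel (\<lambda>x. indicator {0..A} x * (A * sq f))" by simp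
  have i2: "integrable lborel (\<lambda>x. (indicator {0..A} x * primitive f x)\<^sup>2)"
    by (rule Bochner_Integration.integrable_bound[OF i1]) (use b in \<open>auto intro!: AE_I2 simp: abs_le_iff intro: order_trans[OF b]\<close>)
  show "L2_in {0..A} (\<lambda>x. indicator {0..A} x * primitive f x)"
    using i2 by (simp add: L2_in_def sqint_def)
  have "sq (\<lambda>x. indicator {0..A} x * primitive f x) \<le> (LINT x|lborel. indicator {0..A} x * (A * sq f))"
    by (rule integral_mono[OF i2 i1 b])
  also have "\<dots> = A\<^sup>2 * sq f" using A by (simp add: power2_eq_square)
  finally show "sq (\<lambda>x. indicator {0..A} x * primitive f x) \<le> A\<^sup>2 * sq f" .
qed

lemma L2_in_strip_AE:
  assumes d: "L2_in (rect A B) d"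
  shows "AE t in lborel. sqint lborel (\<lambda>\<xi>. d (\<xi>, t))"
proof -
  have [measurable]: "d \<in> borel_measurable (borel \<Otimes>\<^sub>M borel)" using d by (simp add: L2_in_def sqint_def borel_prod)
  have "AE t in lborel. integrable lborel (\<lambda>\<xi>. (d (\<xi>, t))\<^sup>2)"
    using strip_integrable_AE[of "\<lambda>q. (d q)\<^sup>2"] d by (simp add: L2_in_def sqint_def)
  then show ?thesis by eventually_elim (simp add: sqint_def)
qed

lemma strip_sq_bound:
  assumes d: "L2_in (rect A B) d" and A: "0 \<le> A"
  shows "AE t in lborel. \<forall>x. (strip d x t)\<^sup>2 \<le> A * (LINT \<xi>|lborel. (d (\<xi>, t))\<^sup>2)"
  using L2_in_strip_AE[OF d]
  by eventually_elim (use d A in \<open>auto intro!: primitive_sq_bound simp: L2_in_def\<close>)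

lemma sq_strip_integral:
  assumes d: "L2_in (rect A B) d"
  shows "integrable lborel (\<lambda>t. LINT \<xi>|lborel. (d (\<xi>, t))\<^sup>2)" "(LINT t|lborel. LINT \<xi>|lborel. (d (\<xi>, t))\<^sup>2) = sq d"
  using lborel_pair.integrable_snd[of "\<lambda>\<xi> t. (d (\<xi>, t))\<^sup>2"] lborel_pair.integral_snd[of "\<lambda>\<xi> t. (d (\<xi>, t))\<^sup>2"] d
  by (simp_all add: L2_in_def sqint_def lborel_prod case_prod_unfold)

lemma L2_in_strip:
  assumes d: "L2_in (rect A B) d" and A: "0 \<le> A"
  shows "L2_in {0..B} (strip d x)" "sq (strip d x) \<le> A * sq d"
proof -
  note i = sq_strip_integral[OF d]
  have m[measurable]: "strip d x \<in> borel_measurable borel"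
    using integrable_strip[OF L2_in_integrable(2)[OF d]] by auto
  have i2: "integrable lborel (\<lambda>t. (strip d x t)\<^sup>2)"
    by (rule Bochner_Integration.integrable_bound[OF integrable_mult_right[OF i(1), of A]])
       (use strip_sq_bound[OF d A] in \<open>auto elim!: eventually_mono intro: order_trans[OF _ abs_ge_self]\<close>)
  have z: "strip d x t = 0" if "t \<notin> {0..B}" for t
    using d that by (auto simp: primitive_def set_lebesgue_integral_def L2_in_def)
  show "L2_in {0..B} (strip d x)" using i2 z by (simp add: L2_in_def sqint_def)
  have "sq (strip d x) \<le> (LINT t|lborel. A * (LINT \<xi>|lborel. (d (\<xi>, t))\<^sup>2))"
    by (rule integral_mono_AE[OF i2 integrable_mult_right[OF i(1)]])
       (use strip_sq_bound[OF d A] in \<open>auto elim!: eventually_mono\<close>)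
  then show "sq (strip d x) \<le> A * sq d" using i(2) by simp
qed

lemma primitive2_sq_bound:
  assumes d: "L2_in (rect A B) d" and A: "0 \<le> A" "0 \<le> B"
  shows "(primitive2 d x t)\<^sup>2 \<le> A * B * sq d"
proof -
  have "(primitive2 d x t)\<^sup>2 \<le> B * sq (strip d x)"
    unfolding primitive2_eq[OF L2_in_integrable(2)[OF d]]
    by (rule L2_in_primitive_bound[OF L2_in_strip(1)[OF d A(1)] A(2)])
  also have "\<dots> \<le> B * (A * sq d)" by (intro mult_left_mono L2_in_strip(2)[OF d A(1)] A)
  finally show ?thesis by (simp add: mult_ac)
qed

definition cut_strip :: "real \<Rightarrow> real \<Rightarrow> (real \<times> real \<Rightarrow> real) \<Rightarrow> real \<times> real \<Rightarrow> real" where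
  "cut_strip A B d q = indicator (rect A B) q * strip d (fst q) (snd q)"

lemma L2_in_tensor:
  assumes "L2_in {0..A} f" "L2_in {0..B} g"
  shows "L2_in (rect A B) (\<lambda>q. f (fst q) * g (snd q))" "sq (\<lambda>q. f (fst q) * g (snd q)) = sq f * sq g"
proof -
  have [measurable]: "f \<in> borel_measurable borel" "g \<in> borel_measurable borel" using assms by (auto simp: L2_in_def sqint_def)
  have "(\<lambda>q. f (fst q) * g (snd q)) \<in> borel_measurable (borel \<Otimes>\<^sub>M borel)" by measurable
  then have m: "(\<lambda>q. f (fst q) * g (snd q)) \<in> borel_measurable borel" by (simp add: borel_prod)
  have i: "integrable lborel (\<lambda>x. (f x)\<^sup>2)" "integrable lborel (\<lambda>x. (g x)\<^sup>2)" using assms by (auto simp: L2_in_def sqint_def)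
  show "L2_in (rect A B) (\<lambda>q. f (fst q) * g (snd q))"
    using m integrable_tensor(1)[OF i] assms by (auto simp: L2_in_def sqint_def power_mult_distrib)
  show "sq (\<lambda>q. f (fst q) * g (snd q)) = sq f * sq g"
    using integrable_tensor(2)[OF i] by (simp add: power_mult_distrib)
qed

lemma L2_in_cut_strip:
  assumes d: "L2_in (rect A B) d" and A: "0 \<le> A"
  shows "L2_in (rect A B) (cut_strip A B d)" "sq (cut_strip A B d) \<le> A\<^sup>2 * sq d"
proof -
  let ?n = "\<lambda>t. LINT \<xi>|lborel. (d (\<xi>, t))\<^sup>2"
  note i = sq_strip_integral[OF d]
  have dm: "d \<in> borel_measurable borel" using d by (simp add: L2_in_def sqint_def)
  have [measurable]: "rect A B \<in> sets borel" by (simp add: borel_Times)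
  note measurable_strip[OF dm, measurable]
  have m[measurable]: "cut_strip A B d \<in> borel_measurable borel" unfolding cut_strip_def[abs_def] by measurable
  have "AE q::real\<times>real in lborel. (\<forall>x. (strip d x (snd q))\<^sup>2 \<le> A * ?n (snd q))"
    by (rule AE_lborel_snd[OF strip_sq_bound[OF d A]])
  then have b: "AE q in lborel. (cut_strip A B d q)\<^sup>2 \<le> indicator {0..A} (fst q) * (A * ?n (snd q))"
  proof eventually_elim
    case (elim q)
    show ?case
    proof (cases "q \<in> rect A B")
      case True
      then show ?thesis using elim[rule_format, of "fst q"] by (auto simp: cut_strip_def indicator_def mem_Times_iff)
    next
      case False
      then show ?thesis using A by (simp add: cut_strip_def integral_nonneg_AE)
    qed
  qed
  have i1: "integrable lborel (\<lambda>q. indicator {0..A} (fst q) * (A * ?n (snd q)))"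
    by (rule integrable_tensor) (use i in auto)
  have i2: "integrable lborel (\<lambda>q. (cut_strip A B d q)\<^sup>2)"
    by (rule Bochner_Integration.integrable_bound[OF i1])
       (use b in \<open>auto elim!: eventually_mono intro: order_trans[OF _ abs_ge_self]\<close>)
  show "L2_in (rect A B) (cut_strip A B d)"
    using i2 m by (auto simp: L2_in_def sqint_def cut_strip_def)
  have "sq (cut_strip A B d) \<le> (LINT q|lborel. indicator {0..A} (fst q) * (A * ?n (snd q)))"
    by (rule integral_mono_AE[OF i2 i1 b])
  also have "\<dots> = A * (A * sq d)"
    by (subst integrable_tensor(2)) (use i A in auto)
  finally show "sq (cut_strip A B d) \<le> A\<^sup>2 * sq d" by (simp add: power2_eq_square mult_ac)
qed


text \<open>General side lengths make the two variables interchangeable, so that every statement about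
  integration in \<open>x\<close> yields one about integration in \<open>t\<close>.\<close>

definition mixed_L2 :: "real \<Rightarrow> real \<Rightarrow> (real \<Rightarrow> real \<Rightarrow> real) \<Rightarrow> real \<Rightarrow> (real \<Rightarrow> real) \<Rightarrow> (real \<Rightarrow> real) \<Rightarrow> (real \<times> real \<Rightarrow> real) \<Rightarrow> bool" where
  "mixed_L2 A B w a b c d \<longleftrightarrow> L2_in {0..A} b \<and> L2_in {0..B} c \<and> L2_in (rect A B) d \<and>
     (\<forall>x\<in>{0..A}. \<forall>t\<in>{0..B}. w x t = mixed_integral a b c d x t)"

definition sq_size :: "real \<Rightarrow> (real \<Rightarrow> real) \<Rightarrow> (real \<Rightarrow> real) \<Rightarrow> (real \<times> real \<Rightarrow> real) \<Rightarrow> real" where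
  "sq_size a b c d = a\<^sup>2 + sq b + sq c + sq d"

text \<open>Hiding the data and keeping only a bound on their size lets estimates compose along
  \<^term>\<open>L T\<close>, which is built from iterated primitives.\<close>

definition mixed_L2_le :: "real \<Rightarrow> real \<Rightarrow> (real \<Rightarrow> real \<Rightarrow> real) \<Rightarrow> real \<Rightarrow> bool" where
  "mixed_L2_le A B w N \<longleftrightarrow> (\<exists>a b c d. mixed_L2 A B w a b c d \<and> sq_size a b c d \<le> N)"

lemma mixed_L2_integrable:
  assumes "mixed_L2 A B w a b c d"
  shows "integrable lborel b" "integrable lborel c" "integrable lborel d"
  using assms by (auto simp: mixed_L2_def intro: L2_in_integrable)

lemma mixed_L2_continuous:
  assumes "mixed_L2 A B w a b c d"
  shows "continuous_on (rect A B) (\<lambda>q. w (fst q) (snd q))"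
proof -
  note i = mixed_L2_integrable[OF assms]
  have "continuous_on (rect A B) (\<lambda>q. mixed_integral a b c d (fst q) (snd q))"
    unfolding mixed_integral_def
    by (intro continuous_intros continuous_on_compose2[OF continuous_primitive[OF i(1)]]
        continuous_on_compose2[OF continuous_primitive[OF i(2)]]
        continuous_on_subset[OF continuous_primitive2[OF i(3)]]) auto
  then show ?thesis using assms by (subst continuous_on_cong[OF refl]) (auto simp: mixed_L2_def)
qed

lemma four_squares: "(p + q + r + s)\<^sup>2 \<le> 4 * (p\<^sup>2 + q\<^sup>2 + r\<^sup>2 + s\<^sup>2)" for p q r s :: real
proof -
  have "4 * (p\<^sup>2 + q\<^sup>2 + r\<^sup>2 + s\<^sup>2) - (p + q + r + s)\<^sup>2
      = (p-q)\<^sup>2 + (p-r)\<^sup>2 + (p-s)\<^sup>2 + (q-r)\<^sup>2 + (q-s)\<^sup>2 + (r-s)\<^sup>2"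
    by (simp add: power2_eq_square algebra_simps)
  moreover have "0 \<le> (p-q)\<^sup>2 + (p-r)\<^sup>2 + (p-s)\<^sup>2 + (q-r)\<^sup>2 + (q-s)\<^sup>2 + (r-s)\<^sup>2" by simp
  ultimately show ?thesis by linarith
qed

lemma mixed_L2_bound:
  assumes w: "mixed_L2 A B w a b c d" and AB: "0 \<le> A" "0 \<le> B" and xt: "x \<in> {0..A}" "t \<in> {0..B}"
  shows "(w x t)\<^sup>2 \<le> 4 * (1 + A + B + A * B) * sq_size a b c d"
proof -
  have b: "(primitive b x)\<^sup>2 \<le> A * sq b" "(primitive c t)\<^sup>2 \<le> B * sq c" "(primitive2 d x t)\<^sup>2 \<le> A * B * sq d"
    using w AB by (auto simp: mixed_L2_def intro: L2_in_primitive_bound primitive2_sq_bound)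
  let ?C = "1 + A + B + A * B"
  have C: "1 \<le> ?C" "A \<le> ?C" "B \<le> ?C" "A * B \<le> ?C" using AB by auto
  have "a\<^sup>2 \<le> ?C * a\<^sup>2" "A * sq b \<le> ?C * sq b" "B * sq c \<le> ?C * sq c" "A * B * sq d \<le> ?C * sq d"
    using mult_right_mono[OF C(1), of "a\<^sup>2"] mult_right_mono[OF C(2) sq_nonneg[of b]]
      mult_right_mono[OF C(3) sq_nonneg[of c]] mult_right_mono[OF C(4) sq_nonneg[of d]] by simp_all
  then have "a\<^sup>2 + (primitive b x)\<^sup>2 + (primitive c t)\<^sup>2 + (primitive2 d x t)\<^sup>2 \<le> ?C * sq_size a b c d"
    using b unfolding sq_size_def distrib_left by linarith
  then have "4 * (a\<^sup>2 + (primitive b x)\<^sup>2 + (primitive c t)\<^sup>2 + (primitive2 d x t)\<^sup>2) \<le> 4 * (?C * sq_size a b c d)"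
    by (rule mult_left_mono) simp
  with four_squares have "(a + primitive b x + primitive c t + primitive2 d x t)\<^sup>2 \<le> 4 * (?C * sq_size a b c d)"
    by (rule order_trans)
  moreover have "w x t = a + primitive b x + primitive c t + primitive2 d x t"
    using w xt by (simp add: mixed_L2_def mixed_integral_def)
  ultimately show ?thesis by (simp only: mult.assoc)
qed

lemma primitive_lin:
  assumes "integrable lborel f" "integrable lborel g"
  shows "primitive (\<lambda>x. f x + k * g x) x = primitive f x + k * primitive g x"
proof -
  have "integrable lborel (\<lambda>x. - k * g x)" using assms(2) by simp
  from primitive_minus[OF assms(1) this] show ?thesis
    by (simp add: primitive_def set_lebesgue_integral_def mult.left_commute)
qed

lemma primitive2_lin:
  assumes "integrable lborel f" "integrable lborel g"
  shows "primitive2 (\<lambda>x. f x + k * g x) x t = primitive2 f x t + k * primitive2 g x t"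
proof -
  have "integrable lborel (\<lambda>x. - k * g x)" using assms(2) by simp
  from primitive2_minus[OF assms(1) this] show ?thesis
    by (simp add: primitive2_def set_lebesgue_integral_def mult.left_commute)
qed

lemma mixed_L2_lin:
  assumes 1: "mixed_L2 A B w a b c d" and 2: "mixed_L2 A B w' a' b' c' d'"
  shows "mixed_L2 A B (\<lambda>x t. w x t + k * w' x t) (a + k * a') (\<lambda>x. b x + k * b' x) (\<lambda>x. c x + k * c' x) (\<lambda>x. d x + k * d' x)"
  using 1 2 mixed_L2_integrable[OF 1] mixed_L2_integrable[OF 2]
  by (auto simp: mixed_L2_def mixed_integral_def primitive_lin primitive2_lin algebra_simps intro: L2_in_lin)

lemma mixed_L2_le_lin:
  assumes "mixed_L2_le A B w N" "mixed_L2_le A B w' N'"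
  shows "mixed_L2_le A B (\<lambda>x t. w x t + k * w' x t) (2 * N + 2 * k\<^sup>2 * N')"
proof -
  obtain a b c d where 1: "mixed_L2 A B w a b c d" "sq_size a b c d \<le> N" using assms by (auto simp: mixed_L2_le_def)
  obtain a' b' c' d' where 2: "mixed_L2 A B w' a' b' c' d'" "sq_size a' b' c' d' \<le> N'" using assms by (auto simp: mixed_L2_le_def)
  have "sq (\<lambda>x. b x + k * b' x) \<le> 2 * sq b + 2 * k\<^sup>2 * sq b'"
    "sq (\<lambda>x. c x + k * c' x) \<le> 2 * sq c + 2 * k\<^sup>2 * sq c'"
    "sq (\<lambda>x. d x + k * d' x) \<le> 2 * sq d + 2 * k\<^sup>2 * sq d'"
    using 1 2 by (auto simp: mixed_L2_def intro: sq_add)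
  moreover have "(a + k * a')\<^sup>2 \<le> 2 * a\<^sup>2 + 2 * k\<^sup>2 * a'\<^sup>2"
    using sum_squares_bound[of a "k * a'"] by (simp add: power2_sum power_mult_distrib mult.commute)
  ultimately have "sq_size (a + k * a') (\<lambda>x. b x + k * b' x) (\<lambda>x. c x + k * c' x) (\<lambda>x. d x + k * d' x)
      \<le> 2 * sq_size a b c d + 2 * k\<^sup>2 * sq_size a' b' c' d'"
    unfolding sq_size_def by (simp add: algebra_simps)
  also have "\<dots> \<le> 2 * N + 2 * k\<^sup>2 * N'" using 1 2 by (intro add_mono mult_left_mono) auto
  finally show ?thesis using mixed_L2_lin[OF 1(1) 2(1), of k] unfolding mixed_L2_le_def by blast
qed

lemma L2_in_swap:
  assumes d: "L2_in (rect A B) d"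
  shows "L2_in (rect B A) (d \<circ> prod.swap)" "sq (d \<circ> prod.swap) = sq d"
proof -
  have i: "integrable lborel (\<lambda>q. (d q)\<^sup>2)" using d by (simp add: L2_in_def sqint_def)
  have "integrable lborel (\<lambda>q. ((d \<circ> prod.swap) q)\<^sup>2)" using integrable_swap[OF i] by (simp add: comp_def)
  moreover have "d \<circ> prod.swap \<in> borel_measurable borel" using integrable_swap[OF L2_in_integrable(2)[OF d]] by auto
  ultimately show "L2_in (rect B A) (d \<circ> prod.swap)" using d by (auto simp: L2_in_def sqint_def)
  show "sq (d \<circ> prod.swap) = sq d" using integral_swap[OF i] by (simp add: comp_def)
qed

lemma primitive2_swap:
  assumes d: "integrable lborel d" shows "primitive2 (d \<circ> prod.swap) t x = primitive2 d x t"
proof -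
  have i: "integrable lborel (\<lambda>q. indicator ({..x} \<times> {..t}) q * d q)"
    using set_integrable_borel[OF d, of "{..x} \<times> {..t}"] by (simp add: set_integrable_def borel_Times)
  show ?thesis
    using integral_swap[OF i] by (simp add: primitive2_def set_lebesgue_integral_def comp_def indicator_times mult_ac)
qed

lemma mixed_L2_flip:
  assumes "mixed_L2 A B w a b c d" shows "mixed_L2 B A (\<lambda>t x. w x t) a c b (d \<circ> prod.swap)"
proof -
  note i = mixed_L2_integrable[OF assms]
  have "mixed_integral a c b (d \<circ> prod.swap) t x = mixed_integral a b c d x t" for x t
    by (simp only: mixed_integral_def primitive2_swap[OF i(3)])
  then show ?thesis using assms L2_in_swap(1)[of A B d] by (auto simp: mixed_L2_def)
qed

lemma mixed_L2_le_flip: "mixed_L2_le A B w N \<Longrightarrow> mixed_L2_le B A (\<lambda>t x. w x t) N"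
proof -
  assume "mixed_L2_le A B w N"
  then obtain a b c d where 1: "mixed_L2 A B w a b c d" "sq_size a b c d \<le> N" by (auto simp: mixed_L2_le_def)
  have "sq_size a c b (d \<circ> prod.swap) = sq_size a b c d"
    using 1 L2_in_swap(2)[of A B d] unfolding sq_size_def by (simp add: mixed_L2_def)
  then show ?thesis using mixed_L2_flip[OF 1(1)] 1(2) unfolding mixed_L2_le_def by metis
qed

definition int_x :: "(real \<Rightarrow> real \<Rightarrow> real) \<Rightarrow> real \<Rightarrow> real \<Rightarrow> real" where
  "int_x w x t = integral {0..x} (\<lambda>\<xi>. w \<xi> t)"

definition int_t :: "(real \<Rightarrow> real \<Rightarrow> real) \<Rightarrow> real \<Rightarrow> real \<Rightarrow> real" where
  "int_t w x t = integral {0..t} (\<lambda>\<tau>. w x \<tau>)"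

lemma integral_Icc_primitive:
  assumes f: "continuous_on UNIV f" and x: "x \<in> {0..A::real}"
  shows "integral {0..x} f = primitive (\<lambda>\<xi>. indicator {0..A} \<xi> * f \<xi>) x"
proof -
  have "integral {0..x} f = (LINT \<xi>:{0..x}|lborel. f \<xi>)"
    by (rule set_borel_integral_eq_integral(2)[symmetric])
       (intro borel_integrable_atLeastAtMost' continuous_on_subset[OF f] subset_UNIV)
  also have "\<dots> = primitive (\<lambda>\<xi>. indicator {0..A} \<xi> * f \<xi>) x"
    unfolding primitive_def set_lebesgue_integral_def
    by (rule Bochner_Integration.integral_cong) (use x in \<open>auto simp: indicator_def\<close>)
  finally show ?thesis .
qed

lemma sq_size_expand:
  "(2 * A\<^sup>2 + 2 * A) * sq_size a b c d = 2 * (A\<^sup>2 * a\<^sup>2) + 2 * (A\<^sup>2 * sq b) + 2 * (A\<^sup>2 * sq c) + 2 * (A\<^sup>2 * sq d)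
     + 2 * (A * a\<^sup>2) + 2 * (A * sq b) + 2 * (A * sq c) + 2 * (A * sq d)"
  unfolding sq_size_def by (simp add: algebra_simps)

text \<open>Integrating \<open>a + \<integral>b + \<integral>c + \<integral>\<integral>d\<close> in \<open>x\<close>: the first two terms depend on \<open>x\<close> only and become the new
  \<open>b\<close>; the other two are \<open>\<integral>\<close> in \<open>t\<close> of \<open>c t + strip d x t\<close>, which by Fubini becomes the new \<open>d\<close>.\<close>

lemma mixed_L2_int_x:
  assumes w: "mixed_L2 A B w a b c d" and A: "0 \<le> A"
  defines "b' \<equiv> \<lambda>x. indicator {0..A} x * primitive b x + a * indicator {0..A} x"
    and "d' \<equiv> \<lambda>q. cut_strip A B d q + 1 * (indicator {0..A} (fst q) * c (snd q))"
  shows "mixed_L2 A B (int_x w) 0 b' (\<lambda>_. 0) d'"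
    and "sq_size 0 b' (\<lambda>_. 0) d' \<le> (2 * A\<^sup>2 + 2 * A) * sq_size a b c d"
proof -
  note i = mixed_L2_integrable[OF w]
  have l: "L2_in {0..A} b" "L2_in {0..B} c" "L2_in (rect A B) d" using w by (auto simp: mixed_L2_def)
  note L1 = L2_in_cut_primitive[OF l(1) A] and L2 = L2_in_cut_strip[OF l(3) A]
    and L3 = L2_in_tensor[OF L2_in_indicator[of A] l(2)]
  have lb: "L2_in {0..A} b'" unfolding b'_def by (rule L2_in_lin[OF L1(1) L2_in_indicator])
  have ld: "L2_in (rect A B) d'" unfolding d'_def by (rule L2_in_lin[OF L2(1) L3(1)])
  have id: "integrable lborel d'" using L2_in_integrable(2)[OF ld] .
  show "sq_size 0 b' (\<lambda>_. 0) d' \<le> (2 * A\<^sup>2 + 2 * A) * sq_size a b c d"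
  proof -
    have "sq b' \<le> 2 * (A\<^sup>2 * sq b) + 2 * (A * a\<^sup>2)"
      using sq_add[OF L1(1) L2_in_indicator, of a] L1(2) sq_indicator[OF A] unfolding b'_def by (simp add: mult_ac)
    moreover have "sq d' \<le> 2 * (A\<^sup>2 * sq d) + 2 * (A * sq c)"
      using sq_add[OF L2(1) L3(1), of 1] L2(2) L3(2) sq_indicator[OF A] unfolding d'_def by simp
    moreover have "0 \<le> A\<^sup>2 * a\<^sup>2" "0 \<le> A * sq b" "0 \<le> A\<^sup>2 * sq c" "0 \<le> A * sq d"
      using A sq_nonneg by (auto intro!: mult_nonneg_nonneg)
    moreover have "sq_size 0 b' (\<lambda>_. 0) d' = sq b' + sq d'" by (simp add: sq_size_def)
    ultimately show ?thesis unfolding sq_size_expand by linarith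
  qed
  have "int_x w x t = mixed_integral 0 b' (\<lambda>_. 0) d' x t" if x: "x \<in> {0..A}" and t: "t \<in> {0..B}" for x t
  proof -
    define \<phi> where "\<phi> \<xi> = a + primitive b \<xi> + primitive c t + primitive2 d \<xi> t" for \<xi>
    have c\<phi>: "continuous_on UNIV \<phi>"
    proof -
      have "continuous_on UNIV (\<lambda>\<xi>. primitive2 d (fst (\<xi>, t)) (snd (\<xi>, t)))"
        by (rule continuous_on_compose2[OF continuous_primitive2[OF i(3)]]) (auto intro!: continuous_intros)
      then show ?thesis unfolding \<phi>_def using continuous_primitive[OF i(1)] by (intro continuous_intros) auto
    qed
    have "int_x w x t = integral {0..x} \<phi>"
      unfolding int_x_def by (rule integral_cong) (use w x t in \<open>auto simp: mixed_L2_def mixed_integral_def \<phi>_def\<close>)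
    also have "\<dots> = primitive (\<lambda>\<xi>. indicator {0..A} \<xi> * \<phi> \<xi>) x" by (rule integral_Icc_primitive[OF c\<phi> x])
    also have "(\<lambda>\<xi>. indicator {0..A} \<xi> * \<phi> \<xi>) = (\<lambda>\<xi>. b' \<xi> + 1 * primitive (\<lambda>\<eta>. d' (\<xi>, \<eta>)) t)"
    proof
      fix \<xi>
      show "indicator {0..A} \<xi> * \<phi> \<xi> = b' \<xi> + 1 * primitive (\<lambda>\<eta>. d' (\<xi>, \<eta>)) t"
      proof (cases "\<xi> \<in> {0..A}")
        case True
        have "strip d \<xi> \<eta> = 0" if "\<eta> \<notin> {0..B}" for \<eta>
          using L2_in_strip(1)[OF l(3) A] that by (auto simp: L2_in_def)
        then have "(\<lambda>\<eta>. d' (\<xi>, \<eta>)) = (\<lambda>\<eta>. strip d \<xi> \<eta> + 1 * c \<eta>)"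
          using True by (auto simp: d'_def cut_strip_def fun_eq_iff indicator_def)
        then have "primitive (\<lambda>\<eta>. d' (\<xi>, \<eta>)) t = primitive2 d \<xi> t + primitive c t"
          using primitive_lin[OF integrable_strip[OF i(3), of \<xi>] i(2), of 1 t] by (simp add: primitive2_eq[OF i(3)])
        then show ?thesis using True by (simp add: b'_def \<phi>_def)
      next
        case False
        then have "(\<lambda>\<eta>. d' (\<xi>, \<eta>)) = (\<lambda>\<eta>. 0)" by (auto simp: d'_def cut_strip_def fun_eq_iff)
        then show ?thesis using False by (simp add: b'_def primitive_def set_lebesgue_integral_def)
      qed
    qed
    also have "primitive (\<lambda>\<xi>. b' \<xi> + 1 * primitive (\<lambda>\<eta>. d' (\<xi>, \<eta>)) t) x
        = primitive b' x + 1 * primitive (\<lambda>\<xi>. primitive (\<lambda>\<eta>. d' (\<xi>, \<eta>)) t) x"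
    proof (rule primitive_lin)
      show "integrable lborel b'" using L2_in_integrable(1)[OF lb] .
      show "integrable lborel (\<lambda>\<xi>. primitive (\<lambda>\<eta>. d' (\<xi>, \<eta>)) t)"
        using integrable_strip[OF integrable_swap[OF id], of t] by simp
    qed
    finally show ?thesis
      by (simp add: mixed_integral_def primitive2_eq_fst[OF id] primitive_def[of "\<lambda>_. 0"] set_lebesgue_integral_def)
  qed
  then show "mixed_L2 A B (int_x w) 0 b' (\<lambda>_. 0) d'" using lb ld by (auto simp: mixed_L2_def L2_in_def sqint_def)
qed

lemma mixed_L2_le_int_x: "mixed_L2_le A B w N \<Longrightarrow> 0 \<le> A \<Longrightarrow> mixed_L2_le A B (int_x w) ((2 * A\<^sup>2 + 2 * A) * N)"
proof -
  assume "mixed_L2_le A B w N" and A: "0 \<le> A"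
  then obtain a b c d where 1: "mixed_L2 A B w a b c d" "sq_size a b c d \<le> N" by (auto simp: mixed_L2_le_def)
  have "(2 * A\<^sup>2 + 2 * A) * sq_size a b c d \<le> (2 * A\<^sup>2 + 2 * A) * N" using A 1 by (intro mult_left_mono) auto
  then show ?thesis using mixed_L2_int_x[OF 1(1) A] unfolding mixed_L2_le_def by (meson order_trans)
qed

lemma mixed_L2_le_int_t: "mixed_L2_le A B w N \<Longrightarrow> 0 \<le> B \<Longrightarrow> mixed_L2_le A B (int_t w) ((2 * B\<^sup>2 + 2 * B) * N)"
  using mixed_L2_le_flip[OF mixed_L2_le_int_x[OF mixed_L2_le_flip]] by (simp add: int_x_def[abs_def] int_t_def[abs_def])

text \<open>On the edge \<open>x = A\<close> the part \<open>a + \<integral>b\<close> is constant, and Fubini turns the double integral into a primitive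
  in \<open>t\<close>.\<close>

lemma mixed_L2_edge:
  assumes w: "mixed_L2 A B w a b c d" and A: "0 \<le> A"
  defines "e \<equiv> \<lambda>t. c t + 1 * strip d A t"
  shows "L2_in {0..B} e" "t \<in> {0..B} \<Longrightarrow> w A t = (a + primitive b A) + primitive e t"
    and "sq e \<le> 2 * sq c + 2 * A * sq d"
proof -
  note i = mixed_L2_integrable[OF w]
  have l: "L2_in {0..A} b" "L2_in {0..B} c" "L2_in (rect A B) d" using w by (auto simp: mixed_L2_def)
  note L = L2_in_strip[OF l(3) A, of A]
  show "L2_in {0..B} e" unfolding e_def by (rule L2_in_lin[OF l(2) L(1)])
  show "sq e \<le> 2 * sq c + 2 * A * sq d"
    using sq_add[OF l(2) L(1), of 1] L(2) unfolding e_def by simp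
  show "w A t = (a + primitive b A) + primitive e t" if "t \<in> {0..B}"
    unfolding e_def primitive_lin[OF i(2) integrable_strip[OF i(3)]]
    using w that A by (simp add: mixed_L2_def mixed_integral_def primitive2_eq[OF i(3)])
qed

text \<open>The linear interpolation between \<open>0\<close> on \<open>x = 0\<close> and that trace, which corrects the boundary value in
  \<open>bvp\<close> below.\<close>

lemma mixed_L2_le_edge:
  assumes "mixed_L2_le A B w N" and A: "0 \<le> A"
  shows "mixed_L2_le A B (\<lambda>x t. x * w A t) ((2 * A\<^sup>2 + 2 * A) * N)"
proof -
  obtain a b c d where 1: "mixed_L2 A B w a b c d" "sq_size a b c d \<le> N" using assms by (auto simp: mixed_L2_le_def)
  have lb: "L2_in {0..A} b" using 1 by (auto simp: mixed_L2_def)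
  obtain e where e: "L2_in {0..B} e" "\<And>t. t \<in> {0..B} \<Longrightarrow> w A t = (a + primitive b A) + primitive e t"
    "sq e \<le> 2 * sq c + 2 * A * sq d"
    using mixed_L2_edge[OF 1(1) A] by blast
  define k where "k = a + primitive b A"
  define b' where "b' = (\<lambda>x. 0 + k * indicator {0..A} x :: real)"
  define d' where "d' = (\<lambda>q. indicator {0..A} (fst q) * e (snd q) :: real)"
  have z: "L2_in {0..A} (\<lambda>x. 0)" "L2_in {0..B} (\<lambda>x. 0)" by (auto simp: L2_in_def sqint_def)
  have lb': "L2_in {0..A} b'" unfolding b'_def by (rule L2_in_lin[OF z(1) L2_in_indicator])
  have ld': "L2_in (rect A B) d'" unfolding d'_def by (rule L2_in_tensor[OF L2_in_indicator e(1)])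
  have pi: "primitive (indicator {0..A}) x = x" if "x \<in> {0..A}" for x
  proof -
    have "primitive (indicator {0..A}) x = primitive (\<lambda>\<xi>. indicator {0..A} \<xi> * 1) x" by simp
    also have "\<dots> = integral {0..x} (\<lambda>_. 1)" by (rule integral_Icc_primitive[symmetric, OF _ that]) (rule continuous_on_const)
    finally show ?thesis using that by simp
  qed
  have "mixed_L2 A B (\<lambda>x t. x * w A t) 0 b' (\<lambda>_. 0) d'"
    unfolding mixed_L2_def
  proof (intro conjI ballI lb' ld' z)
    fix x t assume x: "x \<in> {0..A}" and t: "t \<in> {0..B}"
    have "primitive b' x = primitive (\<lambda>_. 0) x + k * primitive (indicator {0..A}) x"
      unfolding b'_def by (rule primitive_lin) auto
    moreover have "primitive2 d' x t = primitive (indicator {0..A}) x * primitive e t"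
      unfolding d'_def by (rule primitive2_tensor) (auto intro: L2_in_integrable(1)[OF e(1)])
    ultimately show "x * w A t = mixed_integral 0 b' (\<lambda>_. 0) d' x t"
      using pi[OF x] e(2)[OF t] by (simp add: mixed_integral_def k_def primitive_def[of "\<lambda>_. 0"] set_lebesgue_integral_def algebra_simps)
  qed
  moreover have "sq_size 0 b' (\<lambda>_. 0) d' \<le> (2 * A\<^sup>2 + 2 * A) * N"
  proof -
    have "k\<^sup>2 \<le> 2 * a\<^sup>2 + 2 * (A * sq b)"
      using sum_squares_bound[of a "primitive b A"] L2_in_primitive_bound[OF lb A, of A] by (simp add: k_def power2_sum)
    then have "k\<^sup>2 * A \<le> (2 * a\<^sup>2 + 2 * (A * sq b)) * A" by (rule mult_right_mono[OF _ A])
    then have "k\<^sup>2 * A \<le> 2 * (A * a\<^sup>2) + 2 * (A\<^sup>2 * sq b)" by (simp add: algebra_simps power2_eq_square)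
    moreover have "sq b' = k\<^sup>2 * A" using sq_indicator[OF A] by (simp add: b'_def power_mult_distrib)
    moreover have "sq d' = A * sq e"
      unfolding d'_def using L2_in_tensor(2)[OF L2_in_indicator[of A] e(1)] sq_indicator[OF A] by simp
    moreover
    have "A * sq e \<le> A * (2 * sq c + 2 * A * sq d)" by (rule mult_left_mono[OF e(3) A])
    then have "A * sq e \<le> 2 * (A * sq c) + 2 * (A\<^sup>2 * sq d)" by (simp add: algebra_simps power2_eq_square)
    moreover have "0 \<le> A\<^sup>2 * a\<^sup>2" "0 \<le> A * sq b" "0 \<le> A\<^sup>2 * sq c" "0 \<le> A * sq d"
      using A sq_nonneg by (auto intro!: mult_nonneg_nonneg)
    moreover have "sq_size 0 b' (\<lambda>_. 0) d' = sq b' + sq d'" by (simp add: sq_size_def)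
    ultimately have "sq_size 0 b' (\<lambda>_. 0) d' \<le> (2 * A\<^sup>2 + 2 * A) * sq_size a b c d"
      unfolding sq_size_expand by linarith
    also have "\<dots> \<le> (2 * A\<^sup>2 + 2 * A) * N" using A 1 by (intro mult_left_mono) auto
    finally show ?thesis .
  qed
  ultimately show ?thesis unfolding mixed_L2_le_def by blast
qed

section \<open>Recovering a function from its fourth mixed derivative\<close>

definition cont_rect :: "real \<Rightarrow> real \<Rightarrow> (real \<Rightarrow> real \<Rightarrow> real) \<Rightarrow> bool" where
  "cont_rect A B w \<longleftrightarrow> continuous_on (rect A B) (\<lambda>q. w (fst q) (snd q))"

lemma cont_rect_flip: "cont_rect A B w \<Longrightarrow> cont_rect B A (\<lambda>t x. w x t)"
  unfolding cont_rect_def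
  by (rule continuous_on_compose2[where f="prod.swap" and t="rect A B" and g="\<lambda>q. w (fst q) (snd q)", simplified])
     (auto intro!: continuous_intros simp: prod.swap_def)

lemma cont_rect_compose:
  assumes "cont_rect A B w" "continuous_on S f" "continuous_on S g" "\<And>s. s \<in> S \<Longrightarrow> f s \<in> {0..A}" "\<And>s. s \<in> S \<Longrightarrow> g s \<in> {0..B}"
  shows "continuous_on S (\<lambda>s. w (f s) (g s))"
proof -
  have "continuous_on S (\<lambda>s. (\<lambda>q. w (fst q) (snd q)) (f s, g s))"
    by (rule continuous_on_compose2[OF assms(1)[unfolded cont_rect_def]]) (use assms in \<open>auto intro!: continuous_intros\<close>)
  then show ?thesis by simp
qed

lemma cont_rect_X: "cont_rect A B w \<Longrightarrow> t \<in> {0..B} \<Longrightarrow> continuous_on {0..A} (\<lambda>x. w x t)"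
  by (rule cont_rect_compose) (auto intro: continuous_intros)

lemma cont_rect_T: "cont_rect A B w \<Longrightarrow> x \<in> {0..A} \<Longrightarrow> continuous_on {0..B} (\<lambda>t. w x t)"
  by (rule cont_rect_compose) (auto intro: continuous_intros)

lemma int_x_deriv:
  assumes "cont_rect A B w" "x \<in> {0..A}" "t \<in> {0..B}"
  shows "((\<lambda>x. int_x w x t) has_vector_derivative w x t) (at x within {0..A})"
  unfolding int_x_def by (rule integral_has_vector_derivative[OF cont_rect_X[OF assms(1,3)] assms(2)])

lemma int_t_deriv:
  assumes "cont_rect A B w" "x \<in> {0..A}" "t \<in> {0..B}"
  shows "((\<lambda>t. int_t w x t) has_vector_derivative w x t) (at t within {0..B})"
  unfolding int_t_def by (rule integral_has_vector_derivative[OF cont_rect_T[OF assms(1,2)] assms(3)])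

lemma int_x_0 [simp]: "int_x w 0 t = 0" by (simp add: int_x_def)
lemma int_t_0 [simp]: "int_t w x 0 = 0" by (simp add: int_t_def)

lemma integral_of_derivative_Icc:
  fixes f :: "real \<Rightarrow> real"
  assumes "\<And>x. x \<in> {0..A} \<Longrightarrow> (f has_vector_derivative g x) (at x within {0..A})" "x \<in> {0..A}"
  shows "f x = f 0 + integral {0..x} g"
proof -
  have "(g has_integral f x - f 0) {0..x}"
  proof (rule fundamental_theorem_of_calculus)
    show "(f has_vector_derivative g y) (at y within {0..x})" if "y \<in> {0..x}" for y
      by (rule has_vector_derivative_within_subset[OF assms(1)]) (use that assms(2) in auto)
  qed (use assms(2) in auto)
  then show ?thesis by (simp add: integral_unique)
qed

text \<open>After the substitution \<open>\<xi> = x s\<close> the domain of integration no longer depends on \<open>x\<close>.\<close>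

lemma cont_rect_int_x:
  assumes w: "cont_rect A B w" shows "cont_rect A B (int_x w)"
proof -
  have eq: "int_x w x t = integral (cbox 0 1) (\<lambda>s. x * w (x * s) t)" if x: "x \<in> {0..A}" and t: "t \<in> {0..B}" for x t
  proof -
    have sub: "(\<lambda>s. x * s) ` {0..1} \<subseteq> {0..A}"
      using x mult_mono[of x A _ 1] by (fastforce simp: mult_left_le)
    have "((\<lambda>s. int_x w (x * s) t) has_vector_derivative x * w (x * s) t) (at s within {0..1})" if s: "s \<in> {0..1}" for s
    proof -
      have 1: "((\<lambda>s. x * s) has_vector_derivative x) (at s within {0..1})"
        by (auto intro!: derivative_eq_intros simp: has_vector_derivative_def)
      have 2: "((\<lambda>y. int_x w y t) has_vector_derivative w (x * s) t) (at (x * s) within (\<lambda>s. x * s) ` {0..1})"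
        by (rule has_vector_derivative_within_subset[OF int_x_deriv[OF w _ t] sub]) (use sub s in blast)
      show ?thesis using vector_diff_chain_within[OF 1 2] by (simp add: comp_def)
    qed
    from integral_of_derivative_Icc[OF this, of 1] show ?thesis by simp
  qed
  have "continuous_on (rect A B) (\<lambda>q. integral (cbox 0 1) (\<lambda>s. fst q * w (fst q * s) (snd q)))"
  proof (rule integral_continuous_on_param)
    show "continuous_on (rect A B \<times> cbox 0 1) (\<lambda>(q, s). fst q * w (fst q * s) (snd q))"
      unfolding case_prod_unfold
    proof (intro continuous_on_mult cont_rect_compose[OF w] continuous_intros)
      fix p :: "(real \<times> real) \<times> real" assume p: "p \<in> rect A B \<times> cbox 0 1"
      then have "fst (fst p) * snd p \<le> fst (fst p) * 1" by (intro mult_left_mono) auto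
      then show "fst (fst p) * snd p \<in> {0..A}" using p by auto
      show "snd (fst p) \<in> {0..B}" using p by auto
    qed
  qed
  then show ?thesis unfolding cont_rect_def
    by (subst continuous_on_cong[OF refl, of _ _ "\<lambda>q. integral (cbox 0 1) (\<lambda>s. fst q * w (fst q * s) (snd q))"]) (auto simp: eq)
qed

lemma cont_rect_int_t: "cont_rect A B w \<Longrightarrow> cont_rect A B (int_t w)"
  using cont_rect_flip[OF cont_rect_int_x[OF cont_rect_flip]] by (simp add: int_x_def[abs_def] int_t_def[abs_def])

lemma int_x_int_t_swap:
  assumes w: "cont_rect A B w" and x: "x \<in> {0..A}" and t: "t \<in> {0..B}"
  shows "int_t (int_x w) x t = int_x (int_t w) x t"
proof -
  have "continuous_on (cbox (0,0) (x,t)) (\<lambda>(\<xi>,\<tau>). w \<xi> \<tau>)"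
    unfolding case_prod_unfold by (rule cont_rect_compose[OF w]) (use x t in \<open>auto intro!: continuous_intros simp: cbox_Pair_eq mem_Times_iff\<close>)
  from integral_swap_continuous[OF this] show ?thesis by (simp add: int_x_def int_t_def)
qed

text \<open>For continuous \<open>w\<close> and each \<open>t\<close>, the solution of \<open>f'' = w\<close> with \<open>f 0 = f 1 = 0\<close>.\<close>

definition bvp :: "(real \<Rightarrow> real \<Rightarrow> real) \<Rightarrow> real \<Rightarrow> real \<Rightarrow> real" where
  "bvp w x t = int_x (int_x w) x t - x * int_x (int_x w) 1 t"

text \<open>The \<open>x\<close>-derivative of \<^term>\<open>bvp w\<close> at \<open>x = 0\<close>.\<close>

definition slope :: "(real \<Rightarrow> real \<Rightarrow> real) \<Rightarrow> real \<Rightarrow> real" where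
  "slope w t = - int_x (int_x w) 1 t"

text \<open>For continuous \<open>w\<close>, the function with \<open>\<partial>\<^sup>4u/\<partial>x\<^sup>2\<partial>t\<^sup>2 = w\<close> and the initial and boundary
  values required in \<^const>\<open>W\<close>.\<close>

definition d4_inverse :: "(real \<Rightarrow> real \<Rightarrow> real) \<Rightarrow> real \<Rightarrow> real \<Rightarrow> real" where
  "d4_inverse w = int_t (int_t (bvp w))"

definition eq_Omega :: "real \<Rightarrow> (real \<Rightarrow> real \<Rightarrow> real) \<Rightarrow> (real \<Rightarrow> real \<Rightarrow> real) \<Rightarrow> bool" where
  "eq_Omega T u v \<longleftrightarrow> (\<forall>x\<in>{0..1}. \<forall>t\<in>{0..T}. u x t = v x t)"

lemma eq_Omega_refl[simp]: "eq_Omega T u u" by (simp add: eq_Omega_def)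
lemma eq_Omega_trans: "eq_Omega T u v \<Longrightarrow> eq_Omega T v w \<Longrightarrow> eq_Omega T u w" by (simp add: eq_Omega_def)
lemma eq_OmegaD: "eq_Omega T u v \<Longrightarrow> x \<in> {0..1} \<Longrightarrow> t \<in> {0..T} \<Longrightarrow> u x t = v x t" by (simp add: eq_Omega_def)

lemma eq_Omega_int_x: "eq_Omega T u v \<Longrightarrow> eq_Omega T (int_x u) (int_x v)"
  unfolding eq_Omega_def int_x_def by (auto intro!: integral_cong)

lemma eq_Omega_int_t: "eq_Omega T u v \<Longrightarrow> eq_Omega T (int_t u) (int_t v)"
  unfolding eq_Omega_def int_t_def by (auto intro!: integral_cong)

lemma cont_rect_cong: "eq_Omega T u v \<Longrightarrow> cont_rect 1 T u \<longleftrightarrow> cont_rect 1 T v"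
  unfolding cont_rect_def by (rule continuous_on_cong) (auto simp: eq_Omega_def)

lemma cont_rect_edge: "cont_rect 1 T f \<Longrightarrow> cont_rect 1 T (\<lambda>x t. f 1 t)"
  unfolding cont_rect_def[of 1 T "\<lambda>x t. f 1 t"] by (rule cont_rect_compose) (auto intro!: continuous_intros)

lemma cont_rect_bvp: assumes "cont_rect 1 T w" shows "cont_rect 1 T (bvp w)"
proof -
  have "cont_rect 1 T (int_x (int_x w))" using assms by (intro cont_rect_int_x)
  from this cont_rect_edge[OF this] show ?thesis unfolding bvp_def cont_rect_def by (intro continuous_intros)
qed

lemma int_t_bvp:
  assumes w: "cont_rect 1 T w" shows "eq_Omega T (int_t (bvp w)) (bvp (int_t w))"
proof -
  have c: "cont_rect 1 T (int_x (int_x w))" using w by (intro cont_rect_int_x)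
  have sw: "int_t (int_x (int_x w)) x t = int_x (int_x (int_t w)) x t" if "x \<in> {0..1}" "t \<in> {0..T}" for x t
  proof -
    have "int_t (int_x (int_x w)) x t = int_x (int_t (int_x w)) x t" by (rule int_x_int_t_swap[OF cont_rect_int_x[OF w] that])
    also have "\<dots> = int_x (int_x (int_t w)) x t"
      by (rule eq_OmegaD[OF eq_Omega_int_x that]) (auto simp: eq_Omega_def int_x_int_t_swap[OF w])
    finally show ?thesis .
  qed
  show ?thesis unfolding eq_Omega_def
  proof (intro ballI)
    fix x t assume x: "x \<in> {0..1::real}" and t: "t \<in> {0..T}"
    have i: "(\<lambda>\<tau>. int_x (int_x w) y \<tau>) integrable_on {0..t}" if "y \<in> {0..1}" for y
      by (rule integrable_continuous_interval[OF continuous_on_subset[OF cont_rect_T[OF c that]]]) (use t in auto)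
    have "int_t (bvp w) x t = integral {0..t} (\<lambda>\<tau>. int_x (int_x w) x \<tau> - x * int_x (int_x w) 1 \<tau>)"
      by (simp add: int_t_def bvp_def)
    also have "\<dots> = integral {0..t} (\<lambda>\<tau>. int_x (int_x w) x \<tau>) - integral {0..t} (\<lambda>\<tau>. x * int_x (int_x w) 1 \<tau>)"
      by (rule Henstock_Kurzweil_Integration.integral_diff[OF i[OF x] integrable_on_mult_right[OF i]]) simp
    also have "\<dots> = int_t (int_x (int_x w)) x t - x * int_t (int_x (int_x w)) 1 t" by (simp add: int_t_def)
    also have "\<dots> = bvp (int_t w) x t" using sw[OF x t] sw[of 1 t] t by (simp add: bvp_def)
    finally show "int_t (bvp w) x t = bvp (int_t w) x t" .
  qed
qed

text \<open>Interchanging the integrations gives access to the \<open>x\<close>-derivatives of \<^term>\<open>d4_inverse w\<close>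
  before its \<open>t\<close>-derivatives.\<close>

lemma d4_inverse_eq_bvp:
  assumes w: "cont_rect 1 T w" shows "eq_Omega T (d4_inverse w) (bvp (int_t (int_t w)))"
  unfolding d4_inverse_def
  using eq_Omega_trans[OF eq_Omega_int_t[OF int_t_bvp[OF w]] int_t_bvp[OF cont_rect_int_t[OF w]]] .

lemma slope_int_t:
  assumes w: "cont_rect 1 T w" and t: "t \<in> {0..T}" shows "slope (int_t w) t = integral {0..t} (slope w)"
proof -
  have "int_t (int_x (int_x w)) 1 t = int_x (int_t (int_x w)) 1 t" by (rule int_x_int_t_swap[OF cont_rect_int_x[OF w]]) (use t in auto)
  also have "\<dots> = int_x (int_x (int_t w)) 1 t"
    by (rule eq_OmegaD[OF eq_Omega_int_x]) (use t in \<open>auto simp: eq_Omega_def int_x_int_t_swap[OF w]\<close>)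
  finally show ?thesis by (simp add: slope_def[abs_def] int_t_def)
qed

lemma slope_continuous: "cont_rect 1 T w \<Longrightarrow> continuous_on {0..T} (slope w)"
  unfolding slope_def using cont_rect_T[OF cont_rect_int_x[OF cont_rect_int_x], of 1 T w 1] by (intro continuous_intros) auto

lemma slope_int_t_deriv:
  assumes "cont_rect 1 T w" "t \<in> {0..T}"
  shows "(slope (int_t w) has_vector_derivative slope w t) (at t within {0..T})"
  using integral_has_vector_derivative[OF slope_continuous[OF assms(1)] assms(2)]
    has_vector_derivative_cong_Icc[OF assms(2), of "slope (int_t w)" "\<lambda>t. integral {0..t} (slope w)"] slope_int_t[OF assms(1)]
  by simp

lemma bvp_deriv:
  assumes "cont_rect 1 T w" "x \<in> {0..1}" "t \<in> {0..T}"
  shows "((\<lambda>x. bvp w x t) has_vector_derivative int_x w x t + slope w t) (at x within {0..1})"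
proof -
  have "((\<lambda>x. x * k) has_vector_derivative k) (at x within {0..1})" for k :: real
    by (auto intro!: derivative_eq_intros simp: has_vector_derivative_def)
  from has_vector_derivative_diff[OF int_x_deriv[OF cont_rect_int_x[OF assms(1)] assms(2,3)] this]
  show ?thesis unfolding bvp_def slope_def by simp
qed

lemma bvp_deriv2:
  assumes "cont_rect 1 T w" "x \<in> {0..1}" "t \<in> {0..T}"
  shows "((\<lambda>x. int_x w x t + slope w t) has_vector_derivative w x t) (at x within {0..1})"
  using has_vector_derivative_add[OF int_x_deriv[OF assms] has_vector_derivative_const] by simp

lemma dX_eqI:
  assumes "eq_Omega T u v" "\<And>x t. x \<in> {0..1} \<Longrightarrow> t \<in> {0..T} \<Longrightarrow> ((\<lambda>x. v x t) has_vector_derivative v' x t) (at x within {0..1})"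
  shows "diffX T u" "eq_Omega T (dX u) v'"
proof -
  have d: "((\<lambda>x. u x t) has_vector_derivative v' x t) (at x within {0..1})" if "x \<in> {0..1}" "t \<in> {0..T}" for x t
    using has_vector_derivative_cong_Icc[OF that(1), of "\<lambda>x. u x t" "\<lambda>x. v x t"] assms that by (simp add: eq_Omega_def)
  show "diffX T u" unfolding diffX_def using d differentiableI_vector by blast
  show "eq_Omega T (dX u) v'" unfolding eq_Omega_def dX_def using d by (auto intro!: vector_derivative_Icc)
qed

lemma dT_eqI:
  assumes "eq_Omega T u v" "0 < T" "\<And>x t. x \<in> {0..1} \<Longrightarrow> t \<in> {0..T} \<Longrightarrow> ((\<lambda>t. v x t) has_vector_derivative v' x t) (at t within {0..T})"
  shows "diffT T u" "eq_Omega T (dT T u) v'"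
proof -
  have d: "((\<lambda>t. u x t) has_vector_derivative v' x t) (at t within {0..T})" if "x \<in> {0..1}" "t \<in> {0..T}" for x t
    using has_vector_derivative_cong_Icc[OF that(2), of "\<lambda>t. u x t" "\<lambda>t. v x t"] assms that by (simp add: eq_Omega_def)
  show "diffT T u" unfolding diffT_def using d differentiableI_vector by blast
  show "eq_Omega T (dT T u) v'" unfolding eq_Omega_def dT_def using d assms(2) by (auto intro!: vector_derivative_Icc)
qed

context
  fixes T :: real and w u :: "real \<Rightarrow> real \<Rightarrow> real"
  assumes T: "0 < T" and w: "cont_rect 1 T w" and u: "eq_Omega T u (d4_inverse w)"
begin

lemma d4_inverse_dT: "diffT T u" "eq_Omega T (dT T u) (int_t (bvp w))"
  using dT_eqI[OF u T, of "int_t (bvp w)"] int_t_deriv[OF cont_rect_int_t[OF cont_rect_bvp[OF w]]] by (auto simp: d4_inverse_def)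

lemma d4_inverse_dT2: "diffT T (dT T u)" "eq_Omega T (dT T (dT T u)) (bvp w)"
  using dT_eqI[OF d4_inverse_dT(2) T, of "bvp w"] int_t_deriv[OF cont_rect_bvp[OF w]] by auto

lemma d4_inverse_dXT: "diffX T (dT T (dT T u))" "eq_Omega T (dX (dT T (dT T u))) (\<lambda>x t. int_x w x t + slope w t)"
  using dX_eqI[OF d4_inverse_dT2(2), of "\<lambda>x t. int_x w x t + slope w t"] bvp_deriv[OF w] by auto

lemma d4_inverse_d4: "diffX T (dX (dT T (dT T u)))" "eq_Omega T (dX (dX (dT T (dT T u)))) w"
  using dX_eqI[OF d4_inverse_dXT(2), of w] bvp_deriv2[OF w] by auto

lemma d4_inverse_dX: "diffX T u" "eq_Omega T (dX u) (\<lambda>x t. int_x (int_t (int_t w)) x t + slope (int_t (int_t w)) t)"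
  by (rule dX_eqI[OF eq_Omega_trans[OF u d4_inverse_eq_bvp[OF w]] bvp_deriv[OF cont_rect_int_t[OF cont_rect_int_t[OF w]]]]; assumption)+

lemma d4_inverse_dX2: "diffX T (dX u)" "eq_Omega T (dX (dX u)) (int_t (int_t w))"
  using dX_eqI[OF d4_inverse_dX(2)] bvp_deriv2[OF cont_rect_int_t[OF cont_rect_int_t[OF w]]] by auto

lemma d4_inverse_boundary: "x \<in> {0..1} \<Longrightarrow> u x 0 = 0" "t \<in> {0..T} \<Longrightarrow> u 0 t = 0" "t \<in> {0..T} \<Longrightarrow> u 1 t = 0"
  "x \<in> {0..1} \<Longrightarrow> dT T u x 0 = 0"
  using eq_OmegaD[OF u, of x 0] eq_OmegaD[OF eq_Omega_trans[OF u d4_inverse_eq_bvp[OF w]], of 0 t]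
    eq_OmegaD[OF eq_Omega_trans[OF u d4_inverse_eq_bvp[OF w]], of 1 t] eq_OmegaD[OF d4_inverse_dT(2), of x 0] T
  by (auto simp: d4_inverse_def bvp_def)

end

lemma mixed_integral_continuous:
  assumes "integrable lborel b" "integrable lborel c" "integrable lborel d"
  shows "cont_rect A B (mixed_integral a b c d)"
  unfolding cont_rect_def mixed_integral_def
  by (intro continuous_intros continuous_on_compose2[OF continuous_primitive[OF assms(1)]]
        continuous_on_compose2[OF continuous_primitive[OF assms(2)]]
        continuous_on_subset[OF continuous_primitive2[OF assms(3)]]) auto

lemma has_vector_derivative_diffX: "diffX T v \<Longrightarrow> x \<in> {0..1} \<Longrightarrow> t \<in> {0..T} \<Longrightarrow>
   ((\<lambda>x. v x t) has_vector_derivative dX v x t) (at x within {0..1})"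
  unfolding diffX_def dX_def by (metis vector_derivative_works)

lemma has_vector_derivative_diffT: "diffT T v \<Longrightarrow> x \<in> {0..1} \<Longrightarrow> t \<in> {0..T} \<Longrightarrow>
   ((\<lambda>t. v x t) has_vector_derivative dT T v x t) (at t within {0..T})"
  unfolding diffT_def dT_def by (metis vector_derivative_works)

lemma dT_zero: "0 < T \<Longrightarrow> (\<And>t. t \<in> {0..T} \<Longrightarrow> v x t = 0) \<Longrightarrow> t \<in> {0..T} \<Longrightarrow> dT T v x t = 0"
proof -
  assume T: "0 < T" and z: "\<And>t. t \<in> {0..T} \<Longrightarrow> v x t = 0" and t: "t \<in> {0..T}"
  have "(v x has_vector_derivative 0) (at t within {0..T})"
    using has_vector_derivative_cong_Icc[OF t, of "v x" "\<lambda>_. 0"] z by simp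
  then show ?thesis unfolding dT_def using vector_derivative_Icc[OF T t] by auto
qed

text \<open>The fundamental theorem of calculus, twice in \<open>x\<close> with the boundary values of \<open>u\<^sub>t\<^sub>t\<close> and twice in \<open>t\<close>
  with the initial values of \<open>u\<close>.\<close>

lemma W_eq_d4_inverse:
  assumes T: "0 < T" and u: "u \<in> W T"
  shows "eq_Omega T u (d4_inverse (d4 T u))" "cont_rect 1 T (d4 T u)"
proof -
  define w where "w = d4 T u"
  have f2: "(f ^^ 2) y = f (f y)" for f :: "'z \<Rightarrow> 'z" and y by (simp add: numeral_2_eq_2)
  note dd = u[unfolded W_def mem_Collect_eq f2]
  have d: "diffT T u" "diffT T (dT T u)" "diffX T (dT T (dT T u))" "diffX T (dX (dT T (dT T u)))"
      "completely_continuous T (d4 T u)"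
    using dd by auto
  have bc: "u x 0 = 0" "dT T u x 0 = 0" if "x \<in> {0..1}" for x using dd that by blast+
  have bt: "u 0 t = 0" "u 1 t = 0" if "t \<in> {0..T}" for t using dd that by blast+
  obtain a b c e where r: "mixed_L1 T w a b c e" using d(5) by (auto simp: completely_continuous_iff w_def)
  show wc: "cont_rect 1 T (d4 T u)"
  proof -
    have "cont_rect 1 T (mixed_integral a b c e)" using r by (intro mixed_integral_continuous) (auto simp: mixed_L1_def L1_in_def)
    moreover have "eq_Omega T (mixed_integral a b c e) w" using r by (auto simp: mixed_L1_def eq_Omega_def)
    ultimately show ?thesis using cont_rect_cong by (auto simp: w_def)
  qed
  have w2: "dX (dX (dT T (dT T u))) = w" by (simp add: w_def d4_def f2)
  have z0: "dT T (dT T u) 0 t = 0" "dT T (dT T u) 1 t = 0" if "t \<in> {0..T}" for t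
    using bt dT_zero[OF T, of "dT T u"] dT_zero[OF T, of u] that by auto
  have A: "eq_Omega T (dT T (dT T u)) (bvp w)"
    unfolding eq_Omega_def
  proof (intro ballI)
    fix x t assume x: "x \<in> {0..1::real}" and t: "t \<in> {0..T}"
    let ?f = "\<lambda>x. dT T (dT T u) x t" and ?f' = "\<lambda>x. dX (dT T (dT T u)) x t"
    have 1: "?f' y = ?f' 0 + int_x w y t" if "y \<in> {0..1}" for y
      unfolding int_x_def using integral_of_derivative_Icc[of 1 ?f' "\<lambda>y. w y t" y] that
        has_vector_derivative_diffX[OF d(4) _ t] by (simp add: w2)
    have 2: "?f y = y * ?f' 0 + int_x (int_x w) y t" if y: "y \<in> {0..1}" for y
    proof -
      have "?f y = ?f 0 + integral {0..y} ?f'"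
        by (rule integral_of_derivative_Icc[of 1 ?f ?f']) (use has_vector_derivative_diffX[OF d(3) _ t] y in auto)
      also have "integral {0..y} ?f' = integral {0..y} (\<lambda>y. ?f' 0 + int_x w y t)"
      proof (rule integral_cong)
        fix z assume "z \<in> {0..y}"
        then have "z \<in> {0..1}" using y by auto
        then show "?f' z = ?f' 0 + int_x w z t" by (rule 1)
      qed
      also have "\<dots> = integral {0..y} (\<lambda>y. ?f' 0) + integral {0..y} (\<lambda>y. int_x w y t)"
      proof (rule Henstock_Kurzweil_Integration.integral_add)
        show "(\<lambda>y. int_x w y t) integrable_on {0..y}"
          by (rule integrable_continuous_interval, rule continuous_on_subset[OF cont_rect_X[OF cont_rect_int_x _], of 1 T])
             (use wc y t in \<open>auto simp: w_def\<close>)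
      qed auto
      finally show ?thesis using z0 t y by (simp add: int_x_def)
    qed
    have "?f' 0 = - int_x (int_x w) 1 t" using 2[of 1] z0[OF t] by simp
    then show "?f x = bvp w x t" using 2[OF x] by (simp add: bvp_def)
  qed
  have B: "eq_Omega T (dT T u) (int_t (bvp w))"
    unfolding eq_Omega_def
  proof (intro ballI)
    fix x t assume x: "x \<in> {0..1::real}" and t: "t \<in> {0..T}"
    have "dT T u x t = dT T u x 0 + integral {0..t} (\<lambda>t. dT T (dT T u) x t)"
      by (rule integral_of_derivative_Icc[OF _ t]) (use has_vector_derivative_diffT[OF d(2) x] in auto)
    also have "integral {0..t} (\<lambda>t. dT T (dT T u) x t) = int_t (bvp w) x t"
      unfolding int_t_def by (rule integral_cong) (use A x t in \<open>auto simp: eq_Omega_def\<close>)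
    finally show "dT T u x t = int_t (bvp w) x t" using bc x by simp
  qed
  show "eq_Omega T u (d4_inverse (d4 T u))"
    unfolding eq_Omega_def w_def[symmetric] d4_inverse_def
  proof (intro ballI)
    fix x t assume x: "x \<in> {0..1::real}" and t: "t \<in> {0..T}"
    have "u x t = u x 0 + integral {0..t} (\<lambda>t. dT T u x t)"
      by (rule integral_of_derivative_Icc[OF _ t]) (use has_vector_derivative_diffT[OF d(1) x] in auto)
    also have "integral {0..t} (\<lambda>t. dT T u x t) = int_t (int_t (bvp w)) x t"
      unfolding int_t_def[of "int_t (bvp w)"] by (rule integral_cong) (use B x t in \<open>auto simp: eq_Omega_def\<close>)
    finally show "u x t = int_t (int_t (bvp w)) x t" using bc x by simp
  qed
qed

section \<open>The space W in terms of square integrable data\<close>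

lemma funpow_2: "(f ^^ 2) y = f (f y)" and funpow_3: "(f ^^ 3) y = f (f (f y))"
  by (simp_all add: numeral_2_eq_2 numeral_3_eq_3)

lemma mixed_L2_cont_rect: "mixed_L2 A B w a b c d \<Longrightarrow> cont_rect A B w"
  using mixed_L2_continuous by (auto simp: cont_rect_def)

lemma mixed_L2_mixed_L1: "mixed_L2 1 T w a b c d \<Longrightarrow> eq_Omega T v w \<Longrightarrow> mixed_L1 T v a b c d"
  using L2_in_Icc_L1_in L2_in_Omega_L1_in by (auto simp: mixed_L2_def mixed_L1_def eq_Omega_def Omega_def)

text \<open>The term \<open>i = 1\<close> of \<^const>\<open>inner_W\<close> contains \<open>\<partial>\<^sup>3/\<partial>t\<^sup>3 \<partial>u/\<partial>x\<close> on \<open>x = 0\<close>, the derivative of the slope. It is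
  determined by the data of \<open>w\<close> and controlled by them.\<close>

lemma slope_data:
  assumes "mixed_L2_le 1 T w N" "0 < T"
  obtains e where "L2_in {0..T} e" "\<And>t. t \<in> {0..T} \<Longrightarrow> slope w t = slope w 0 + primitive e t" "sq e \<le> 32 * N"
proof -
  have "mixed_L2_le 1 T (int_x (int_x w)) (16 * N)" using mixed_L2_le_int_x[OF mixed_L2_le_int_x[OF assms(1)]] by simp
  then obtain a b c d where 1: "mixed_L2 1 T (int_x (int_x w)) a b c d" "sq_size a b c d \<le> 16 * N" by (auto simp: mixed_L2_le_def)
  obtain e where e: "L2_in {0..T} e" "\<And>t. t \<in> {0..T} \<Longrightarrow> int_x (int_x w) 1 t = (a + primitive b 1) + primitive e t"
    "sq e \<le> 2 * sq c + 2 * 1 * sq d"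
    using mixed_L2_edge[OF 1(1)] by auto
  have pe: "primitive e 0 = 0" using primitive_0 L2_in_Icc_L1_in[OF e(1)] by blast
  have z: "L2_in {0..T} (\<lambda>x. 0)" by (auto simp: L2_in_def sqint_def)
  show thesis
  proof (rule that[of "\<lambda>t. 0 + (-1) * e t"])
    show "L2_in {0..T} (\<lambda>t. 0 + (-1) * e t)" by (rule L2_in_lin[OF z e(1)])
    show "slope w t = slope w 0 + primitive (\<lambda>t. 0 + (-1) * e t) t" if "t \<in> {0..T}" for t
      using e(2)[OF that] e(2)[of 0] that pe
      by (simp add: slope_def primitive_def set_lebesgue_integral_def)
    have "sq c + sq d \<le> sq_size a b c d" unfolding sq_size_def by (simp add: sq_nonneg)
    then have "sq e \<le> 2 * sq_size a b c d" using e(3) by simp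
    then show "sq (\<lambda>t. 0 + (-1) * e t) \<le> 32 * N" using 1(2) by simp
  qed
qed

text \<open>Each integration over the unit interval costs a factor \<open>4\<close>, and so does the linear interpolation of the
  trace; the difference of the two terms has size at most \<open>2 \<cdot> 16 + 2 \<cdot> 64\<close>.\<close>

lemma mixed_L2_le_bvp: "mixed_L2_le 1 T w N \<Longrightarrow> mixed_L2_le 1 T (bvp w) (160 * N)"
proof -
  assume "mixed_L2_le 1 T w N"
  then have 1: "mixed_L2_le 1 T (int_x (int_x w)) (16 * N)" using mixed_L2_le_int_x[OF mixed_L2_le_int_x[of 1 T w N]] by simp
  from mixed_L2_le_edge[OF 1] have 2: "mixed_L2_le 1 T (\<lambda>x t. x * int_x (int_x w) 1 t) (64 * N)" by simp
  from mixed_L2_le_lin[OF 1 2, of "-1"] show ?thesis by (simp add: bvp_def[abs_def])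
qed

lemma mixed_L2_le_d4_inverse: "mixed_L2_le 1 T w N \<Longrightarrow> 0 \<le> T \<Longrightarrow> mixed_L2_le 1 T (d4_inverse w) ((2 * T\<^sup>2 + 2 * T)\<^sup>2 * 160 * N)"
  using mixed_L2_le_int_t[OF mixed_L2_le_int_t[OF mixed_L2_le_bvp[of T w N]]]
  unfolding d4_inverse_def power2_eq_square[of "2 * T\<^sup>2 + 2 * T"] by (simp only: mult.assoc)

text \<open>Besides the data of \<open>w\<close> a density \<open>e\<close> of the slope is recorded. It depends on the others, but only
  up to a null set, and recording it keeps linear combinations exact.\<close>

definition W_rep where
  "W_rep T u w a b c d e \<longleftrightarrow> mixed_L2 1 T w a b c d \<and> eq_Omega T u (d4_inverse w) \<and> L2_in {0..T} e \<and>
     (\<forall>t\<in>{0..T}. slope w t = slope w 0 + primitive e t)"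

lemma AE_lebesgue_on:
  assumes "S \<in> sets borel" "AE x in lborel. x \<in> S \<longrightarrow> P x" shows "AE x in lebesgue_on S. P x"
proof -
  have "S \<inter> space lebesgue \<in> sets lebesgue" using assms(1) by (simp add: sets_completionI_sets)
  then show ?thesis using AE_completion[OF assms(2)] by (simp add: AE_restrict_space_iff)
qed

text \<open>The regularity that membership in \<^const>\<open>W\<close> demands on \<open>x = 0\<close> of \<open>g = \<partial>\<^sup>iu/\<partial>x\<^sup>i\<close>, for one \<open>i\<close>, together
  with the value of the third derivative.\<close>

definition third_on_line :: "real \<Rightarrow> (real \<Rightarrow> real \<Rightarrow> real) \<Rightarrow> real \<Rightarrow> (real \<Rightarrow> real) \<Rightarrow> bool" where
  "third_on_line T g x r \<longleftrightarrow>
     (\<forall>t\<in>{0..T}. g x differentiable (at t within {0..T}) \<and> dT T g x differentiable (at t within {0..T})) \<and>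
     (AE t in lebesgue_on {0..T}. dT T (dT T g) x differentiable (at t within {0..T})) \<and>
     (AE t in lborel. t \<in> {0..T} \<longrightarrow> dT T (dT T (dT T g)) x t = r t) \<and>
     L2_on {0..T} (dT T (dT T (dT T g)) x)"

lemma third_derivative_line:
  assumes T: "0 < T" and p: "\<And>t. t \<in> {0..T} \<Longrightarrow> g x t = p t"
    and p1: "\<And>t. t \<in> {0..T} \<Longrightarrow> (p has_vector_derivative p1 t) (at t within {0..T})"
    and p2: "\<And>t. t \<in> {0..T} \<Longrightarrow> (p1 has_vector_derivative p2 t) (at t within {0..T})"
    and p3: "\<And>t. t \<in> {0..T} \<Longrightarrow> p2 t = k + primitive r t" and r: "L2_in {0..T} r"
  shows "third_on_line T g x r"
proof -
  have d1: "(g x has_vector_derivative p1 t) (at t within {0..T})" if "t \<in> {0..T}" for t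
    using has_vector_derivative_cong_Icc[OF that, of "g x" p] p p1 that by simp
  have e1: "dT T g x t = p1 t" if "t \<in> {0..T}" for t
    unfolding dT_def using vector_derivative_Icc[OF T that d1[OF that]] by simp
  have d2: "(dT T g x has_vector_derivative p2 t) (at t within {0..T})" if "t \<in> {0..T}" for t
    using has_vector_derivative_cong_Icc[OF that, of "dT T g x" p1] e1 p2 that by simp
  have e2: "dT T (dT T g) x t = p2 t" if "t \<in> {0..T}" for t
    unfolding dT_def[of T "dT T g"] using vector_derivative_Icc[OF T that d2[OF that]] by simp
  have 1: "\<forall>t\<in>{0..T}. g x differentiable (at t within {0..T}) \<and> dT T g x differentiable (at t within {0..T})"
    using d1 d2 differentiableI_vector by blast
  have ae: "AE t in lborel. t \<in> {0..T} \<longrightarrow> (dT T (dT T g) x has_vector_derivative r t) (at t within {0..T})"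
    by (rule AE_derivative_primitive_Icc[OF T L2_in_integrable(1)[OF r], of _ k]) (use e2 p3 in auto)
  then have "AE t in lborel. t \<in> {0..T} \<longrightarrow> dT T (dT T g) x differentiable (at t within {0..T})"
    by eventually_elim (blast intro: differentiableI_vector)
  then have 2: "AE t in lebesgue_on {0..T}. dT T (dT T g) x differentiable (at t within {0..T})"
    by (rule AE_lebesgue_on[rotated]) simp
  have ae3: "AE t in lborel. t \<in> {0..T} \<longrightarrow> dT T (dT T (dT T g)) x t = r t"
    using ae unfolding dT_def[of T "dT T (dT T g)"] by eventually_elim (use vector_derivative_Icc[OF T] in blast)
  have "L2_on {0..T} (dT T (dT T (dT T g)) x)"
    using L2_on_AE_iff[OF _ _ _ ae3] r by (auto simp: L2_in_def sqint_def)
  with 1 2 ae3 show ?thesis unfolding third_on_line_def by blast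
qed

lemma abs_cont01_C1:
  assumes d: "\<And>x. x \<in> {0..1} \<Longrightarrow> (f has_vector_derivative g x) (at x within {0..1})"
    and c: "continuous_on {0..1} g"
  shows "abs_cont01 f"
  unfolding abs_cont01_def
proof (intro exI conjI ballI)
  show "integrable (lebesgue_on {0..1}) g" by (rule continuous_imp_integrable_real[OF c])
  fix x :: real assume x: "x \<in> {0..1}"
  have "integrable (lebesgue_on {0..x}) g"
    by (rule continuous_imp_integrable_real[OF continuous_on_subset[OF c]]) (use x in auto)
  from lebesgue_integral_eq_integral[OF this]
  show "f x = f 0 + (LINT \<xi>|lebesgue_on {0..x}. g \<xi>)"
    using integral_of_derivative_Icc[OF d x] by simp
qed

lemma abs_cont01_primitive:
  assumes b: "L2_in {0..1} b" and f: "\<And>x. x \<in> {0..1} \<Longrightarrow> f x = a + primitive b x"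
  shows "abs_cont01 f"
  unfolding abs_cont01_def
proof (intro exI conjI ballI)
  note l = L2_in_Icc_L1_in[OF b]
  show "integrable (lebesgue_on {0..1}) b" by (rule L1_in_integrable_lebesgue_on[OF _ l]) simp
  fix x :: real assume x: "x \<in> {0..1}"
  show "f x = f 0 + (LINT \<xi>|lebesgue_on {0..x}. b \<xi>)"
    using f[OF x] f[of 0] primitive_0[OF l] LINT_primitive[OF l _ x, of b] by simp
qed

lemma D01_zero:
  assumes "\<And>x. x \<in> {0..1} \<Longrightarrow> f x = 0" "x \<in> {0..1}"
  shows "(f has_vector_derivative 0) (at x within {0..1})" "D01 f x = 0"
proof -
  show d: "(f has_vector_derivative 0) (at x within {0..1})"
    using has_vector_derivative_cong_Icc[OF assms(2), of f "\<lambda>_. 0"] assms(1) by simp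
  then show "D01 f x = 0" unfolding D01_def using vector_derivative_Icc[OF _ assms(2) d] by simp
qed

lemma zero_W23:
  assumes z: "\<And>x. x \<in> {0..1} \<Longrightarrow> f x = 0"
  shows "f \<in> W23" "inner_W23 f g = 0"
proof -
  have z1: "D01 f x = 0" if "x \<in> {0..1}" for x
    by (rule D01_zero(2)[of f, OF _ that]) (rule z)
  have z2: "D01 (D01 f) x = 0" if "x \<in> {0..1}" for x
    by (rule D01_zero(2)[of "D01 f", OF _ that]) (rule z1)
  have z3: "D01 (D01 (D01 f)) x = 0" if "x \<in> {0..1}" for x
    by (rule D01_zero(2)[of "D01 (D01 f)", OF _ that]) (rule z2)
  have ac: "abs_cont01 h" if "\<And>x. x \<in> {0..1} \<Longrightarrow> h x = 0" for h
    by (rule abs_cont01_C1[OF D01_zero(1)[OF that]]) (auto intro: continuous_on_const)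
  have diff: "h differentiable (at x within {0..1})" if "\<And>x. x \<in> {0..1} \<Longrightarrow> h x = 0" "x \<in> {0..1}" for h :: "real \<Rightarrow> real" and x
    by (rule differentiableI_vector, rule D01_zero(1), rule that(1), assumption, rule that(2))
  have "L2_on {0..1} (D01 (D01 (D01 f)))"
    using L2_on_AE_iff[of "{0..1}" "\<lambda>_. 0" "D01 (D01 (D01 f))"] z3 by (auto simp: L2_in_def sqint_def)
  then show "f \<in> W23"
    using z ac[OF z] ac[OF z1] ac[OF z2] diff[OF z] diff[OF z1] by (simp add: W23_def funpow_2 funpow_3)
  have "(LINT x|lebesgue_on {0..1}. D01 (D01 (D01 f)) x * D01 (D01 (D01 g)) x) = (LINT x|lebesgue_on {0..1::real}. (0::real))"
  proof (rule Bochner_Integration.integral_cong[OF refl])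
    fix x assume "x \<in> space (lebesgue_on {0..1::real})"
    then have "x \<in> {0..1}" by simp
    from z3[OF this] show "D01 (D01 (D01 f)) x * D01 (D01 (D01 g)) x = 0" by simp
  qed
  then show "inner_W23 f g = 0" using z z1 by (simp add: inner_W23_def funpow_3)
qed

lemma D01_dX: "D01 (\<lambda>x. v x t) = (\<lambda>x. dX v x t)"
  by (simp add: fun_eq_iff D01_def dX_def)

lemma third_on_lineD:
  "third_on_line T g x r \<Longrightarrow> AE t in lborel. t \<in> {0..T} \<longrightarrow> dT T (dT T (dT T g)) x t = r t"
  unfolding third_on_line_def by blast

context
  fixes T u w a b c d e
  assumes T: "0 < T" and rep: "W_rep T u w a b c d e"
begin

lemma rep_mixed_L2: "mixed_L2 1 T w a b c d" and rep_u: "eq_Omega T u (d4_inverse w)" and rep_e: "L2_in {0..T} e"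
  and rep_slope: "t \<in> {0..T} \<Longrightarrow> slope w t = slope w 0 + primitive e t"
  using rep unfolding W_rep_def by blast+

lemma rep_cont: "cont_rect 1 T w" by (rule mixed_L2_cont_rect[OF rep_mixed_L2])

lemma rep_L2: "L2_in {0..1} b" "L2_in {0..T} c" "L2_in (Omega T) d"
  using rep_mixed_L2 by (auto simp: mixed_L2_def Omega_def)

lemmas rep_d4_inverse = T rep_cont rep_u

lemma rep_d4: "eq_Omega T (d4 T u) w"
  using d4_inverse_d4(2)[OF rep_d4_inverse] by (simp add: d4_def funpow_2)

lemma rep_d6: "AE q in lborel. q \<in> Omega T \<longrightarrow> (case q of (x, t) \<Rightarrow> d6 T u x t) = d q"
  using mixed_L1_AE_mixed[OF T mixed_L2_mixed_L1[OF rep_mixed_L2 rep_d4]] by (simp add: d6_def)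

lemma rep_line0: "third_on_line T u 0 (\<lambda>_. 0)"
proof -
  have 0: "u 0 t = (\<lambda>_. 0) t" if "t \<in> {0..T}" for t using d4_inverse_boundary(2)[OF rep_d4_inverse that] .
  have d: "((\<lambda>_. 0) has_vector_derivative (\<lambda>_. 0) t) (at t within {0..T})" for t :: real by simp
  have p: "(\<lambda>_. 0) t = 0 + primitive (\<lambda>_. 0) t" for t :: real by (simp add: primitive_def set_lebesgue_integral_def)
  have l: "L2_in {0..T} (\<lambda>_. 0)" by (simp add: L2_in_def sqint_def)
  show ?thesis by (rule third_derivative_line[OF T, of u 0 "\<lambda>_. 0" "\<lambda>_. 0" "\<lambda>_. 0" 0 "\<lambda>_. 0", OF 0 d d p l])
qed

lemma rep_line1: "third_on_line T (dX u) 0 e"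
proof -
  have 0: "dX u 0 t = slope (int_t (int_t w)) t" if "t \<in> {0..T}" for t
    using eq_OmegaD[OF d4_inverse_dX(2)[OF rep_d4_inverse], of 0 t] that by simp
  note d = slope_int_t_deriv[OF cont_rect_int_t[OF rep_cont]] slope_int_t_deriv[OF rep_cont]
  show ?thesis by (rule third_derivative_line[OF T, of "dX u" 0, OF 0 d rep_slope rep_e])
qed

lemma rep_line2: "third_on_line T (dX (dX u)) 0 c"
proof -
  have 0: "dX (dX u) 0 t = int_t (int_t w) 0 t" if "t \<in> {0..T}" for t
    using eq_OmegaD[OF d4_inverse_dX2(2)[OF rep_d4_inverse], of 0 t] that by simp
  have d1: "(int_t (int_t w) 0 has_vector_derivative int_t w 0 t) (at t within {0..T})" if "t \<in> {0..T}" for t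
    by (rule int_t_deriv[OF cont_rect_int_t[OF rep_cont] _ that]) simp
  have d2: "(int_t w 0 has_vector_derivative w 0 t) (at t within {0..T})" if "t \<in> {0..T}" for t
    by (rule int_t_deriv[OF rep_cont _ that]) simp
  have l: "L1_in {0..1} b" "L1_in (Omega T) d" using rep_L2 L2_in_Icc_L1_in L2_in_Omega_L1_in by blast+
  have w0: "w 0 t = a + primitive c t" if "t \<in> {0..T}" for t
    using rep_mixed_L2 that primitive_0[OF l(1)] primitive2_0[OF l(2)] by (simp add: mixed_L2_def mixed_integral_def)
  show ?thesis by (rule third_derivative_line[OF T, of "dX (dX u)" 0, OF 0 d1 d2 w0 rep_L2(2)])
qed

lemma rep_init2:
  shows "(\<lambda>x. dT T (dT T u) x 0) \<in> W23"
    and "dT T (dT T u) 0 0 = 0" "dX (dT T (dT T u)) 0 0 = slope w 0" "dX (dT T (dT T u)) 1 0 = int_x w 1 0 + slope w 0"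
    and "AE x in lborel. x \<in> {0..1} \<longrightarrow> dX (dX (dX (dT T (dT T u)))) x 0 = b x"
proof -
  let ?v = "dT T (dT T u)"
  have t0: "0 \<in> {0..T}" using T by simp
  note d0 = has_vector_derivative_diffX[OF d4_inverse_dXT(1)[OF rep_d4_inverse] _ t0]
  note d1 = has_vector_derivative_diffX[OF d4_inverse_d4(1)[OF rep_d4_inverse] _ t0]
  note v0 = eq_OmegaD[OF d4_inverse_dT2(2)[OF rep_d4_inverse] _ t0]
  note v1 = eq_OmegaD[OF d4_inverse_dXT(2)[OF rep_d4_inverse] _ t0]
  note v2 = eq_OmegaD[OF d4_inverse_d4(2)[OF rep_d4_inverse] _ t0]
  have c1: "continuous_on {0..1} (\<lambda>x. dX ?v x 0)"
    by (subst continuous_on_cong[OF refl v1]) (auto intro!: continuous_intros cont_rect_X[OF cont_rect_int_x[OF rep_cont] t0])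
  have c2: "continuous_on {0..1} (\<lambda>x. dX (dX ?v) x 0)"
    by (subst continuous_on_cong[OF refl v2]) (auto intro!: cont_rect_X[OF rep_cont t0])
  note crep = mixed_L2_mixed_L1[OF rep_mixed_L2 d4_inverse_d4(2)[OF rep_d4_inverse]]
  have w0: "dX (dX ?v) x 0 = a + primitive b x" if "x \<in> {0..1}" for x
    using mixed_L1_at_0[OF crep _ that] T by simp
  show z: "dT T (dT T u) 0 0 = 0" using v0[of 0] by (simp add: bvp_def)
  show "dX (dT T (dT T u)) 0 0 = slope w 0" "dX (dT T (dT T u)) 1 0 = int_x w 1 0 + slope w 0"
    using v1[of 0] v1[of 1] by simp_all
  have ae: "AE x in lborel. x \<in> {0..1} \<longrightarrow> dX (dX (dX ?v)) x 0 = b x"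
    using mixed_L1_AE_dX_0[OF T crep] unfolding dX_def[of "dX (dX ?v)"]
    by eventually_elim (use vector_derivative_Icc[of 1] in auto)
  then show "AE x in lborel. x \<in> {0..1} \<longrightarrow> dX (dX (dX (dT T (dT T u)))) x 0 = b x" .
  have L2: "L2_on {0..1} (\<lambda>x. dX (dX (dX ?v)) x 0)"
    using L2_on_AE_iff[OF _ _ _ ae] rep_L2(1) by (auto simp: L2_in_def sqint_def)
  have ac: "abs_cont01 (\<lambda>x. ?v x 0)" "abs_cont01 (\<lambda>x. dX ?v x 0)" "abs_cont01 (\<lambda>x. dX (dX ?v) x 0)"
    using abs_cont01_C1[OF d0 c1] abs_cont01_C1[OF d1 c2] abs_cont01_primitive[OF rep_L2(1) w0] by auto
  have z1: "dT T (dT T u) 1 0 = 0" using v0[of 1] by (simp add: bvp_def)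
  show "(\<lambda>x. dT T (dT T u) x 0) \<in> W23"
    unfolding W23_def mem_Collect_eq funpow_2 funpow_3 D01_dX
    using d0 d1 ac L2 z z1 differentiableI_vector by blast
qed

lemma rep_in_W: "u \<in> W T"
proof -
  have i: "i \<le> 2 \<longleftrightarrow> i = 0 \<or> i = 1 \<or> i = 2" for i :: nat by auto
  have W0: "(\<lambda>x. u x 0) \<in> W23" "(\<lambda>x. dT T u x 0) \<in> W23"
    using d4_inverse_boundary(1,4)[OF rep_d4_inverse] by (auto intro: zero_W23)
  have L: "L2_on (Omega T) (\<lambda>(x, t). d6 T u x t)"
    using L2_on_AE_iff[OF _ _ _ rep_d6] rep_L2(3) by (auto simp: L2_in_def sqint_def)
  have compl: "completely_continuous T (d4 T u)"
    using mixed_L2_mixed_L1[OF rep_mixed_L2 rep_d4] completely_continuous_iff by blast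
  show ?thesis
    unfolding W_def mem_Collect_eq Let_def funpow_2 funpow_3
  proof (intro conjI)
    show "\<forall>i\<le>2. (\<forall>t\<in>{0..T}. (dX ^^ i) u 0 differentiable at t within {0..T} \<and> dT T ((dX ^^ i) u) 0 differentiable at t within {0..T}) \<and>
       (AE t in lebesgue_on {0..T}. dT T (dT T ((dX ^^ i) u)) 0 differentiable at t within {0..T}) \<and>
       L2_on {0..T} (dT T (dT T (dT T ((dX ^^ i) u))) 0)"
      unfolding i using rep_line0[unfolded third_on_line_def] rep_line1[unfolded third_on_line_def]
        rep_line2[unfolded third_on_line_def]
      by (auto simp: funpow_2)
    show "\<forall>j\<le>2. (\<lambda>x. (dT T ^^ j) u x 0) \<in> W23"
      unfolding i using W0 rep_init2(1) by (auto simp: funpow_2)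
  qed (use d4_inverse_dT(1)[OF rep_d4_inverse] d4_inverse_dT2(1)[OF rep_d4_inverse] d4_inverse_dXT(1)[OF rep_d4_inverse] d4_inverse_d4(1)[OF rep_d4_inverse]
      d4_inverse_dX(1)[OF rep_d4_inverse] d4_inverse_dX2(1)[OF rep_d4_inverse] compl L d4_inverse_boundary[OF rep_d4_inverse] in auto)
qed

end

text \<open>Complete continuity gives integrable data \<open>b\<close>, \<open>c\<close>, \<open>d\<close>; they agree almost everywhere with derivatives
  that \<^const>\<open>W\<close> requires to be square integrable, namely \<open>b\<close> with the third derivative of \<open>u\<^sub>t\<^sub>t\<close> on
  \<open>t = 0\<close>, \<open>c\<close> with the third \<open>t\<close>-derivative of \<open>u\<^sub>x\<^sub>x\<close> on \<open>x = 0\<close>, and \<open>d\<close> with the sixth derivative.\<close>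

lemma W_rep_exists:
  assumes T: "0 < T" and u: "u \<in> W T"
  obtains w a b c d e where "W_rep T u w a b c d e"
proof -
  define w where "w = d4 T u"
  have L: "eq_Omega T u (d4_inverse w)" "cont_rect 1 T w" using W_eq_d4_inverse[OF T u] by (auto simp: w_def)
  note dd = u[unfolded W_def mem_Collect_eq Let_def]
  have compl: "completely_continuous T (d4 T u)" using dd by blast
  obtain a b c d where r: "mixed_L1 T w a b c d" using compl by (auto simp: completely_continuous_iff w_def)
  have l: "L1_in {0..1} b" "L1_in {0..T} c" "L1_in (Omega T) d" using r by (auto simp: mixed_L1_def)
  have "L2_on (Omega T) (\<lambda>(x, t). d6 T u x t)" using dd by blast
  then have d2: "L2_in (Omega T) d"
    using L2_on_AE_iff[OF Omega_borel L1_in_measurable[OF l(3)] _ mixed_L1_AE_mixed[OF T r]] l(3)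
    by (simp add: L1_in_def d6_def w_def)
  have "(\<lambda>x. (dT T ^^ 2) u x 0) \<in> W23" using dd by blast
  then have "L2_on {0..1} (\<lambda>x. dX w x 0)"
    unfolding W23_def mem_Collect_eq funpow_2 funpow_3 D01_dX by (auto simp: w_def d4_def funpow_2)
  moreover have "AE x in lborel. x \<in> {0..1} \<longrightarrow> dX w x 0 = b x"
    using mixed_L1_AE_dX_0[OF T r] unfolding dX_def
    by eventually_elim (use vector_derivative_Icc[of 1] in auto)
  ultimately have b2: "L2_in {0..1} b"
    using L2_on_AE_iff[OF _ L1_in_measurable[OF l(1)]] l(1) by (auto simp: L1_in_def)
  have "L2_on {0..T} ((dT T ^^ 3) ((dX ^^ 2) u) 0)" using dd by blast
  then have L2c: "L2_on {0..T} (dT T (dT T (dT T (dX (dX u)))) 0)" by (simp add: funpow_2 funpow_3)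
  have 1: "eq_Omega T (dX (dX u)) (int_t (int_t w))" by (rule d4_inverse_dX2(2)[OF T L(2,1)])
  have 2: "eq_Omega T (dT T (dX (dX u))) (int_t w)"
    by (rule dT_eqI(2)[OF 1 T]) (rule int_t_deriv[OF cont_rect_int_t[OF L(2)]])
  have 3: "eq_Omega T (dT T (dT T (dX (dX u)))) w"
    by (rule dT_eqI(2)[OF 2 T]) (rule int_t_deriv[OF L(2)])
  have r3: "mixed_L1 T (dT T (dT T (dX (dX u)))) a b c d" using r 3 by (auto simp: mixed_L1_def eq_Omega_def)
  have "AE t in lborel. t \<in> {0..T} \<longrightarrow> dT T (dT T (dT T (dX (dX u)))) 0 t = c t"
    using mixed_L1_AE_dT_0[OF T r3] unfolding dT_def[of T "dT T (dT T (dX (dX u)))"]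
    by eventually_elim (use vector_derivative_Icc[OF T] in auto)
  then have c2: "L2_in {0..T} c"
    using L2_on_AE_iff[OF _ L1_in_measurable[OF l(2)]] l(2) L2c by (auto simp: L1_in_def)
  have w: "mixed_L2 1 T w a b c d" using r b2 c2 d2 by (auto simp: mixed_L2_def mixed_L1_def Omega_def)
  then have "mixed_L2_le 1 T w (sq_size a b c d)" by (auto simp: mixed_L2_le_def)
  from slope_data[OF this T] obtain e where
    "L2_in {0..T} e" "\<And>t. t \<in> {0..T} \<Longrightarrow> slope w t = slope w 0 + primitive e t" by blast
  then have "W_rep T u w a b c d e" using w L(1) unfolding W_rep_def by blast
  then show thesis by (rule that)
qed

text \<open>The terms with \<open>i = 0\<close>, \<open>j = 0\<close> and \<open>j = 1\<close> vanish by the initial and boundary values; each other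
  integrand agrees almost everywhere with a product of data.\<close>

theorem inner_W_rep:
  assumes T: "0 < T" and r: "W_rep T u w a b c d e" and r': "W_rep T u' w' a' b' c' d' e'"
  shows "inner_W T u u' = (LINT t|lborel. e t * e' t) + (LINT t|lborel. c t * c' t)
    + slope w 0 * slope w' 0 + (int_x w 1 0 + slope w 0) * (int_x w' 1 0 + slope w' 0)
    + (LINT x|lborel. b x * b' x) + (LINT q|lborel. d q * d' q)"
proof -
  have m: "L2_in S f \<Longrightarrow> f \<in> borel_measurable borel" for S and f :: "'z::euclidean_space \<Rightarrow> real" by (simp add: L2_in_def sqint_def)
  have z: "L2_in S f \<Longrightarrow> \<forall>x. x \<notin> S \<longrightarrow> f x = 0" for S and f :: "'z::euclidean_space \<Rightarrow> real" by (simp add: L2_in_def)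
  note M = m[OF rep_e[OF T r]] m[OF rep_e[OF T r']] m[OF rep_L2(1)[OF T r]] m[OF rep_L2(1)[OF T r']]
    m[OF rep_L2(2)[OF T r]] m[OF rep_L2(2)[OF T r']] m[OF rep_L2(3)[OF T r]] m[OF rep_L2(3)[OF T r']]
  have 0: "(LINT t|lebesgue_on {0..T}. dT T (dT T (dT T u)) 0 t * dT T (dT T (dT T u')) 0 t) = 0"
    using LINT_mult_lebesgue_on[OF _ _ _ _ third_on_lineD[OF rep_line0[OF T r]] third_on_lineD[OF rep_line0[OF T r']]] by simp
  have 1: "(LINT t|lebesgue_on {0..T}. dT T (dT T (dT T (dX u))) 0 t * dT T (dT T (dT T (dX u'))) 0 t) = (LINT t|lborel. e t * e' t)"
    by (rule LINT_mult_lebesgue_on[OF _ M(1,2) z[OF rep_e[OF T r]] third_on_lineD[OF rep_line1[OF T r]] third_on_lineD[OF rep_line1[OF T r']]]) simp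
  have 2: "(LINT t|lebesgue_on {0..T}. dT T (dT T (dT T (dX (dX u)))) 0 t * dT T (dT T (dT T (dX (dX u')))) 0 t) = (LINT t|lborel. c t * c' t)"
    by (rule LINT_mult_lebesgue_on[OF _ M(5,6) z[OF rep_L2(2)[OF T r]] third_on_lineD[OF rep_line2[OF T r]] third_on_lineD[OF rep_line2[OF T r']]]) simp
  have 3: "(LINT x|lebesgue_on {0..1}. dX (dX (dX (dT T (dT T u)))) x 0 * dX (dX (dX (dT T (dT T u')))) x 0) = (LINT x|lborel. b x * b' x)"
    by (rule LINT_mult_lebesgue_on[OF _ M(3,4) z[OF rep_L2(1)[OF T r]] rep_init2(5)[OF T r] rep_init2(5)[OF T r']]) simp
  have 4: "(LINT (x, t)|lebesgue_on (Omega T). d6 T u x t * d6 T u' x t) = (LINT q|lborel. d q * d' q)"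
    using LINT_mult_lebesgue_on[OF Omega_borel M(7,8) z[OF rep_L2(3)[OF T r]] rep_d6[OF T r] rep_d6[OF T r']]
    by (simp add: case_prod_unfold)
  have z0: "inner_W23 (\<lambda>x. u x 0) g = 0" "inner_W23 (\<lambda>x. dT T u x 0) g = 0" for g
    using d4_inverse_boundary(1,4)[OF rep_d4_inverse[OF T r]] by (auto intro: zero_W23)
  have 5: "inner_W23 (\<lambda>x. dT T (dT T u) x 0) (\<lambda>x. dT T (dT T u') x 0)
     = slope w 0 * slope w' 0 + (int_x w 1 0 + slope w 0) * (int_x w' 1 0 + slope w' 0) + (LINT x|lborel. b x * b' x)"
    unfolding inner_W23_def funpow_3 D01_dX 3 using rep_init2(2,3,4)[OF T r] rep_init2(2,3,4)[OF T r'] by simp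
  have S: "(\<Sum>i\<le>2. f i) = f 0 + f (Suc 0) + f (2::nat)" for f :: "nat \<Rightarrow> real" by (simp add: numeral_2_eq_2)
  show ?thesis
    unfolding inner_W_def S funpow_2 funpow_3 funpow.simps o_apply id_apply
    using 0 1 2 4 5 z0 by simp
qed

section \<open>Completeness of W\<close>

abbreviation comb :: "(real \<Rightarrow> real \<Rightarrow> real) \<Rightarrow> real \<Rightarrow> (real \<Rightarrow> real \<Rightarrow> real) \<Rightarrow> real \<Rightarrow> real \<Rightarrow> real" where
  "comb f k g \<equiv> \<lambda>x t. f x t + k * g x t"

lemma cont_rect_lin: "cont_rect A B f \<Longrightarrow> cont_rect A B g \<Longrightarrow> cont_rect A B (comb f k g)"
  unfolding cont_rect_def by (intro continuous_intros)

lemma int_x_lin: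
  assumes f: "cont_rect 1 T f" and g: "cont_rect 1 T g"
  shows "eq_Omega T (int_x (comb f k g)) (comb (int_x f) k (int_x g))"
  unfolding eq_Omega_def
proof (intro ballI)
  fix x t assume x: "x \<in> {0..1::real}" and t: "t \<in> {0..T}"
  have i: "(\<lambda>y. h y t) integrable_on {0..x}" if "cont_rect 1 T h" for h
    by (rule integrable_continuous_interval[OF continuous_on_subset[OF cont_rect_X[OF that t]]]) (use x in auto)
  show "int_x (comb f k g) x t = comb (int_x f) k (int_x g) x t"
    unfolding int_x_def
    using Henstock_Kurzweil_Integration.integral_add[OF i[OF f] integrable_on_mult_right[OF i[OF g]], of k] by simp
qed

lemma int_t_lin:
  assumes f: "cont_rect 1 T f" and g: "cont_rect 1 T g"
  shows "eq_Omega T (int_t (comb f k g)) (comb (int_t f) k (int_t g))"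
  unfolding eq_Omega_def
proof (intro ballI)
  fix x t assume x: "x \<in> {0..1::real}" and t: "t \<in> {0..T}"
  have i: "(\<lambda>y. h x y) integrable_on {0..t}" if "cont_rect 1 T h" for h
    by (rule integrable_continuous_interval[OF continuous_on_subset[OF cont_rect_T[OF that x]]]) (use t in auto)
  show "int_t (comb f k g) x t = comb (int_t f) k (int_t g) x t"
    unfolding int_t_def
    using Henstock_Kurzweil_Integration.integral_add[OF i[OF f] integrable_on_mult_right[OF i[OF g]], of k] by simp
qed

lemma int_x2_lin:
  assumes f: "cont_rect 1 T f" and g: "cont_rect 1 T g"
  shows "eq_Omega T (int_x (int_x (comb f k g))) (comb (int_x (int_x f)) k (int_x (int_x g)))"
  by (rule eq_Omega_trans[OF eq_Omega_int_x[OF int_x_lin[OF f g]] int_x_lin[OF cont_rect_int_x[OF f] cont_rect_int_x[OF g]]])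

lemma int_t2_lin:
  assumes f: "cont_rect 1 T f" and g: "cont_rect 1 T g"
  shows "eq_Omega T (int_t (int_t (comb f k g))) (comb (int_t (int_t f)) k (int_t (int_t g)))"
  by (rule eq_Omega_trans[OF eq_Omega_int_t[OF int_t_lin[OF f g]] int_t_lin[OF cont_rect_int_t[OF f] cont_rect_int_t[OF g]]])

lemma slope_lin:
  assumes f: "cont_rect 1 T f" and g: "cont_rect 1 T g" and t: "t \<in> {0..T}"
  shows "slope (comb f k g) t = slope f t + k * slope g t"
  using eq_OmegaD[OF int_x2_lin[OF f g], of 1 t k] t by (simp add: slope_def)

lemma bvp_lin:
  assumes f: "cont_rect 1 T f" and g: "cont_rect 1 T g"
  shows "eq_Omega T (bvp (comb f k g)) (comb (bvp f) k (bvp g))"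
  unfolding eq_Omega_def
proof (intro ballI)
  fix x t assume x: "x \<in> {0..1::real}" and t: "t \<in> {0..T}"
  show "bvp (comb f k g) x t = comb (bvp f) k (bvp g) x t"
    using eq_OmegaD[OF int_x2_lin[OF f g] x t, of k] eq_OmegaD[OF int_x2_lin[OF f g] _ t, of 1 k]
    by (simp add: bvp_def algebra_simps)
qed

lemma d4_inverse_lin:
  assumes f: "cont_rect 1 T f" and g: "cont_rect 1 T g"
  shows "eq_Omega T (d4_inverse (comb f k g)) (comb (d4_inverse f) k (d4_inverse g))"
  unfolding d4_inverse_def
  by (rule eq_Omega_trans[OF eq_Omega_int_t[OF eq_Omega_int_t[OF bvp_lin[OF f g]]] int_t2_lin[OF cont_rect_bvp[OF f] cont_rect_bvp[OF g]]])

lemma W_rep_lin: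
  assumes T: "0 < T" and r: "W_rep T u w a b c d e" and r': "W_rep T u' w' a' b' c' d' e'"
  shows "W_rep T (comb u k u') (comb w k w') (a + k * a') (\<lambda>x. b x + k * b' x) (\<lambda>x. c x + k * c' x)
    (\<lambda>x. d x + k * d' x) (\<lambda>x. e x + k * e' x)"
proof -
  note C = rep_cont[OF T r] rep_cont[OF T r']
  have "mixed_L2 1 T (comb w k w') (a + k * a') (\<lambda>x. b x + k * b' x) (\<lambda>x. c x + k * c' x) (\<lambda>x. d x + k * d' x)"
    by (rule mixed_L2_lin[OF rep_mixed_L2[OF T r] rep_mixed_L2[OF T r']])
  moreover have "eq_Omega T (comb u k u') (d4_inverse (comb w k w'))"
    using rep_u[OF T r] rep_u[OF T r'] d4_inverse_lin[OF C, of k] by (simp add: eq_Omega_def)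
  moreover have "slope (comb w k w') t = slope (comb w k w') 0 + primitive (\<lambda>x. e x + k * e' x) t" if "t \<in> {0..T}" for t
    using slope_lin[OF C that] slope_lin[OF C, of 0] T rep_slope[OF T r that] rep_slope[OF T r' that]
      primitive_lin[OF L2_in_integrable(1)[OF rep_e[OF T r]] L2_in_integrable(1)[OF rep_e[OF T r']], of k t]
    by (simp add: algebra_simps)
  moreover have "L2_in {0..T} (\<lambda>x. e x + k * e' x)" by (rule L2_in_lin[OF rep_e[OF T r] rep_e[OF T r']])
  ultimately show ?thesis unfolding W_rep_def by blast
qed

lemma W_rep_zero: "W_rep T (\<lambda>x t. 0) (\<lambda>x t. 0) 0 (\<lambda>_. 0) (\<lambda>_. 0) (\<lambda>_. 0) (\<lambda>_. 0)"
  by (simp add: W_rep_def mixed_L2_def mixed_integral_def L2_in_def sqint_def eq_Omega_def d4_inverse_def bvp_def slope_def int_x_def int_t_def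
      primitive_def primitive2_def set_lebesgue_integral_def)

lemma L2_in_ip_lc:
  assumes "L2_in S f" "L2_in S g" "L2_in S h"
  shows "(LINT x|lborel. (f x + k * g x) * h x) = (LINT x|lborel. f x * h x) + k * (LINT x|lborel. g x * h x)"
  using L2.ip_lc[of f lborel g h k] assms by (simp add: L2_in_def)

lemma W_semi_inner:
  assumes T: "0 < T"
  shows "semi_inner_space (W T) (inner_W T) comb (\<lambda>x t. 0)"
proof
  fix f g k :: "real \<Rightarrow> real \<Rightarrow> real" and \<alpha> :: real
  show "(\<lambda>x t. 0) \<in> W T" by (rule rep_in_W[OF T W_rep_zero])
  assume f: "f \<in> W T"
  obtain w a b c d e where r: "W_rep T f w a b c d e" using W_rep_exists[OF T f] by blast
  show "0 \<le> inner_W T f f"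
    unfolding inner_W_rep[OF T r r] by (intro add_nonneg_nonneg integral_nonneg_AE) auto
  show "inner_W T (\<lambda>x t. 0) f = 0"
    unfolding inner_W_rep[OF T W_rep_zero r] by (simp add: slope_def int_x_def)
  assume g: "g \<in> W T"
  obtain w' a' b' c' d' e' where r': "W_rep T g w' a' b' c' d' e'" using W_rep_exists[OF T g] by blast
  note R = W_rep_lin[OF T r r', of \<alpha>]
  show "comb f \<alpha> g \<in> W T" by (rule rep_in_W[OF T R])
  show "inner_W T f g = inner_W T g f"
    unfolding inner_W_rep[OF T r r'] inner_W_rep[OF T r' r] by (simp add: mult.commute)
  assume k: "k \<in> W T"
  obtain w'' a'' b'' c'' d'' e'' where r'': "W_rep T k w'' a'' b'' c'' d'' e''" using W_rep_exists[OF T k] by blast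
  note C = rep_cont[OF T r] rep_cont[OF T r']
  have s: "slope (comb w \<alpha> w') 0 = slope w 0 + \<alpha> * slope w' 0" using slope_lin[OF C, of 0] T by simp
  have i: "int_x (comb w \<alpha> w') 1 0 = int_x w 1 0 + \<alpha> * int_x w' 1 0" using eq_OmegaD[OF int_x_lin[OF C], of 1 0] T by simp
  show "inner_W T (comb f \<alpha> g) k = inner_W T f k + \<alpha> * inner_W T g k"
    unfolding inner_W_rep[OF T R r''] inner_W_rep[OF T r r''] inner_W_rep[OF T r' r''] s i
      L2_in_ip_lc[OF rep_e[OF T r] rep_e[OF T r'] rep_e[OF T r'']]
      L2_in_ip_lc[OF rep_L2(1)[OF T r] rep_L2(1)[OF T r'] rep_L2(1)[OF T r'']]
      L2_in_ip_lc[OF rep_L2(2)[OF T r] rep_L2(2)[OF T r'] rep_L2(2)[OF T r'']]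
      L2_in_ip_lc[OF rep_L2(3)[OF T r] rep_L2(3)[OF T r'] rep_L2(3)[OF T r'']]
    by (simp add: algebra_simps)
qed

lemma inner_W_self:
  assumes "0 < T" "W_rep T u w a b c d e"
  shows "inner_W T u u = sq e + sq c + (slope w 0)\<^sup>2 + (int_x w 1 0 + slope w 0)\<^sup>2 + sq b + sq d"
  unfolding inner_W_rep[OF assms(1,2,2)] by (simp add: power2_eq_square)

text \<open>Only \<open>a\<close> does not occur in the norm. It is recovered from the two boundary slopes of \<open>u\<^sub>t\<^sub>t\<close> at \<open>t = 0\<close>,
  whose difference is \<open>\<integral>\<^sub>0\<^sup>1 (a + \<integral>b)\<close>.\<close>

lemma sq_size_le_inner_W:
  assumes T: "0 < T" and r: "W_rep T u w a b c d e"
  shows "sq_size a b c d \<le> 4 * inner_W T u u"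
proof -
  note b = rep_L2(1)[OF T r]
  have w0: "w x 0 = a + primitive b x" if "x \<in> {0..1}" for x
    using mixed_L1_at_0[OF mixed_L2_mixed_L1[OF rep_mixed_L2[OF T r] eq_Omega_refl] _ that] T by simp
  have c: "continuous_on S (primitive b)" for S
    by (rule continuous_on_subset[OF continuous_primitive[OF L2_in_integrable(1)[OF b]]]) simp
  define s where "s = int_x w 1 0"
  have "s = integral {0..1} (\<lambda>x. a + primitive b x)"
    unfolding s_def int_x_def by (rule integral_cong) (use w0 in auto)
  also have "\<dots> = integral {0..1} (\<lambda>x::real. a) + integral {0..1} (primitive b)"
    by (rule Henstock_Kurzweil_Integration.integral_add) (auto intro!: integrable_continuous_interval c)
  finally have s: "s - a = integral {0..1} (primitive b)" by simp
  have "norm (integral {0..1} (primitive b)) \<le> sqrt (sq b) * (1 - 0)"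
  proof (rule integral_bound)
    show "norm (primitive b t) \<le> sqrt (sq b)" for t
      using L2_in_primitive_bound[OF b, of t] real_le_rsqrt[of "\<bar>primitive b t\<bar>" "sq b"] by simp
  qed (auto intro: c)
  then have "\<bar>s - a\<bar> \<le> sqrt (sq b)" by (simp add: s)
  then have "\<bar>s - a\<bar>\<^sup>2 \<le> (sqrt (sq b))\<^sup>2" by (rule power_mono) simp
  then have sa: "(s - a)\<^sup>2 \<le> sq b" using sq_nonneg[of b] by simp
  have two: "(p + q)\<^sup>2 \<le> 2 * p\<^sup>2 + 2 * q\<^sup>2" for p q :: real
    using sum_squares_bound[of p q] by (simp add: power2_sum)
  have "a\<^sup>2 \<le> 2 * s\<^sup>2 + 2 * (s - a)\<^sup>2" using two[of s "a - s"] by (simp add: power2_commute[of s a])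
  moreover have "s\<^sup>2 \<le> 2 * (s + slope w 0)\<^sup>2 + 2 * (slope w 0)\<^sup>2" using two[of "s + slope w 0" "- slope w 0"] by simp
  moreover have "inner_W T u u = sq e + sq c + (slope w 0)\<^sup>2 + (s + slope w 0)\<^sup>2 + sq b + sq d"
    unfolding s_def by (rule inner_W_self[OF T r])
  ultimately show ?thesis
    using sa sq_nonneg[of e] sq_nonneg[of b] sq_nonneg[of c] sq_nonneg[of d] unfolding sq_size_def by linarith
qed

text \<open>The norm does not depend on the choice of \<open>e\<close>, so the one controlled by the other data may be used.\<close>

lemma inner_W_le_sq_size:
  assumes T: "0 < T" and r: "W_rep T u w a b c d e"
  shows "inner_W T u u \<le> (33 + 4 * (2 + 2 * T) * 56) * sq_size a b c d"
proof -
  let ?N = "sq_size a b c d"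
  have N: "mixed_L2_le 1 T w ?N" using rep_mixed_L2[OF T r] unfolding mixed_L2_le_def by blast
  have pt: "(f x t)\<^sup>2 \<le> 4 * (2 + 2 * T) * K" if f: "mixed_L2_le 1 T f K" and xt: "x \<in> {0..1}" "t \<in> {0..T}" for f K x t
  proof -
    obtain a b c d where 1: "mixed_L2 1 T f a b c d" "sq_size a b c d \<le> K" using f by (auto simp: mixed_L2_le_def)
    have "(f x t)\<^sup>2 \<le> 4 * (1 + 1 + T + 1 * T) * sq_size a b c d" by (rule mixed_L2_bound[OF 1(1) _ _ xt]) (use T in auto)
    also have "\<dots> = 4 * (2 + 2 * T) * sq_size a b c d" by simp
    also have "\<dots> \<le> 4 * (2 + 2 * T) * K" using 1(2) T by (intro mult_left_mono) auto
    finally show ?thesis .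
  qed
  have N1: "mixed_L2_le 1 T (int_x w) (4 * ?N)" using mixed_L2_le_int_x[OF N] by simp
  have N2: "mixed_L2_le 1 T (int_x (int_x w)) (16 * ?N)" using mixed_L2_le_int_x[OF N1] by simp
  have s: "(slope w 0)\<^sup>2 \<le> 4 * (2 + 2 * T) * (16 * ?N)" using pt[OF N2, of 1 0] T by (simp add: slope_def)
  have i: "(int_x w 1 0)\<^sup>2 \<le> 4 * (2 + 2 * T) * (4 * ?N)" using pt[OF N1, of 1 0] T by simp
  have "(int_x w 1 0 + slope w 0)\<^sup>2 \<le> 2 * (int_x w 1 0)\<^sup>2 + 2 * (slope w 0)\<^sup>2"
    using sum_squares_bound[of "int_x w 1 0" "slope w 0"] by (simp add: power2_sum)
  \<comment> \<open>The factor is \<open>16 + 2 \<cdot> (4 + 16)\<close>.\<close>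
  then have m: "(slope w 0)\<^sup>2 + (int_x w 1 0 + slope w 0)\<^sup>2 \<le> 4 * (2 + 2 * T) * 56 * ?N" using s i by (simp add: algebra_simps)
  obtain e' where e': "L2_in {0..T} e'" "\<And>t. t \<in> {0..T} \<Longrightarrow> slope w t = slope w 0 + primitive e' t" "sq e' \<le> 32 * ?N"
    using slope_data[OF N T] by blast
  have "W_rep T u w a b c d e'" using rep_mixed_L2[OF T r] rep_u[OF T r] e' unfolding W_rep_def by blast
  from inner_W_self[OF T this] have "inner_W T u u = sq e' + sq c + ((slope w 0)\<^sup>2 + (int_x w 1 0 + slope w 0)\<^sup>2) + sq b + sq d" by simp
  also have "\<dots> \<le> 32 * ?N + 4 * (2 + 2 * T) * 56 * ?N + ?N"
    using e'(3) m zero_le_power2[of a] unfolding sq_size_def by linarith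
  finally show ?thesis by (simp add: algebra_simps)
qed

text \<open>The data of \<open>u\<close> itself are bounded by those of \<open>w\<close>, and a function is bounded by its data.\<close>

lemma W_point_bound:
  assumes T: "0 < T"
  obtains C where "0 \<le> C" "\<And>u x t. u \<in> W T \<Longrightarrow> x \<in> {0..1} \<Longrightarrow> t \<in> {0..T} \<Longrightarrow> (u x t)\<^sup>2 \<le> C * inner_W T u u"
proof
  let ?K = "(2 * T\<^sup>2 + 2 * T)\<^sup>2 * 160"
  let ?C = "4 * (1 + 1 + T + 1 * T) * (?K * 4)"
  show "0 \<le> ?C" using T by simp
  fix u x t assume u: "u \<in> W T" and xt: "x \<in> {0..1::real}" "t \<in> {0..T}"
  obtain w a b c d e where r: "W_rep T u w a b c d e" using W_rep_exists[OF T u] by blast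
  have "mixed_L2_le 1 T w (sq_size a b c d)" using rep_mixed_L2[OF T r] unfolding mixed_L2_le_def by blast
  from mixed_L2_le_d4_inverse[OF this] T have "mixed_L2_le 1 T (d4_inverse w) (?K * sq_size a b c d)" by simp
  then obtain a' b' c' d' where 1: "mixed_L2 1 T (d4_inverse w) a' b' c' d'" "sq_size a' b' c' d' \<le> ?K * sq_size a b c d"
    by (auto simp: mixed_L2_le_def)
  have "(u x t)\<^sup>2 = (d4_inverse w x t)\<^sup>2" using eq_OmegaD[OF rep_u[OF T r] xt] by simp
  also have "\<dots> \<le> 4 * (1 + 1 + T + 1 * T) * sq_size a' b' c' d'" by (rule mixed_L2_bound[OF 1(1) _ _ xt]) (use T in auto)
  also have "\<dots> \<le> 4 * (1 + 1 + T + 1 * T) * (?K * (4 * inner_W T u u))"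
  proof (rule mult_left_mono)
    have "?K * sq_size a b c d \<le> ?K * (4 * inner_W T u u)"
      by (rule mult_left_mono[OF sq_size_le_inner_W[OF T r]]) simp
    with 1(2) show "sq_size a' b' c' d' \<le> ?K * (4 * inner_W T u u)" by (rule order_trans)
  qed (use T in auto)
  finally show "(u x t)\<^sup>2 \<le> ?C * inner_W T u u" by (simp only: mult.assoc)
qed

text \<open>Data that represent a function represent every other one that agrees with it on \<open>\<Omega>\<close>.\<close>

lemma inner_W_eq_Omega:
  assumes T: "0 < T" and u: "u \<in> W T" "u' \<in> W T" and v: "eq_Omega T v u" "eq_Omega T v' u'"
  shows "v \<in> W T" "inner_W T v v' = inner_W T u u'"
proof -
  obtain w a b c d e where r: "W_rep T u w a b c d e" using W_rep_exists[OF T u(1)] by blast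
  obtain w' a' b' c' d' e' where r': "W_rep T u' w' a' b' c' d' e'" using W_rep_exists[OF T u(2)] by blast
  have s: "W_rep T v w a b c d e" using r eq_Omega_trans[OF v(1) rep_u[OF T r]] unfolding W_rep_def by blast
  have s': "W_rep T v' w' a' b' c' d' e'" using r' eq_Omega_trans[OF v(2) rep_u[OF T r']] unfolding W_rep_def by blast
  show "v \<in> W T" by (rule rep_in_W[OF T s])
  show "inner_W T v v' = inner_W T u u'" unfolding inner_W_rep[OF T r r'] inner_W_rep[OF T s s'] ..
qed

text \<open>The data of a Cauchy sequence are Cauchy, and their limits are the data of a limit in \<^const>\<open>W\<close>.\<close>

theorem W_complete:
  assumes T: "0 < T"
  shows "complete_semi_inner_space (W T) (inner_W T) comb (\<lambda>x t. 0)"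
proof -
  interpret V: semi_inner_space "W T" "inner_W T" comb "\<lambda>x t. 0" by (rule W_semi_inner[OF T])
  show ?thesis
  proof
    fix F :: "nat \<Rightarrow> real \<Rightarrow> real \<Rightarrow> real"
    assume F: "\<And>n. F n \<in> W T"
      and Cau: "\<And>\<epsilon>. \<epsilon> > 0 \<Longrightarrow> \<exists>N. \<forall>m\<ge>N. \<forall>n\<ge>N. V.sqdist (F m) (F n) < \<epsilon>"
    have "\<forall>n. \<exists>w a b c d e. W_rep T (F n) w a b c d e" using W_rep_exists[OF T F] by metis
    then obtain w a b c d e where r: "\<And>n. W_rep T (F n) (w n) (a n) (b n) (c n) (d n) (e n)" by metis
    note b = rep_L2(1)[OF T r] and c = rep_L2(2)[OF T r] and d = rep_L2(3)[OF T r]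
    have dist: "(a m - a n)\<^sup>2 + sq (\<lambda>x. b m x - b n x) + sq (\<lambda>x. c m x - c n x) + sq (\<lambda>x. d m x - d n x)
        \<le> 4 * V.sqdist (F m) (F n)" for m n
      using sq_size_le_inner_W[OF T W_rep_lin[OF T r[of m] r[of n], of "-1"]]
      unfolding V.sqdist_def sq_size_def by simp
    have cauchy: "\<exists>N. \<forall>m\<ge>N. \<forall>n\<ge>N. f m n < \<epsilon>"
      if f: "\<And>m n. f m n \<le> 4 * V.sqdist (F m) (F n)" and "\<epsilon> > 0" for f :: "nat \<Rightarrow> nat \<Rightarrow> real" and \<epsilon>
    proof -
      obtain N where N: "\<And>m n. m \<ge> N \<Longrightarrow> n \<ge> N \<Longrightarrow> V.sqdist (F m) (F n) < \<epsilon> / 4"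
        using Cau[of "\<epsilon> / 4"] \<open>\<epsilon> > 0\<close> by auto
      show ?thesis
      proof (intro exI[of _ N] allI impI)
        fix m n assume "N \<le> m" "N \<le> n"
        then show "f m n < \<epsilon>" using f[of m n] N[of m n] by linarith
      qed
    qed
    have nn: "0 \<le> sq (\<lambda>x. b m x - b n x)" "0 \<le> sq (\<lambda>x. c m x - c n x)" "0 \<le> sq (\<lambda>x. d m x - d n x)" for m n
      by (rule sq_nonneg)+
    have le: "(a m - a n)\<^sup>2 \<le> 4 * V.sqdist (F m) (F n)" "sq (\<lambda>x. b m x - b n x) \<le> 4 * V.sqdist (F m) (F n)"
      "sq (\<lambda>x. c m x - c n x) \<le> 4 * V.sqdist (F m) (F n)" "sq (\<lambda>x. d m x - d n x) \<le> 4 * V.sqdist (F m) (F n)" for m n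
      using dist[of m n] nn[of m n] zero_le_power2[of "a m - a n"] by linarith+
    have "Cauchy a"
    proof (rule metric_CauchyI)
      fix \<epsilon> :: real assume "0 < \<epsilon>"
      then have "0 < \<epsilon>\<^sup>2" by simp
      from cauchy[of "\<lambda>m n. (a m - a n)\<^sup>2", OF le(1) this]
      obtain N where N: "\<And>m n. N \<le> m \<Longrightarrow> N \<le> n \<Longrightarrow> (a m - a n)\<^sup>2 < \<epsilon>\<^sup>2" by blast
      have "dist (a m) (a n) < \<epsilon>" if "N \<le> m" "N \<le> n" for m n
        by (rule power2_less_imp_less) (use N[OF that] \<open>0 < \<epsilon>\<close> in \<open>simp_all add: dist_real_def\<close>)
      then show "\<exists>N. \<forall>m\<ge>N. \<forall>n\<ge>N. dist (a m) (a n) < \<epsilon>" by blast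
    qed
    then obtain a0 where a0: "a \<longlonglongrightarrow> a0" by (auto simp: Cauchy_convergent_iff convergent_def)
    have s: "\<And>n. sqint lborel (b n)" "\<And>n. sqint lborel (c n)" "\<And>n. sqint lborel (d n)"
      using b c d by (auto simp: L2_in_def)
    obtain b0 where b0: "sqint lborel b0" "(\<lambda>n. sq (\<lambda>x. b n x - b0 x)) \<longlonglongrightarrow> 0" "\<And>x. (\<And>n. b n x = 0) \<Longrightarrow> b0 x = 0"
      using riesz_fischer[OF s(1) cauchy[of "\<lambda>m n. sq (\<lambda>x. b m x - b n x)", OF le(2)]] by blast
    obtain c0 where c0: "sqint lborel c0" "(\<lambda>n. sq (\<lambda>x. c n x - c0 x)) \<longlonglongrightarrow> 0" "\<And>x. (\<And>n. c n x = 0) \<Longrightarrow> c0 x = 0"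
      using riesz_fischer[OF s(2) cauchy[of "\<lambda>m n. sq (\<lambda>x. c m x - c n x)", OF le(3)]] by blast
    obtain d0 where d0: "sqint lborel d0" "(\<lambda>n. sq (\<lambda>x. d n x - d0 x)) \<longlonglongrightarrow> 0" "\<And>x. (\<And>n. d n x = 0) \<Longrightarrow> d0 x = 0"
      using riesz_fischer[OF s(3) cauchy[of "\<lambda>m n. sq (\<lambda>x. d m x - d n x)", OF le(4)]] by blast
    define w0 where "w0 = mixed_integral a0 b0 c0 d0"
    have L: "L2_in {0..1} b0" "L2_in {0..T} c0" "L2_in (rect 1 T) d0"
      using b0 c0 d0 b c d by (auto simp: L2_in_def Omega_def)
    have w0: "mixed_L2 1 T w0 a0 b0 c0 d0" using L by (simp add: mixed_L2_def w0_def)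
    have N0: "mixed_L2_le 1 T w0 (sq_size a0 b0 c0 d0)" unfolding mixed_L2_le_def using w0 by (intro exI conjI) auto
    have "\<exists>e0. L2_in {0..T} e0 \<and> (\<forall>t\<in>{0..T}. slope w0 t = slope w0 0 + primitive e0 t)"
    proof (rule slope_data[OF N0 T])
      fix e0 assume 1: "L2_in {0..T} e0" and 2: "\<And>t. t \<in> {0..T} \<Longrightarrow> slope w0 t = slope w0 0 + primitive e0 t"
      show ?thesis by (intro exI[of _ e0] conjI ballI 1) (rule 2)
    qed
    then obtain e0 where e0: "L2_in {0..T} e0" "\<forall>t\<in>{0..T}. slope w0 t = slope w0 0 + primitive e0 t" by blast
    have r0: "W_rep T (d4_inverse w0) w0 a0 b0 c0 d0 e0" using w0 e0 eq_Omega_refl[of T "d4_inverse w0"] unfolding W_rep_def by blast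
    let ?C = "33 + 4 * (2 + 2 * T) * 56"
    have up: "V.sqdist (F n) (d4_inverse w0) \<le> ?C * ((a n - a0)\<^sup>2 + sq (\<lambda>x. b n x - b0 x) + sq (\<lambda>x. c n x - c0 x) + sq (\<lambda>x. d n x - d0 x))" for n
      using inner_W_le_sq_size[OF T W_rep_lin[OF T r[of n] r0, of "-1"]]
      unfolding V.sqdist_def sq_size_def by simp
    have "(\<lambda>n. ?C * ((a n - a0)\<^sup>2 + sq (\<lambda>x. b n x - b0 x) + sq (\<lambda>x. c n x - c0 x) + sq (\<lambda>x. d n x - d0 x)))
        \<longlonglongrightarrow> ?C * ((a0 - a0)\<^sup>2 + 0 + 0 + 0)"
      by (intro tendsto_mult tendsto_add tendsto_power tendsto_diff tendsto_const a0 b0(2) c0(2) d0(2))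
    then have lim: "(\<lambda>n. ?C * ((a n - a0)\<^sup>2 + sq (\<lambda>x. b n x - b0 x) + sq (\<lambda>x. c n x - c0 x) + sq (\<lambda>x. d n x - d0 x))) \<longlonglongrightarrow> 0"
      by simp
    have uW: "d4_inverse w0 \<in> W T" by (rule rep_in_W[OF T r0])
    have "(\<lambda>n. V.sqdist (F n) (d4_inverse w0)) \<longlonglongrightarrow> 0"
      by (rule tendsto_sandwich[OF always_eventually always_eventually tendsto_const lim])
         (rule allI, rule V.sqdist_nonneg[OF F uW], rule allI, rule up)
    then show "\<exists>f\<in>W T. (\<lambda>n. V.sqdist (F n) f) \<longlonglongrightarrow> 0" using uW by blast
  qed
qed

section \<open>The operator L and its adjoint\<close>

lemma mixed_L2_eq_Omega: "mixed_L2 1 T f a b c d \<Longrightarrow> eq_Omega T g f \<Longrightarrow> mixed_L2 1 T g a b c d"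
  by (simp add: mixed_L2_def eq_Omega_def)

text \<open>As for \<^const>\<open>W\<close>: the conditions in \<^const>\<open>What\<close> say that the three densities are square integrable.\<close>

lemma What_mixed_L2:
  assumes T: "0 < T" and g: "g \<in> What T"
  obtains a b c d where "mixed_L2 1 T g a b c d"
proof -
  note dd = g[unfolded What_def mem_Collect_eq W21_def]
  obtain a b c d where r: "mixed_L1 T g a b c d" using dd by (auto simp: completely_continuous_iff)
  have l: "L1_in {0..1} b" "L1_in {0..T} c" "L1_in (Omega T) d" using r by (auto simp: mixed_L1_def)
  have "L2_in (Omega T) d"
    using L2_on_AE_iff[OF Omega_borel L1_in_measurable[OF l(3)] _ mixed_L1_AE_mixed[OF T r]] l(3) dd
    by (simp add: L1_in_def)
  moreover have "AE x in lborel. x \<in> {0..1} \<longrightarrow> D01 (\<lambda>x. g x 0) x = b x"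
    using mixed_L1_AE_dX_0[OF T r] unfolding D01_def
    by eventually_elim (use vector_derivative_Icc[of 1] in auto)
  then have "L2_in {0..1} b"
    using L2_on_AE_iff[OF _ L1_in_measurable[OF l(1)]] l(1) dd by (auto simp: L1_in_def)
  moreover have "AE t in lborel. t \<in> {0..T} \<longrightarrow> dT T g 0 t = c t"
    using mixed_L1_AE_dT_0[OF T r] unfolding dT_def
    by eventually_elim (use vector_derivative_Icc[OF T] in auto)
  then have "L2_in {0..T} c"
    using L2_on_AE_iff[OF _ L1_in_measurable[OF l(2)]] l(2) dd by (auto simp: L1_in_def)
  ultimately have "mixed_L2 1 T g a b c d" using r by (auto simp: mixed_L2_def mixed_L1_def Omega_def)
  then show thesis by (rule that)
qed

context
  fixes T g a b c d
  assumes T: "0 < T" and g: "mixed_L2 1 T g a b c d"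
begin

lemma mixed_L2_rep: "mixed_L1 T g a b c d" by (rule mixed_L2_mixed_L1[OF g eq_Omega_refl])

lemma mixed_L2_D01: "AE x in lborel. x \<in> {0..1} \<longrightarrow> D01 (\<lambda>x. g x 0) x = b x"
  using mixed_L1_AE_dX_0[OF T mixed_L2_rep] unfolding D01_def
  by eventually_elim (use vector_derivative_Icc[of 1] in auto)

lemma mixed_L2_dT: "AE t in lborel. t \<in> {0..T} \<longrightarrow> dT T g 0 t = c t"
  using mixed_L1_AE_dT_0[OF T mixed_L2_rep] unfolding dT_def
  by eventually_elim (use vector_derivative_Icc[OF T] in auto)

lemma mixed_L2_mixed: "AE q in lborel. q \<in> Omega T \<longrightarrow> (case q of (x, t) \<Rightarrow> dX (dT T g) x t) = d q"
  by (rule mixed_L1_AE_mixed[OF T mixed_L2_rep])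

lemma mixed_L2_at_00: "g 0 0 = a"
  using mixed_L1_at_0[OF mixed_L2_rep, of 0] primitive_0 L2_in_Icc_L1_in g T by (auto simp: mixed_L2_def)

lemma mixed_L2_L2: "L2_in {0..1} b" "L2_in {0..T} c" "L2_in (Omega T) d"
  using g by (auto simp: mixed_L2_def Omega_def)

lemma mixed_L2_in_What: "g \<in> What T"
proof -
  have "abs_cont01 (\<lambda>x. g x 0)"
    by (rule abs_cont01_primitive[OF mixed_L2_L2(1), of _ a]) (use mixed_L1_at_0[OF mixed_L2_rep] T in auto)
  moreover have "completely_continuous T g" using mixed_L2_rep completely_continuous_iff by blast
  ultimately show ?thesis
    using L2_on_AE_iff[OF _ _ _ mixed_L2_D01] L2_on_AE_iff[OF _ _ _ mixed_L2_dT] L2_on_AE_iff[OF _ _ _ mixed_L2_mixed] mixed_L2_L2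
    by (auto simp: What_def W21_def L2_in_def sqint_def)
qed

end

lemma inner_What_mixed_L2:
  assumes T: "0 < T" and f: "mixed_L2 1 T f a b c d" and g: "mixed_L2 1 T g a' b' c' d'"
  shows "inner_What T f g = a * a' + (LINT x|lborel. b x * b' x) + (LINT x|lborel. c x * c' x) + (LINT x|lborel. d x * d' x)"
proof -
  have m: "L2_in S f \<Longrightarrow> f \<in> borel_measurable borel" for S and f :: "'z::euclidean_space \<Rightarrow> real" by (simp add: L2_in_def sqint_def)
  have z: "L2_in S f \<Longrightarrow> \<forall>x. x \<notin> S \<longrightarrow> f x = 0" for S and f :: "'z::euclidean_space \<Rightarrow> real" by (simp add: L2_in_def)
  note F = mixed_L2_L2[OF T f] and G = mixed_L2_L2[OF T g]
  have 1: "(LINT x|lebesgue_on {0..1}. D01 (\<lambda>x. f x 0) x * D01 (\<lambda>x. g x 0) x) = (LINT x|lborel. b x * b' x)"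
    by (rule LINT_mult_lebesgue_on[OF _ m[OF F(1)] m[OF G(1)] z[OF F(1)] mixed_L2_D01[OF T f] mixed_L2_D01[OF T g]]) simp
  have 2: "(LINT t|lebesgue_on {0..T}. dT T f 0 t * dT T g 0 t) = (LINT x|lborel. c x * c' x)"
    by (rule LINT_mult_lebesgue_on[OF _ m[OF F(2)] m[OF G(2)] z[OF F(2)] mixed_L2_dT[OF T f] mixed_L2_dT[OF T g]]) simp
  have 3: "(LINT (x, t)|lebesgue_on (Omega T). dX (dT T f) x t * dX (dT T g) x t) = (LINT x|lborel. d x * d' x)"
    using LINT_mult_lebesgue_on[OF Omega_borel m[OF F(3)] m[OF G(3)] z[OF F(3)] mixed_L2_mixed[OF T f] mixed_L2_mixed[OF T g]]
    by (simp add: case_prod_unfold)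
  show ?thesis
    unfolding inner_What_def inner_W21_def 1 2 3 using mixed_L2_at_00[OF T f] mixed_L2_at_00[OF T g] by simp
qed

lemma LINT_CS: "L2_in S f \<Longrightarrow> L2_in S g \<Longrightarrow> (LINT x|lborel. f x * g x)\<^sup>2 \<le> sq f * sq g"
  using L2.Cauchy_Schwarz[of f lborel g] by (simp add: L2_in_def power2_eq_square)

lemma inner_What_bound:
  assumes T: "0 < T" and f: "mixed_L2 1 T f a b c d" and g: "mixed_L2 1 T g a' b' c' d'"
  shows "(inner_What T f g)\<^sup>2 \<le> 4 * sq_size a b c d * sq_size a' b' c' d'"
proof -
  note F = mixed_L2_L2[OF T f] and G = mixed_L2_L2[OF T g]
  have prod4: "p * p' + q * q' + r * r' + s * s' \<le> (p + q + r + s) * (p' + q' + r' + s')"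
    if "0 \<le> p" "0 \<le> q" "0 \<le> r" "0 \<le> s" "0 \<le> p'" "0 \<le> q'" "0 \<le> r'" "0 \<le> s'" for p q r s p' q' r' s' :: real
  proof -
    have "0 \<le> p * (q' + r' + s') + q * (p' + r' + s') + r * (p' + q' + s') + s * (p' + q' + r')"
      using that by (intro add_nonneg_nonneg mult_nonneg_nonneg) auto
    also have "\<dots> = (p + q + r + s) * (p' + q' + r' + s') - (p * p' + q * q' + r * r' + s * s')" by (simp add: algebra_simps)
    finally show ?thesis by simp
  qed
  have "(inner_What T f g)\<^sup>2 \<le> 4 * ((a * a')\<^sup>2 + (LINT x|lborel. b x * b' x)\<^sup>2 + (LINT x|lborel. c x * c' x)\<^sup>2 + (LINT x|lborel. d x * d' x)\<^sup>2)"
    unfolding inner_What_mixed_L2[OF T f g] by (rule four_squares)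
  also have "\<dots> \<le> 4 * (a\<^sup>2 * a'\<^sup>2 + sq b * sq b' + sq c * sq c' + sq d * sq d')"
    by (intro mult_left_mono add_mono LINT_CS[OF F(1) G(1)] LINT_CS[OF F(2) G(2)] LINT_CS[OF F(3) G(3)])
       (simp_all add: power_mult_distrib)
  also have "\<dots> \<le> 4 * (sq_size a b c d * sq_size a' b' c' d')"
    unfolding sq_size_def by (rule mult_left_mono[OF prod4]) (simp_all add: sq_nonneg)
  finally show ?thesis by (simp only: mult.assoc)
qed

lemma L_eq:
  assumes T: "0 < T" and r: "W_rep T v w a b c d e"
  shows "eq_Omega T (L T v) (comb (bvp w) (-1) (int_t (int_t w)))"
  using d4_inverse_dT2(2)[OF rep_d4_inverse[OF T r]] d4_inverse_dX2(2)[OF rep_d4_inverse[OF T r]]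
  by (simp add: eq_Omega_def L_def funpow_2)

lemma L_mixed_L2_le:
  assumes T: "0 < T" and r: "W_rep T v w a b c d e"
  obtains a' b' c' d' where "mixed_L2 1 T (L T v) a' b' c' d'"
    "sq_size a' b' c' d' \<le> (320 + 2 * (2 * T\<^sup>2 + 2 * T)\<^sup>2) * sq_size a b c d"
proof -
  let ?N = "sq_size a b c d"
  have N: "mixed_L2_le 1 T w ?N" using rep_mixed_L2[OF T r] unfolding mixed_L2_le_def by blast
  have "mixed_L2_le 1 T (int_t (int_t w)) ((2 * T\<^sup>2 + 2 * T) * ((2 * T\<^sup>2 + 2 * T) * ?N))"
    using mixed_L2_le_int_t[OF mixed_L2_le_int_t[OF N]] T by simp
  from mixed_L2_le_lin[OF mixed_L2_le_bvp[OF N] this, of "-1"]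
  obtain a' b' c' d' where 1: "mixed_L2 1 T (comb (bvp w) (-1) (int_t (int_t w))) a' b' c' d'"
    "sq_size a' b' c' d' \<le> 2 * (160 * ?N) + 2 * (-1)\<^sup>2 * ((2 * T\<^sup>2 + 2 * T) * ((2 * T\<^sup>2 + 2 * T) * ?N))"
    unfolding mixed_L2_le_def by blast
  show thesis
  proof (rule that[OF mixed_L2_eq_Omega[OF 1(1) L_eq[OF T r]]])
    show "sq_size a' b' c' d' \<le> (320 + 2 * (2 * T\<^sup>2 + 2 * T)\<^sup>2) * ?N"
      using 1(2) unfolding power2_eq_square[of "2 * T\<^sup>2 + 2 * T"] by (simp add: algebra_simps)
  qed
qed

lemma L_lin:
  assumes T: "0 < T" and r: "W_rep T v w a b c d e" and r': "W_rep T v' w' a' b' c' d' e'"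
  shows "eq_Omega T (L T (comb v k v')) (comb (L T v) k (L T v'))"
proof -
  note C = rep_cont[OF T r] rep_cont[OF T r']
  show ?thesis unfolding eq_Omega_def
  proof (intro ballI)
    fix x t assume x: "x \<in> {0..1::real}" and t: "t \<in> {0..T}"
    show "L T (comb v k v') x t = comb (L T v) k (L T v') x t"
      unfolding eq_OmegaD[OF L_eq[OF T W_rep_lin[OF T r r', of k]] x t] eq_OmegaD[OF L_eq[OF T r] x t] eq_OmegaD[OF L_eq[OF T r'] x t]
        eq_OmegaD[OF bvp_lin[OF C, of k] x t] eq_OmegaD[OF int_t2_lin[OF C, of k] x t]
      by (simp add: right_diff_distrib)
  qed
qed

text \<open>For \<open>g\<close> in \<^const>\<open>What\<close> the functional \<open>v \<mapsto> \<langle>L v, g\<rangle>\<close> is bounded, since the data of \<open>L v\<close> are bounded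
  by those of \<open>v\<close>; the Riesz representation theorem provides the value of the adjoint at \<open>g\<close>. Hence the
  choice in \<^const>\<open>Lstar\<close> is from a nonempty set.\<close>

theorem L_adjoint_exists:
  assumes T: "0 < T"
  shows "is_adjoint (W T) (inner_W T) (What T) (inner_What T) (L T) (Lstar T)"
proof -
  interpret V: complete_semi_inner_space "W T" "inner_W T" comb "\<lambda>x t. 0" by (rule W_complete[OF T])
  have "\<exists>r\<in>W T. \<forall>v\<in>W T. inner_What T (L T v) g = inner_W T v r" if g: "g \<in> What T" for g
  proof -
    obtain a0 b0 c0 d0 where g: "mixed_L2 1 T g a0 b0 c0 d0" using What_mixed_L2[OF T g] by blast
    let ?K = "4 * ((320 + 2 * (2 * T\<^sup>2 + 2 * T)\<^sup>2) * 4) * sq_size a0 b0 c0 d0"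
    show ?thesis
    proof (rule V.riesz_representation)
      fix v assume v: "v \<in> W T"
      obtain w a b c d e where r: "W_rep T v w a b c d e" using W_rep_exists[OF T v] by blast
      obtain a' b' c' d' where l: "mixed_L2 1 T (L T v) a' b' c' d'"
        "sq_size a' b' c' d' \<le> (320 + 2 * (2 * T\<^sup>2 + 2 * T)\<^sup>2) * sq_size a b c d" by (rule L_mixed_L2_le[OF T r])
      have "sq_size a' b' c' d' \<le> (320 + 2 * (2 * T\<^sup>2 + 2 * T)\<^sup>2) * (4 * inner_W T v v)"
        by (rule order_trans[OF l(2) mult_left_mono[OF sq_size_le_inner_W[OF T r]]]) simp
      then have "4 * sq_size a' b' c' d' * sq_size a0 b0 c0 d0
          \<le> 4 * ((320 + 2 * (2 * T\<^sup>2 + 2 * T)\<^sup>2) * (4 * inner_W T v v)) * sq_size a0 b0 c0 d0"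
        by (intro mult_right_mono mult_left_mono) (simp_all add: sq_size_def sq_nonneg)
      also have "\<dots> = ?K * inner_W T v v" by (simp only: mult_ac)
      finally show "(inner_What T (L T v) g)\<^sup>2 \<le> ?K * inner_W T v v"
        using inner_What_bound[OF T l(1) g] by (rule order_trans[rotated])
    next
      fix v v' k assume v: "v \<in> W T" and v': "v' \<in> W T"
      obtain w a b c d e where r: "W_rep T v w a b c d e" using W_rep_exists[OF T v] by blast
      obtain w' a' b' c' d' e' where r': "W_rep T v' w' a' b' c' d' e'" using W_rep_exists[OF T v'] by blast
      obtain a1 b1 c1 d1 where l: "mixed_L2 1 T (L T v) a1 b1 c1 d1" by (rule L_mixed_L2_le[OF T r])
      obtain a2 b2 c2 d2 where l': "mixed_L2 1 T (L T v') a2 b2 c2 d2" by (rule L_mixed_L2_le[OF T r'])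
      note l3 = mixed_L2_eq_Omega[OF mixed_L2_lin[OF l l', of k] L_lin[OF T r r', of k]]
      note A = mixed_L2_L2[OF T l] and B = mixed_L2_L2[OF T l'] and C = mixed_L2_L2[OF T g]
      show "inner_What T (L T (comb v k v')) g = inner_What T (L T v) g + k * inner_What T (L T v') g"
        unfolding inner_What_mixed_L2[OF T l3 g] inner_What_mixed_L2[OF T l g] inner_What_mixed_L2[OF T l' g]
          L2_in_ip_lc[OF A(1) B(1) C(1)] L2_in_ip_lc[OF A(2) B(2) C(2)] L2_in_ip_lc[OF A(3) B(3) C(3)]
        by (simp add: algebra_simps)
    qed
  qed
  then have "\<forall>g. \<exists>r. g \<in> What T \<longrightarrow> r \<in> W T \<and> (\<forall>v\<in>W T. inner_What T (L T v) g = inner_W T v r)" by blast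
  then obtain B where "\<forall>g. g \<in> What T \<longrightarrow> B g \<in> W T \<and> (\<forall>v\<in>W T. inner_What T (L T v) g = inner_W T v (B g))"
    by metis
  then have "\<exists>B. is_adjoint (W T) (inner_W T) (What T) (inner_What T) (L T) B" unfolding is_adjoint_def by blast
  from someI_ex[OF this] show ?thesis unfolding Lstar_def .
qed

lemma primitive_indicator:
  assumes "0 \<le> x" "0 \<le> y" shows "primitive (indicator {0..y}) x = min x y"
proof -
  have "primitive (indicator {0..y}) x = (LINT z|lborel. indicator {0..min x y} z)"
    unfolding primitive_def set_lebesgue_integral_def
    by (rule Bochner_Integration.integral_cong) (auto simp: indicator_def)
  then show ?thesis using assms by simp
qed

lemma L2_in_indicator_sub: "y \<le> A \<Longrightarrow> L2_in {0..A::real} (indicator {0..y})"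
  by (auto simp: L2_in_def sqint_def indicator_sq)

text \<open>\<open>1 + min x y = 1 + \<integral>\<^sub>0\<^sup>x 1\<^bsub>[0,y]\<^esub>\<close>, and \<open>G\<close> is the product of two such functions.\<close>

lemma G_mixed_L2:
  assumes y: "y \<in> {0..1}" and s: "s \<in> {0..T}"
  shows "mixed_L2 1 T (G y s) 1 (indicator {0..y}) (indicator {0..s}) (\<lambda>q. indicator {0..y} (fst q) * indicator {0..s} (snd q))"
proof -
  have "mixed_integral 1 (indicator {0..y}) (indicator {0..s}) (\<lambda>q. indicator {0..y} (fst q) * indicator {0..s} (snd q)) x t = G y s x t"
    if "x \<in> {0..1}" "t \<in> {0..T}" for x t
    using that y s primitive2_tensor[OF integrable_indicator_Icc[of y] integrable_indicator_Icc[of s], of x t]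
    by (simp add: mixed_integral_def G_def primitive_indicator algebra_simps)
  then show ?thesis using y s by (auto simp: mixed_L2_def intro: L2_in_indicator_sub L2_in_tensor)
qed

text \<open>Against the indicator data of \<open>G\<close>, the inner product sums \<open>a\<close> and the integrals of \<open>b\<close>, \<open>c\<close>, \<open>d\<close> up to
  \<open>(y, s)\<close>, which is the value of \<open>f\<close> there.\<close>

theorem G_reproducing:
  assumes T: "0 < T" and y: "y \<in> {0..1}" and s: "s \<in> {0..T}" and f: "mixed_L2 1 T f a b c d"
  shows "inner_What T f (G y s) = f y s"
proof -
  note F = mixed_L2_L2[OF T f]
  have 1: "(LINT x|lborel. b x * indicator {0..y} x) = primitive b y"
    using primitive_Icc[OF L2_in_Icc_L1_in[OF F(1)], of y] by (simp add: set_lebesgue_integral_def mult.commute)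
  have 2: "(LINT x|lborel. c x * indicator {0..s} x) = primitive c s"
    using primitive_Icc[OF L2_in_Icc_L1_in[OF F(2)], of s] by (simp add: set_lebesgue_integral_def mult.commute)
  have 3: "(LINT q|lborel. d q * (indicator {0..y} (fst q) * indicator {0..s} (snd q))) = primitive2 d y s"
    using primitive2_Icc[OF L2_in_Omega_L1_in[OF F(3)], of y s]
    by (simp add: set_lebesgue_integral_def indicator_times mult.commute)
  show ?thesis
    unfolding inner_What_mixed_L2[OF T f G_mixed_L2[OF y s]] 1 2 3 using f y s by (simp add: mixed_L2_def mixed_integral_def)
qed

lemma adjoint_evaluation:
  assumes T: "0 < T" and y: "y \<in> {0..1}" and s: "s \<in> {0..T}" and v: "v \<in> W T"
  shows "inner_W T v (Lstar T (G y s)) = L T v y s" "Lstar T (G y s) \<in> W T"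
proof -
  have GW: "G y s \<in> What T" by (rule mixed_L2_in_What[OF T G_mixed_L2[OF y s]])
  note A = L_adjoint_exists[OF T, unfolded is_adjoint_def]
  obtain w a b c d e where r: "W_rep T v w a b c d e" using W_rep_exists[OF T v] by blast
  obtain a1 b1 c1 d1 where l: "mixed_L2 1 T (L T v) a1 b1 c1 d1" by (rule L_mixed_L2_le[OF T r])
  show "Lstar T (G y s) \<in> W T" using A GW by blast
  have "inner_W T v (Lstar T (G y s)) = inner_What T (L T v) (G y s)" using A GW v by simp
  then show "inner_W T v (Lstar T (G y s)) = L T v y s" using G_reproducing[OF T y s l] by simp
qed

section \<open>Uniqueness for the wave equation\<close>

text \<open>With \<open>p = v\<^sub>x\<close> and \<open>q = v\<^sub>t\<close> one has \<open>p\<^sub>t = q\<^sub>x\<close> and, by the equation, \<open>q\<^sub>t = p\<^sub>x\<close>, so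
  \<open>\<partial>\<^sub>t (p\<^sup>2 + q\<^sup>2) = 2 \<partial>\<^sub>x (p q)\<close>. As \<open>q\<close> vanishes for \<open>x = 0\<close> and \<open>x = 1\<close>, the energy
  \<open>\<integral>\<^sub>0\<^sup>1 (p\<^sup>2 + q\<^sup>2) dx\<close> keeps its initial value \<open>0\<close>; hence \<open>v\<^sub>x = 0\<close> and \<open>v = 0\<close>.\<close>

theorem wave_unique:
  assumes T: "0 < T" and v: "v \<in> W T" and L0: "\<And>x t. x \<in> {0..1} \<Longrightarrow> t \<in> {0..T} \<Longrightarrow> L T v x t = 0"
  shows "eq_Omega T v (\<lambda>x t. 0)"
proof -
  obtain w a b c d e where r: "W_rep T v w a b c d e" using W_rep_exists[OF T v] by blast
  note C = rep_cont[OF T r]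
  define m where "m = int_t (int_t w)"
  define p where "p x t = int_x m x t + slope m t" for x t
  define q where "q = bvp (int_t w)"
  define s where "s x t = int_x (int_t w) x t + slope (int_t w) t" for x t
  note C1 = cont_rect_int_t[OF C]
  have Cm: "cont_rect 1 T m" unfolding m_def by (rule cont_rect_int_t[OF C1])
  have Cslope: "cont_rect 1 T (\<lambda>x t. slope f t)" if "cont_rect 1 T f" for f
    unfolding slope_def cont_rect_def
    using cont_rect_edge[OF cont_rect_int_x[OF cont_rect_int_x[OF that]]] by (intro continuous_on_minus) (simp add: cont_rect_def)
  have Cp: "cont_rect 1 T p" using cont_rect_lin[OF cont_rect_int_x[OF Cm] Cslope[OF Cm], of 1] by (simp add: p_def[abs_def])
  have Cs: "cont_rect 1 T s" using cont_rect_lin[OF cont_rect_int_x[OF C1] Cslope[OF C1], of 1] by (simp add: s_def[abs_def])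
  have Cq: "cont_rect 1 T q" unfolding q_def by (rule cont_rect_bvp[OF C1])
  \<comment> \<open>The wave equation: \<open>m = v\<^sub>x\<^sub>x\<close> and \<open>bvp w = v\<^sub>t\<^sub>t\<close>.\<close>
  have mb: "eq_Omega T m (bvp w)" using L_eq[OF T r] L0 by (simp add: eq_Omega_def m_def)
  have pX: "((\<lambda>x. p x t) has_vector_derivative m x t) (at x within {0..1})" if "x \<in> {0..1}" "t \<in> {0..T}" for x t
    unfolding p_def by (rule bvp_deriv2[OF Cm that])
  have qX: "((\<lambda>x. q x t) has_vector_derivative s x t) (at x within {0..1})" if "x \<in> {0..1}" "t \<in> {0..T}" for x t
    unfolding q_def s_def by (rule bvp_deriv[OF C1 that])
  have pT: "((\<lambda>t. p x t) has_vector_derivative s x t) (at t within {0..T})" if x: "x \<in> {0..1}" and t: "t \<in> {0..T}" for x t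
  proof -
    have "((\<lambda>t. int_x m x t) has_vector_derivative int_x (int_t w) x t) (at t within {0..T})"
      using has_vector_derivative_cong_Icc[OF t, of "\<lambda>t. int_x m x t" "\<lambda>t. int_t (int_x (int_t w)) x t"]
        int_x_int_t_swap[OF C1 x] int_t_deriv[OF cont_rect_int_x[OF C1] x t] by (simp add: m_def)
    from has_vector_derivative_add[OF this slope_int_t_deriv[OF C1 t]]
    show ?thesis by (simp add: p_def s_def m_def)
  qed
  have qT: "((\<lambda>t. q x t) has_vector_derivative m x t) (at t within {0..T})" if x: "x \<in> {0..1}" and t: "t \<in> {0..T}" for x t
    using has_vector_derivative_cong_Icc[OF t, of "\<lambda>t. q x t" "\<lambda>t. int_t (bvp w) x t"] eq_OmegaD[OF int_t_bvp[OF C] x]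
      int_t_deriv[OF cont_rect_bvp[OF C] x t] eq_OmegaD[OF mb x t] by (simp add: q_def)
  have p0: "p x 0 = 0" and q0: "q x 0 = 0" for x by (simp_all add: p_def q_def m_def slope_def bvp_def int_x_def)
  have qb: "q 0 t = 0" "q 1 t = 0" for t by (simp_all add: q_def bvp_def)
  \<comment> \<open>The common value of \<open>\<partial>\<^sub>t (p\<^sup>2 + q\<^sup>2)\<close> and \<open>\<partial>\<^sub>x (2 p q)\<close>.\<close>
  define z where "z x t = 2 * (p x t * s x t + q x t * m x t)" for x t
  have Cz: "cont_rect 1 T z" using Cp Cs Cq Cm unfolding cont_rect_def z_def by (intro continuous_intros)
  have int_tz: "int_t z x t = p x t * p x t + q x t * q x t" if x: "x \<in> {0..1}" and t: "t \<in> {0..T}" for x t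
  proof -
    have "((\<lambda>t. p x t * p x t + q x t * q x t) has_vector_derivative z x t) (at t within {0..T})" if t: "t \<in> {0..T}" for t
      using has_vector_derivative_add[OF has_vector_derivative_mult[OF pT[OF x t] pT[OF x t]] has_vector_derivative_mult[OF qT[OF x t] qT[OF x t]]]
      by (simp add: z_def algebra_simps)
    from integral_of_derivative_Icc[OF this t] show ?thesis by (simp add: int_t_def p0 q0)
  qed
  have int_xz: "int_x z 1 t = 0" if t: "t \<in> {0..T}" for t
  proof -
    have "((\<lambda>x. 2 * (p x t * q x t)) has_vector_derivative z x t) (at x within {0..1})" if x: "x \<in> {0..1}" for x
      using has_vector_derivative_mult_right[OF has_vector_derivative_mult[OF pX[OF x t] qX[OF x t]], of 2]
      by (simp add: z_def algebra_simps)
    from integral_of_derivative_Icc[OF this, of 1] show ?thesis by (simp add: int_x_def qb)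
  qed
  have p_zero: "p x t = 0" if x: "x \<in> {0..1}" and t: "t \<in> {0..T}" for x t
  proof -
    have one: "(1::real) \<in> {0..1}" by simp
    have "integral {0..1} (\<lambda>x. p x t * p x t + q x t * q x t) = int_x (int_t z) 1 t"
      unfolding int_x_def by (rule integral_cong) (use int_tz t in auto)
    also have "\<dots> = int_t (int_x z) 1 t" by (rule int_x_int_t_swap[OF Cz one t, symmetric])
    also have "\<dots> = integral {0..t} (\<lambda>\<tau>. 0)"
      unfolding int_t_def by (rule integral_cong) (use int_xz t in auto)
    finally have I: "integral {0..1} (\<lambda>x. p x t * p x t + q x t * q x t) = 0" by simp
    have "continuous_on {0..1} (\<lambda>x. p x t * p x t + q x t * q x t)"
      by (intro continuous_intros cont_rect_X[OF Cp t] cont_rect_X[OF Cq t])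
    from integral_eq_0_iff[OF this] I x have "p x t * p x t + q x t * q x t = 0" by simp
    then show ?thesis by (simp add: sum_squares_eq_zero_iff)
  qed
  show ?thesis unfolding eq_Omega_def
  proof (intro ballI)
    fix x t assume x: "x \<in> {0..1::real}" and t: "t \<in> {0..T}"
    have "v x t = bvp m x t"
      using eq_OmegaD[OF eq_Omega_trans[OF rep_u[OF T r] d4_inverse_eq_bvp[OF C]] x t] by (simp add: m_def)
    also have "bvp m x t = bvp m 0 t + integral {0..x} (\<lambda>x. p x t)"
    proof (rule integral_of_derivative_Icc[OF _ x])
      show "((\<lambda>x. bvp m x t) has_vector_derivative p y t) (at y within {0..1})" if "y \<in> {0..1}" for y
        unfolding p_def by (rule bvp_deriv[OF Cm that t])
    qed
    also have "integral {0..x} (\<lambda>x. p x t) = integral {0..x} (\<lambda>x. 0)"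
      by (rule integral_cong) (use p_zero t x in auto)
    finally show "v x t = 0" by (simp add: bvp_def)
  qed
qed

section \<open>Gram--Schmidt expansion of the solution\<close>

context
  fixes T :: real
  assumes T: "0 < T"
begin

interpretation V: complete_semi_inner_space "W T" "inner_W T" comb "\<lambda>x t. 0" by (rule W_complete[OF T])

lemma W_sum:
  fixes n :: nat
  assumes "\<And>j. j < n \<Longrightarrow> f j \<in> W T"
  shows "(\<lambda>x t. \<Sum>j<n. k j * f j x t) \<in> W T"
  using assms
proof (induction n)
  case 0
  show ?case using V.zero_in by simp
next
  case (Suc n)
  have "comb (\<lambda>x t. \<Sum>j<n. k j * f j x t) (k n) (f n) \<in> W T" by (rule V.lc_in) (use Suc in auto)
  then show ?case by simp
qed

lemma inner_W_sum:
  fixes n :: nat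
  assumes "\<And>j. j < n \<Longrightarrow> f j \<in> W T" "g \<in> W T"
  shows "inner_W T g (\<lambda>x t. \<Sum>j<n. k j * f j x t) = (\<Sum>j<n. k j * inner_W T g (f j))"
  using assms
proof (induction n)
  case 0
  then show ?case using V.ip_zero_right by simp
next
  case (Suc n)
  have "inner_W T g (comb (\<lambda>x t. \<Sum>j<n. k j * f j x t) (k n) (f n)) = inner_W T g (\<lambda>x t. \<Sum>j<n. k j * f j x t) + k n * inner_W T g (f n)"
    by (rule V.ip_lc_right) (use Suc W_sum[of n f k] in auto)
  then show ?case using Suc by simp
qed

text \<open>\<open>L v\<close> is continuous, so it vanishes on all of \<open>\<Omega>\<close>.\<close>

lemma L_dense_zero:
  assumes v: "v \<in> W T" and dense: "Omega T \<subseteq> closure S" "S \<subseteq> Omega T" and z: "\<And>q. q \<in> S \<Longrightarrow> L T v (fst q) (snd q) = 0"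
  shows "inner_W T v v = 0"
proof -
  obtain w a b c d e where r: "W_rep T v w a b c d e" using W_rep_exists[OF T v] by blast
  obtain a1 b1 c1 d1 where l: "mixed_L2 1 T (L T v) a1 b1 c1 d1" by (rule L_mixed_L2_le[OF T r])
  have "closed (Omega T)" unfolding Omega_cbox by (rule closed_cbox)
  then have cl: "closure S = Omega T" using dense closure_minimal by blast
  have "continuous_on (closure S) (\<lambda>q. L T v (fst q) (snd q))"
    using mixed_L2_cont_rect[OF l] by (simp add: cont_rect_def cl Omega_def)
  from continuous_constant_on_closure[OF this z]
  have "L T v x t = 0" if "x \<in> {0..1}" "t \<in> {0..T}" for x t
    using that cl by (force simp: Omega_def)
  from wave_unique[OF T v this] have "eq_Omega T v (\<lambda>x t. 0)" .
  from inner_W_eq_Omega(2)[OF T V.zero_in V.zero_in this this] show ?thesis using V.ip_zero[OF V.zero_in] by simp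
qed

context
  fixes \<Psi> :: "nat \<Rightarrow> real \<Rightarrow> real \<Rightarrow> real"
  assumes \<Psi>: "\<And>i. \<Psi> i \<in> W T"
begin

definition residual :: "nat \<Rightarrow> real \<Rightarrow> real \<Rightarrow> real" where
  "residual i = (\<lambda>x t. \<Psi> i x t - (\<Sum>j<i. inner_W T (\<Psi> i) (gram_schmidt_W T \<Psi> j) * gram_schmidt_W T \<Psi> j x t))"

lemma residual_W:
  assumes e: "\<And>j. j < i \<Longrightarrow> gram_schmidt_W T \<Psi> j \<in> W T"
  shows "residual i \<in> W T"
    and "g \<in> W T \<Longrightarrow> inner_W T g (residual i) = inner_W T g (\<Psi> i)
      - (\<Sum>j<i. inner_W T (\<Psi> i) (gram_schmidt_W T \<Psi> j) * inner_W T g (gram_schmidt_W T \<Psi> j))"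
proof -
  let ?S = "\<lambda>x t. \<Sum>j<i. inner_W T (\<Psi> i) (gram_schmidt_W T \<Psi> j) * gram_schmidt_W T \<Psi> j x t"
  have S: "?S \<in> W T" by (rule W_sum[OF e])
  have eq: "residual i = comb (\<Psi> i) (-1) ?S" by (simp add: residual_def)
  show "residual i \<in> W T" unfolding eq by (rule V.lc_in[OF \<Psi> S])
  show "inner_W T g (residual i) = inner_W T g (\<Psi> i)
      - (\<Sum>j<i. inner_W T (\<Psi> i) (gram_schmidt_W T \<Psi> j) * inner_W T g (gram_schmidt_W T \<Psi> j))" if g: "g \<in> W T"
  proof -
    have sum: "inner_W T g ?S = (\<Sum>j<i. inner_W T (\<Psi> i) (gram_schmidt_W T \<Psi> j) * inner_W T g (gram_schmidt_W T \<Psi> j))"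
      by (rule inner_W_sum[OF e g])
    show ?thesis unfolding eq V.ip_lc_right[OF \<Psi> S g] sum by simp
  qed
qed

lemma gram_schmidt_step:
  assumes "\<not> in_previous_span T \<Psi> i"
  shows "gram_schmidt_W T \<Psi> i = comb (\<lambda>x t. 0) (1 / norm_W T (residual i)) (residual i)"
  using assms by (simp add: gram_schmidt_W.simps[of T \<Psi> i] residual_def Let_def)

lemma gram_schmidt_dependent: "in_previous_span T \<Psi> i \<Longrightarrow> gram_schmidt_W T \<Psi> i = (\<lambda>x t. 0)"
  by (simp add: gram_schmidt_W.simps[of T \<Psi> i])

text \<open>The value \<open>0\<close> of \<open>\<langle>e\<^sub>i, e\<^sub>i\<rangle>\<close> covers dependent indices as well as a residual of norm \<open>0\<close>, for which the
  division by the norm yields the zero function.\<close>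

lemma gram_schmidt_props:
  "gram_schmidt_W T \<Psi> i \<in> W T \<and> (\<forall>j<i. inner_W T (gram_schmidt_W T \<Psi> i) (gram_schmidt_W T \<Psi> j) = 0) \<and>
   (inner_W T (gram_schmidt_W T \<Psi> i) (gram_schmidt_W T \<Psi> i) = 0 \<or> inner_W T (gram_schmidt_W T \<Psi> i) (gram_schmidt_W T \<Psi> i) = 1)"
proof (induction i rule: less_induct)
  case (less i)
  let ?e = "gram_schmidt_W T \<Psi>"
  have e: "\<And>j. j < i \<Longrightarrow> ?e j \<in> W T" using less by blast
  show ?case
  proof (cases "in_previous_span T \<Psi> i")
    case True
    then show ?thesis using V.zero_in V.ip_zero e by (simp add: gram_schmidt_dependent)
  next
    case False
    have R: "residual i \<in> W T" by (rule residual_W(1)) (rule e)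
    have RI: "inner_W T g (residual i) = inner_W T g (\<Psi> i) - (\<Sum>j<i. inner_W T (\<Psi> i) (?e j) * inner_W T g (?e j))"
      if "g \<in> W T" for g
      by (rule residual_W(2)[OF _ that]) (rule e)
    define \<nu> where "\<nu> = norm_W T (residual i)"
    have ei: "?e i = comb (\<lambda>x t. 0) (1 / \<nu>) (residual i)" unfolding \<nu>_def by (rule gram_schmidt_step[OF False])
    have W: "?e i \<in> W T" unfolding ei by (rule V.lc_in[OF V.zero_in R])
    have ip: "inner_W T (?e i) g = inner_W T (residual i) g / \<nu>" if "g \<in> W T" for g
    proof -
      have "inner_W T (?e i) g = inner_W T (\<lambda>x t. 0) g + (1 / \<nu>) * inner_W T (residual i) g"
        unfolding ei by (rule V.ip_lc[OF V.zero_in R that])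
      then show ?thesis by (simp add: V.ip_zero[OF that])
    qed
    have "inner_W T (residual i) (?e j) = 0" if j: "j < i" for j
    proof -
      have o: "inner_W T (?e j) (?e l) = (if l = j then inner_W T (?e j) (?e j) else 0)" if l: "l < i" for l
      proof (cases l j rule: linorder_cases)
        case less then show ?thesis using less.IH[OF j] by simp
      next
        case greater
        then show ?thesis using less.IH[OF l] V.ip_sym[OF e[OF j] e[OF l]] by simp
      qed simp
      have "(\<Sum>l<i. inner_W T (\<Psi> i) (?e l) * inner_W T (?e j) (?e l)) = (\<Sum>l<i. if l = j then inner_W T (\<Psi> i) (?e j) * inner_W T (?e j) (?e j) else 0)"
      proof (rule sum.cong[OF refl])
        fix l assume "l \<in> {..<i}"
        then have "l < i" by simp
        show "inner_W T (\<Psi> i) (?e l) * inner_W T (?e j) (?e l) = (if l = j then inner_W T (\<Psi> i) (?e j) * inner_W T (?e j) (?e j) else 0)"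
          by (subst o[OF \<open>l < i\<close>]) simp
      qed
      also have "\<dots> = inner_W T (\<Psi> i) (?e j) * inner_W T (?e j) (?e j)" using j by simp
      also have "\<dots> = inner_W T (\<Psi> i) (?e j)"
        using less.IH[OF j] V.Cauchy_Schwarz[OF \<Psi>[of i] e[OF j]] by auto
      finally have "inner_W T (?e j) (residual i) = 0"
        unfolding RI[OF e[OF j]] using V.ip_sym[OF e[OF j] \<Psi>[of i]] by simp
      then show ?thesis using V.ip_sym[OF e[OF j] R] by simp
    qed
    then have orth: "\<forall>j<i. inner_W T (?e i) (?e j) = 0" using ip e by simp
    have "inner_W T (?e i) (?e i) = inner_W T (residual i) (residual i) / \<nu>\<^sup>2"
      using ip[OF W] ip[OF R] V.ip_sym[OF R W] by (simp add: power2_eq_square)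
    moreover have "\<nu>\<^sup>2 = inner_W T (residual i) (residual i)"
      unfolding \<nu>_def norm_W_def by (rule real_sqrt_pow2[OF V.ip_nonneg[OF R]])
    ultimately have "inner_W T (?e i) (?e i) = 0 \<or> inner_W T (?e i) (?e i) = 1" by (cases "\<nu> = 0") auto
    then show ?thesis using W orth by blast
  qed
qed

lemma gram_schmidt_in_W: "gram_schmidt_W T \<Psi> i \<in> W T"
  using gram_schmidt_props by blast

lemma gram_schmidt_orth: "i \<noteq> j \<Longrightarrow> inner_W T (gram_schmidt_W T \<Psi> i) (gram_schmidt_W T \<Psi> j) = 0"
proof (induction i j rule: linorder_wlog)
  case (le i j)
  then have "inner_W T (gram_schmidt_W T \<Psi> j) (gram_schmidt_W T \<Psi> i) = 0" using gram_schmidt_props[of j] by simp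
  then show ?case using V.ip_sym[OF gram_schmidt_in_W gram_schmidt_in_W] by simp
next
  case (sym i j)
  then show ?case using V.ip_sym[OF gram_schmidt_in_W gram_schmidt_in_W] by simp
qed

text \<open>Each \<open>\<Psi>\<^sub>i\<close> is, up to a vector of norm \<open>0\<close>, a combination of Gram--Schmidt vectors or, at a dependent
  index, of earlier \<open>\<Psi>\<^sub>k\<close>.\<close>

lemma orthogonal_to_generators:
  assumes v: "v \<in> W T" and o: "\<And>i. inner_W T v (gram_schmidt_W T \<Psi> i) = 0"
  shows "inner_W T v (\<Psi> i) = 0"
proof (induction i rule: less_induct)
  case (less i)
  show ?case
  proof (cases "in_previous_span T \<Psi> i")
    case True
    then obtain c where c: "\<forall>(x, t)\<in>Omega T. \<Psi> i x t = (\<Sum>k<i. c k * \<Psi> k x t)" unfolding in_previous_span_def by blast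
    have S: "(\<lambda>x t. \<Sum>k<i. c k * \<Psi> k x t) \<in> W T" by (rule W_sum[OF \<Psi>])
    have "eq_Omega T (\<Psi> i) (\<lambda>x t. \<Sum>k<i. c k * \<Psi> k x t)" using c by (auto simp: eq_Omega_def Omega_def)
    from inner_W_eq_Omega(2)[OF T v S eq_Omega_refl this]
    have "inner_W T v (\<Psi> i) = inner_W T v (\<lambda>x t. \<Sum>k<i. c k * \<Psi> k x t)" .
    also have "\<dots> = (\<Sum>k<i. c k * inner_W T v (\<Psi> k))" by (rule inner_W_sum[OF \<Psi> v])
    also have "\<dots> = 0" using less by (intro sum.neutral) auto
    finally show ?thesis .
  next
    case False
    note R = residual_W(1)[OF gram_schmidt_in_W, of i]
    have "inner_W T v (residual i) = 0"
    proof (cases "norm_W T (residual i) = 0")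
      case True
      then have "inner_W T (residual i) (residual i) = 0" by (simp add: norm_W_def)
      then show ?thesis using V.Cauchy_Schwarz[OF v R] by simp
    next
      case nz: False
      have "inner_W T v (gram_schmidt_W T \<Psi> i) = (1 / norm_W T (residual i)) * inner_W T v (residual i)"
        unfolding gram_schmidt_step[OF False] V.ip_lc_right[OF V.zero_in R v] by (simp add: V.ip_zero_right[OF v])
      then show ?thesis using o[of i] nz by simp
    qed
    then show ?thesis using residual_W(2)[OF gram_schmidt_in_W v, of i] by (simp add: o)
  qed
qed

end

end

text \<open>The series is the Fourier series of \<open>u\<close> along the Gram--Schmidt vectors, whose coefficients the adjoint
  evaluates at the points \<open>(x\<^sub>k, t\<^sub>k)\<close>.\<close>

theorem theorem3p2:
  fixes T :: real
    and M :: "real \<Rightarrow> real \<Rightarrow> real \<Rightarrow> real"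
    and u :: "real \<Rightarrow> real \<Rightarrow> real"
    and xs ts :: "nat \<Rightarrow> real"
    and \<Psi> :: "nat \<Rightarrow> real \<Rightarrow> real \<Rightarrow> real"
    and \<beta> :: "nat \<Rightarrow> nat \<Rightarrow> real"
  assumes "T > 0"
    and "range (\<lambda>i. (xs i, ts i)) \<subseteq> Omega T"
    and "Omega T \<subseteq> closure (range (\<lambda>i. (xs i, ts i)))"
    and "u \<in> W T"
    and "\<And>x t. (x, t) \<in> Omega T \<Longrightarrow> L T u x t = M x t (u x t)"
    and "\<And>x. x \<in> {0..1} \<Longrightarrow> u x 0 = 0 \<and> dT T u x 0 = 0"
    and "\<And>t. t \<in> {0..T} \<Longrightarrow> u 0 t = 0 \<and> u 1 t = 0"
    and "\<And>i. \<Psi> i = Lstar T (G (xs i) (ts i))"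
    and "gram_schmidt_coeffs T \<Psi> \<beta>"
  shows "converges_in_W T
           (\<lambda>n x t. \<Sum>i<n. (\<Sum>k\<le>i. \<beta> i k * M (xs k) (ts k) (u (xs k) (ts k)))
                              * gram_schmidt_W T \<Psi> i x t) u
       \<and> (\<forall>(x, t)\<in>Omega T.
            (\<lambda>i. (\<Sum>k\<le>i. \<beta> i k * M (xs k) (ts k) (u (xs k) (ts k)))
                   * gram_schmidt_W T \<Psi> i x t) sums u x t)"
proof -
  note T = assms(1) and u = assms(4)
  interpret V: complete_semi_inner_space "W T" "inner_W T" comb "\<lambda>x t. 0" by (rule W_complete[OF T])
  let ?e = "gram_schmidt_W T \<Psi>"
  define \<alpha> where "\<alpha> i = (\<Sum>k\<le>i. \<beta> i k * M (xs k) (ts k) (u (xs k) (ts k)))" for i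
  define S where "S n = (\<lambda>x t. \<Sum>i<n. \<alpha> i * ?e i x t)" for n
  have pt: "(xs i, ts i) \<in> Omega T" for i using assms(2) by blast
  then have xt: "xs i \<in> {0..1}" "ts i \<in> {0..T}" for i by (auto simp: Omega_def)
  have \<Psi>: "\<Psi> i \<in> W T" for i unfolding assms(8) by (rule adjoint_evaluation(2)[OF T xt u])
  have ev: "inner_W T v (\<Psi> i) = L T v (xs i) (ts i)" if "v \<in> W T" for v i
    unfolding assms(8) by (rule adjoint_evaluation(1)[OF T xt that])
  note e = gram_schmidt_in_W[OF T, of \<Psi>, OF \<Psi>]
  note orth = gram_schmidt_orth[OF T, of \<Psi>, OF \<Psi>]
  have coeff: "inner_W T u (?e i) = \<alpha> i" for i
  proof -
    have "eq_Omega T (?e i) (\<lambda>x t. \<Sum>k<Suc i. \<beta> i k * \<Psi> k x t)"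
      unfolding eq_Omega_def lessThan_Suc_atMost
    proof (intro ballI)
      fix x t assume "x \<in> {0..1::real}" "t \<in> {0..T}"
      then have q: "(x, t) \<in> Omega T" by (simp add: Omega_def)
      have "\<forall>(x, t)\<in>Omega T. ?e i x t = (\<Sum>k\<le>i. \<beta> i k * \<Psi> k x t)"
        using assms(9)[unfolded gram_schmidt_coeffs_def, THEN spec, of i] by (rule conjunct1)
      from bspec[OF this q] show "?e i x t = (\<Sum>k\<le>i. \<beta> i k * \<Psi> k x t)" by simp
    qed
    from inner_W_eq_Omega(2)[OF T u W_sum[OF T \<Psi>] eq_Omega_refl this]
    have "inner_W T u (?e i) = inner_W T u (\<lambda>x t. \<Sum>k<Suc i. \<beta> i k * \<Psi> k x t)" .
    also have "\<dots> = (\<Sum>k<Suc i. \<beta> i k * inner_W T u (\<Psi> k))" by (rule inner_W_sum[OF T \<Psi> u])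
    also have "\<dots> = \<alpha> i" unfolding \<alpha>_def lessThan_Suc_atMost using ev[OF u] assms(5)[OF pt] by simp
    finally show ?thesis .
  qed
  have total: "inner_W T v v = 0" if v: "v \<in> W T" and o: "\<And>i. inner_W T v (?e i) = 0" for v
  proof (rule L_dense_zero[OF T v assms(3,2)])
    fix q assume "q \<in> range (\<lambda>i. (xs i, ts i))"
    then obtain i where "q = (xs i, ts i)" by blast
    then show "L T v (fst q) (snd q) = 0" using orthogonal_to_generators[OF T, of \<Psi>, OF \<Psi> v o, of i] ev[OF v, of i] by simp
  qed
  have unit: "inner_W T (?e i) (?e i) = 0 \<or> inner_W T (?e i) (?e i) = 1" for i
    using gram_schmidt_props[OF T, of \<Psi> i, OF \<Psi>] by (elim conjE)
  have S0: "S 0 = (\<lambda>x t. 0)" by (simp add: S_def)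
  have SS: "S (Suc n) = comb (S n) (inner_W T u (?e n)) (?e n)" for n by (simp add: S_def coeff)
  have conv: "(\<lambda>n. V.sqdist (S n) u) \<longlonglongrightarrow> 0"
    by (rule V.orthonormal_expansion[OF u e orth unit total S0 SS])
  have SW: "S n \<in> W T" for n unfolding S_def by (rule W_sum[OF T e])
  have sq: "V.sqdist (S n) u = inner_W T (\<lambda>x t. S n x t - u x t) (\<lambda>x t. S n x t - u x t)" for n
    by (simp add: V.sqdist_def)
  have "(\<lambda>n. sqrt (V.sqdist (S n) u)) \<longlonglongrightarrow> sqrt 0" by (rule tendsto_real_sqrt[OF conv])
  then have "(\<lambda>n. norm_W T (\<lambda>x t. S n x t - u x t)) \<longlonglongrightarrow> 0" by (simp add: norm_W_def sq)
  then have A: "converges_in_W T S u" using SW u by (simp add: converges_in_W_def)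
  obtain C where C: "0 \<le> C" "\<And>u x t. u \<in> W T \<Longrightarrow> x \<in> {0..1} \<Longrightarrow> t \<in> {0..T} \<Longrightarrow> (u x t)\<^sup>2 \<le> C * inner_W T u u"
    using W_point_bound[OF T] by blast
  have B: "(\<lambda>i. \<alpha> i * ?e i x t) sums u x t" if "(x, t) \<in> Omega T" for x t
  proof -
    have x: "x \<in> {0..1}" and t: "t \<in> {0..T}" using that by (auto simp: Omega_def)
    have le: "(S n x t - u x t)\<^sup>2 \<le> C * V.sqdist (S n) u" for n
      using C(2)[OF V.lc_in[OF SW[of n] u, of "-1"] x t] by (simp add: V.sqdist_def)
    have "(\<lambda>n. C * V.sqdist (S n) u) \<longlonglongrightarrow> C * 0" by (intro tendsto_mult tendsto_const conv)
    then have lim: "(\<lambda>n. C * V.sqdist (S n) u) \<longlonglongrightarrow> 0" by simp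
    have "(\<lambda>n. (S n x t - u x t)\<^sup>2) \<longlonglongrightarrow> 0"
      by (rule tendsto_sandwich[OF always_eventually always_eventually tendsto_const lim])
         (rule allI, rule zero_le_power2, rule allI, rule le)
    then have "(\<lambda>n. S n x t - u x t) \<longlonglongrightarrow> 0" by (simp only: power_tendsto_0_iff pos2)
    then have "(\<lambda>n. S n x t) \<longlonglongrightarrow> u x t" by (simp add: LIM_zero_iff)
    then show ?thesis by (simp add: sums_def S_def)
  qed
  show ?thesis using A B unfolding S_def \<alpha>_def by blast
qed

end
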